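(* Let $m\ge 2$ and $1<p_i<\infty$ for $i=1,\dots,m$, with $\frac1p=\sum_{i=1}^m\frac1{p_i}$. Let $\frac{\alpha_i}{n}=\frac1{p_i}-\frac1{q_i}\in(0,1)$, $\alpha=\sum_{i=1}^m\alpha_i$, $\frac1q=\sum_{i=1}^m\frac1{q_i}$. Let $\vec\omega=(\omega_1,\dots,\omega_m)\in A_{\vec P,q}$ with $\omega_i^{q_i}\in A_\infty$ for $i=1,\dots,m$, and let $(\vec\varphi_1,\varphi_2)=(\varphi_{11},\dots,\varphi_{1m},\varphi_2)$ be non-negative measurable functions on $\mathbb R^n\times(0,\infty)$ satisfying $$[\vec\varphi_1,\varphi_2]_A':=\sup_{x\in\mathbb R^n,r>0}\varphi_2(x,r)^{-1}\sup_{t>r}\Big(1+\log\frac tr\Big)^m\frac{\operatorname{essinf}_{t<\eta<\infty}\prod_{i=1}^m\varphi_{1i}(x,\eta)\|\omega_i\|_{L^{p_i}(B(x,\eta))}}{\prod_{i=1}^m\|\omega_i\|_{L^{q_i}(B(x,t))}}<\infty.$$ If $\vec b=(b_1,\dots,b_m)\in({\rm BMO})^m$, then $\mathcal M_{\alpha,\prod\vec b}$ is bounded from $M^{p_1,\varphi_{11}}(\omega_1^{p_1})\times\cdots\times M^{p_m,\varphi_{1m}}(\omega_m^{p_m})$ to $M^{q,\varphi_2}(u_{\vec\omega}^q)$, and its operator norm satisfies $\|\mathcal M_{\alpha,\prod\vec b}\|\lesssim\prod_{i=1}^m\|b_i\|_{\rm BMO}$.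
   Context: A weight is a nonnegative locally integrable function on $\mathbb R^n$, positive a.e.; $w(E)=\int_E w$. $B(x,r)$ is the open ball. For $1\le s<\infty$ and a ball $B$: $\|w\|_{L^s(B)}=(\int_B w^s)^{1/s}$, $\|f\|_{L^s(B,w)}=(\int_B|f|^s w)^{1/s}$. $A_\infty=\bigcup_{1\le p<\infty}A_p$. ${\rm BMO}$ is the space of bounded mean oscillation with $\|b\|_{\rm BMO}=\sup_B\frac1{|B|}\int_B|b-b_B|$, $b_B=\frac1{|B|}\int_Bb$. Generalized weighted Morrey space: for $1\le s<\infty$, a weight $w$ and positive measurable $\varphi$ on $\mathbb R^n\times(0,\infty)$, $M^{s,\varphi}(w)$ is the set of $f$ with $\|f\|_{M^{s,\varphi}(w)}:=\sup_{x,r>0}\varphi(x,r)^{-1}w(B(x,r))^{-1/s}\|f\|_{L^s(B(x,r),w)}<\infty$. For $\vec\omega=(\omega_1,\dots,\omega_m)$, $u_{\vec\omega}=\prod_i\omega_i$; $\vec\omega\in A_{\vec P,q}$ means $\sup_B\big(\frac1{|B|}\int_B u_{\vec\omega}^q\big)^{1/q}\prod_{i=1}^m\big(\frac1{|B|}\int_B\omega_i^{-p_i'}\big)^{1/p_i'}<\infty$. The iterated commutator of the multilinear fractional maximal operator is $\mathcal M_{\alpha,\prod\vec b}(\vec f)(x)=\sup_{r>0}|B(x,r)|^{\frac{\alpha}{n}-m}\int_{B(x,r)^m}\prod_{i=1}^m|b_i(x)-b_i(y_i)||f_i(y_i)|\,dy_1\cdots dy_m$. Boundedness from $X_1\times\cdots\times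 X_m$ to $Y$ means $\|T(\vec f)\|_Y\le C\prod\|f_i\|_{X_i}$; the operator norm is the least such $C$; $A\lesssim B$ means $A\le CB$ with $C$ independent of $\vec b$ and $\vec f$. *)

theory Defs
  imports "HOL-Analysis.Analysis"
begin

text \<open>Power of an extended nonnegative real with a positive real exponent
  (used only with exponents a > 0): top stays top.\<close>
definition enn_powr :: "ennreal \<Rightarrow> real \<Rightarrow> ennreal" where
  "enn_powr x a = (if x = top then top else ennreal (enn2real x powr a))"

definition ball_meas :: "'a::euclidean_space \<Rightarrow> real \<Rightarrow> ennreal" where
  "ball_meas x r = emeasure lebesgue (ball x r)"

definition ess_inf_on :: "'b::euclidean_space set \<Rightarrow> ('b \<Rightarrow> ennreal) \<Rightarrow> ennreal" where
  "ess_inf_on S g = Sup {c. AE y in lebesgue. y \<in> S \<longrightarrow> c \<le> g y}"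

definition is_weight :: "('a::euclidean_space \<Rightarrow> real) \<Rightarrow> bool" where
  "is_weight w \<longleftrightarrow> w \<in> borel_measurable lebesgue \<and> (\<forall>x. 0 \<le> w x)
     \<and> (\<forall>K. compact K \<longrightarrow> set_integrable lebesgue K w)
     \<and> (AE x in lebesgue. 0 < w x)"

definition wmeas :: "('a::euclidean_space \<Rightarrow> real) \<Rightarrow> 'a set \<Rightarrow> ennreal" where
  "wmeas w E = (\<integral>\<^sup>+ y \<in> E. ennreal (w y) \<partial>lebesgue)"

definition A_class :: "real \<Rightarrow> ('a::euclidean_space \<Rightarrow> real) \<Rightarrow> bool" where
  "A_class p w \<longleftrightarrow> is_weight w \<and>
     (if p = 1 then
        (\<exists>C::real. \<forall>x. \<forall>r>0.
           wmeas w (ball x r) / ball_meas x r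
             \<le> ennreal C * ess_inf_on (ball x r) (\<lambda>y. ennreal (w y)))
      else
        (\<exists>C::real. \<forall>x. \<forall>r>0.
           (wmeas w (ball x r) / ball_meas x r) *
           enn_powr ((\<integral>\<^sup>+ y \<in> ball x r. ennreal (w y powr (-1 / (p - 1))) \<partial>lebesgue)
                       / ball_meas x r) (p - 1)
           \<le> ennreal C))"

definition A_infty :: "('a::euclidean_space \<Rightarrow> real) \<Rightarrow> bool" where
  "A_infty w \<longleftrightarrow> (\<exists>p. 1 \<le> p \<and> A_class p w)"

definition A_multi :: "nat \<Rightarrow> (nat \<Rightarrow> real) \<Rightarrow> real \<Rightarrow> (nat \<Rightarrow> 'a::euclidean_space \<Rightarrow> real) \<Rightarrow> bool" where
  "A_multi m p q om \<longleftrightarrow>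
     (\<exists>C::real. \<forall>x. \<forall>r>0.
        enn_powr ((\<integral>\<^sup>+ y \<in> ball x r. ennreal ((\<Prod>i<m. om i y) powr q) \<partial>lebesgue)
                   / ball_meas x r) (1 / q) *
        (\<Prod>i<m. enn_powr ((\<integral>\<^sup>+ y \<in> ball x r.
                     ennreal (om i y powr (- (p i / (p i - 1)))) \<partial>lebesgue) / ball_meas x r)
                   (1 / (p i / (p i - 1))))
        \<le> ennreal C)"

definition ball_avg :: "('a::euclidean_space \<Rightarrow> real) \<Rightarrow> 'a \<Rightarrow> real \<Rightarrow> real" where
  "ball_avg b x r = (\<integral> y \<in> ball x r. b y \<partial>lebesgue) / measure lebesgue (ball x r)"

definition bmo_norm :: "('a::euclidean_space \<Rightarrow> real) \<Rightarrow> ennreal" where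
  "bmo_norm b = (SUP xr \<in> {xr :: 'a \<times> real. 0 < snd xr}.
      (\<integral>\<^sup>+ y \<in> ball (fst xr) (snd xr). ennreal \<bar>b y - ball_avg b (fst xr) (snd xr)\<bar> \<partial>lebesgue)
        / ball_meas (fst xr) (snd xr))"

definition in_BMO :: "('a::euclidean_space \<Rightarrow> real) \<Rightarrow> bool" where
  "in_BMO b \<longleftrightarrow> b \<in> borel_measurable lebesgue
     \<and> (\<forall>x. \<forall>r>0. set_integrable lebesgue (ball x r) b) \<and> bmo_norm b < top"

definition morrey_norm :: "real \<Rightarrow> ('a::euclidean_space \<Rightarrow> real \<Rightarrow> real) \<Rightarrow> ('a \<Rightarrow> real)
    \<Rightarrow> ('a \<Rightarrow> ennreal) \<Rightarrow> ennreal" where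
  "morrey_norm s \<phi> w F = (SUP xr \<in> {xr :: 'a \<times> real. 0 < snd xr}.
      inverse (ennreal (\<phi> (fst xr) (snd xr))) *
      inverse (enn_powr (wmeas w (ball (fst xr) (snd xr))) (1 / s)) *
      enn_powr (\<integral>\<^sup>+ y \<in> ball (fst xr) (snd xr). enn_powr (F y) s * ennreal (w y) \<partial>lebesgue) (1 / s))"

definition in_morrey :: "real \<Rightarrow> ('a::euclidean_space \<Rightarrow> real \<Rightarrow> real) \<Rightarrow> ('a \<Rightarrow> real)
    \<Rightarrow> ('a \<Rightarrow> ennreal) \<Rightarrow> bool" where
  "in_morrey s \<phi> w F \<longleftrightarrow> F \<in> borel_measurable lebesgue \<and> morrey_norm s \<phi> w F < top"

definition frac_max_comm :: "nat \<Rightarrow> real \<Rightarrow> (nat \<Rightarrow> 'a::euclidean_space \<Rightarrow> real)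
    \<Rightarrow> (nat \<Rightarrow> 'a \<Rightarrow> real) \<Rightarrow> 'a \<Rightarrow> ennreal" where
  "frac_max_comm m \<alpha> b f x = (SUP r \<in> {0<..}.
     ennreal (measure lebesgue (ball x r) powr (\<alpha> / real DIM('a) - real m)) *
     (\<integral>\<^sup>+ ys \<in> (\<Pi>\<^sub>E i\<in>{..<m}. ball x r).
        ennreal (\<Prod>i<m. \<bar>b i x - b i (ys i)\<bar> * \<bar>f i (ys i)\<bar>)
      \<partial>(\<Pi>\<^sub>M i\<in>{..<m}. (lebesgue :: 'a measure))))"

definition A_prime_const :: "nat \<Rightarrow> (nat \<Rightarrow> real) \<Rightarrow> (nat \<Rightarrow> real) \<Rightarrow> (nat \<Rightarrow> 'a::euclidean_space \<Rightarrow> real)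
    \<Rightarrow> (nat \<Rightarrow> 'a \<Rightarrow> real \<Rightarrow> real) \<Rightarrow> ('a \<Rightarrow> real \<Rightarrow> real) \<Rightarrow> ennreal" where
  "A_prime_const m p q om \<phi>1 \<phi>2 = (SUP xr \<in> {xr :: 'a \<times> real. 0 < snd xr}.
     inverse (ennreal (\<phi>2 (fst xr) (snd xr))) *
     (SUP t \<in> {snd xr<..}.
        ennreal ((1 + ln (t / snd xr)) ^ m) *
        ess_inf_on {t<..} (\<lambda>\<eta>. \<Prod>i<m. ennreal (\<phi>1 i (fst xr) \<eta>) *
             enn_powr (\<integral>\<^sup>+ y \<in> ball (fst xr) \<eta>. ennreal (om i y powr p i) \<partial>lebesgue) (1 / p i))
        / (\<Prod>i<m. enn_powr (\<integral>\<^sup>+ y \<in> ball (fst xr) t. ennreal (om i y powr q i) \<partial>lebesgue) (1 / q i))))"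

end

theory Submission
  imports Defs
begin
text \<open>
  Hoelder's inequality for the weights \<open>\<omega>\<^sub>i\<^bsup>q\<^sub>i\<^esup>\<close> and their
  dual weights bounds the product of their averages by the average of the geometric mean. Hence the
  multilinear condition splits into the linear conditions \<open>\<omega>\<^sub>i \<in> A(p\<^sub>i, q\<^sub>i)\<close>, and the multilinear
  maximal commutator is dominated by the product of the linear ones.

  The linear maximal commutator is treated by conjugation: from \<open>|t| \<le> e\<^sup>t + e\<^sup>-\<^sup>t\<close> it is bounded by
  \<open>e\<^sup>\<plusminus>\<^sup>b M(e\<^sup>\<minusplus>\<^sup>b f)\<close> after scaling \<open>b\<close>, and \<open>\<omega> e\<^sup>\<plusminus>\<^sup>b\<close> satisfies the same weight condition uniformly.
  This uniformity is a John-Nirenberg inequality relative to a weight, proved by one dyadic stopping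
  step: the stopped set has at most half of the Lebesgue measure of the cube, hence at most a fixed
  fraction less than one of its weighted measure, and a supremum over all cubes absorbs the remainder.
  The fractional maximal operator itself is dominated pointwise by a composition of two maximal
  operators taken with respect to the doubling measures \<open>\<omega>\<^sup>q dx\<close> and \<open>\<omega>\<^bsup>-p'\<^esup> dx\<close>.

  On a ball of radius \<open>r\<close>, averages over radii below \<open>r\<close> see only the part of the functions on the
  doubled ball; averages over larger radii are estimated directly, and the logarithmic growth of the
  means of a BMO function produces the factors \<open>(1 + log (t/r))\<^sup>m\<close>.
\<close>

section \<open>Powers of extended nonnegative reals and Hoelder's inequality\<close>

text \<open>Every constant must depend on the weights only through \<theta> and K. Conjugation
  replaces a pair of weights by perturbed pairs that vary with b, so an estimate for one fixed pair
  would be of no use; this is why, in the linear estimates, the quantifier over all pairs stands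
  inside the existence of the constant.

  The size of b enters through a positive bound \<beta> of its norm. The conjugation parameter is a
  constant divided by \<beta>, which gives a bound linear in \<beta>. Since the norm may be zero,
  \<beta> is kept apart from it and tends to it only at the very end.

  The supremum in the multilinear operator runs over one common radius and is at most the product of
  the linear suprema. This loss is affordable for small radii only. For large radii the product has
  to be kept at a common radius, because the condition on (\<phi>1, \<phi>2) controls a product of
  local norms and not its factors.

  Integrals and norms take values in the extended nonnegative reals, so finiteness matters only
  where a quantity is divided out.\<close>

lemma enn_powr_ennreal: "0 \<le> x \<Longrightarrow> enn_powr (ennreal x) a = ennreal (x powr a)"
  by (simp add: enn_powr_def)

lemma enn_powr_top [simp]: "enn_powr top a = top"
  by (simp add: enn_powr_def)

lemma enn_powr_0 [simp]: "enn_powr 0 a = 0"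
  by (simp add: enn_powr_def)

lemma enn_powr_1 [simp]: "enn_powr 1 a = 1"
  by (simp add: enn_powr_def)

lemma enn_powr_one [simp]: "enn_powr x 1 = x"
  by (cases x) (simp_all add: enn_powr_def)

lemma enn_powr_eq_0_iff [simp]: "enn_powr x a = 0 \<longleftrightarrow> x = 0"
  by (cases x) (auto simp: enn_powr_def ennreal_eq_0_iff not_le)

lemma enn_powr_eq_top_iff [simp]: "enn_powr x a = top \<longleftrightarrow> x = top"
  by (simp add: enn_powr_def)

lemma enn_powr_less_top_iff [simp]: "enn_powr x a < top \<longleftrightarrow> x < top"
  by (simp add: less_top[symmetric])

lemma enn_powr_pos_iff [simp]: "0 < enn_powr x a \<longleftrightarrow> 0 < x"
  by (simp add: zero_less_iff_neq_zero)

lemma enn_powr_mono: "x \<le> y \<Longrightarrow> 0 \<le> a \<Longrightarrow> enn_powr x a \<le> enn_powr y a"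
  by (cases x; cases y) (auto simp: enn_powr_def top_unique intro!: ennreal_leI powr_mono2)

text \<open>Valid for all exponents, also with a zero or infinite factor: zero and
  \<open>top\<close> are fixed by \<open>enn_powr\<close>, so 0 * top = 0 is respected on both
  sides.\<close>

lemma enn_powr_mult: "enn_powr (x * y) a = enn_powr x a * enn_powr y a"
  by (cases x; cases y)
     (auto simp: enn_powr_def ennreal_mult_top ennreal_top_mult ennreal_mult_eq_top_iff enn2real_mult
        powr_mult simp flip: ennreal_mult split: if_splits)

lemma enn_powr_prod: "enn_powr (\<Prod>i\<in>I. f i) a = (\<Prod>i\<in>I. enn_powr (f i) a)"
  by (induction I rule: infinite_finite_induct) (auto simp: enn_powr_mult)

lemma enn_powr_powr: "enn_powr (enn_powr x a) b = enn_powr x (a * b)"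
  by (cases x) (simp_all add: enn_powr_def powr_powr)

lemma enn_powr_add: "enn_powr x (a + b) = enn_powr x a * enn_powr x b"
  by (cases x) (simp_all add: enn_powr_def powr_add ennreal_mult ennreal_top_mult)

lemma enn_powr_cancel: "a \<noteq> 0 \<Longrightarrow> enn_powr (enn_powr x a) (1 / a) = x"
  "a \<noteq> 0 \<Longrightarrow> enn_powr (enn_powr x (1 / a)) a = x"
  by (simp_all add: enn_powr_powr)

lemma enn_powr_le_iff: "0 < a \<Longrightarrow> enn_powr x a \<le> enn_powr y a \<longleftrightarrow> x \<le> y"
  by (metis enn_powr_cancel(1) enn_powr_mono less_eq_real_def less_irrefl zero_le_divide_1_iff)

lemma enn_powr_le_iff2: "0 < a \<Longrightarrow> enn_powr x a \<le> y \<longleftrightarrow> x \<le> enn_powr y (1 / a)"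
  using enn_powr_le_iff[of a x "enn_powr y (1/a)"] by (simp add: enn_powr_cancel)

lemma borel_measurable_enn_powr [measurable (raw)]:
  "f \<in> borel_measurable M \<Longrightarrow> (\<lambda>x. enn_powr (f x) a) \<in> borel_measurable M"
proof -
  assume [measurable]: "f \<in> borel_measurable M"
  have "{x \<in> space M. f x = top} = f -` {top} \<inter> space M" by auto
  also have "\<dots> \<in> sets M" by measurable
  finally have [measurable]: "{x \<in> space M. f x = top} \<in> sets M" .
  have "(\<lambda>x. if f x = top then top else ennreal (exp (a * ln (enn2real (f x))) * indicator (- {0}) (enn2real (f x)))) \<in> borel_measurable M"
    by measurable
  moreover have "(\<lambda>x. enn_powr (f x) a) = (\<lambda>x. if f x = top then top else ennreal (exp (a * ln (enn2real (f x))) * indicator (- {0}) (enn2real (f x))))"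
    by (auto simp: enn_powr_def powr_def indicator_def)
  ultimately show ?thesis by simp
qed

lemma ennreal_less_divide_iff:
  fixes a b c :: ennreal
  shows "b \<noteq> 0 \<Longrightarrow> b < top \<Longrightarrow> c < a / b \<longleftrightarrow> c * b < a"
  by (cases a; cases b; cases c)
     (auto simp: divide_ennreal ennreal_mult[symmetric] ennreal_less_iff field_simps ennreal_top_mult ennreal_top_divide)

lemma ennreal_divide_le_iff:
  fixes a b c :: ennreal
  shows "b \<noteq> 0 \<Longrightarrow> b < top \<Longrightarrow> a / b \<le> c \<longleftrightarrow> a \<le> c * b"
  by (meson ennreal_less_divide_iff not_le)

lemma ennreal_mult_le_imp_le: "c \<noteq> 0 \<Longrightarrow> c \<noteq> top \<Longrightarrow> c * x \<le> c * y \<Longrightarrow> x \<le> (y::ennreal)"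
  by (metis ennreal_mult_le_mult_iff)

text \<open>Jensen's inequality for the concave \<open>ln\<close>. A vanishing \<open>x i\<close>
  annihilates the product and is split off, so that logarithms are taken of positive numbers
  only.\<close>

lemma weighted_arith_geom_mean:
  fixes x a :: "'i \<Rightarrow> real"
  assumes "finite I" "I \<noteq> {}" and a: "\<And>i. i \<in> I \<Longrightarrow> 0 < a i" "(\<Sum>i\<in>I. a i) = 1" 
    and x: "\<And>i. i \<in> I \<Longrightarrow> 0 \<le> x i"
  shows "(\<Prod>i\<in>I. x i powr a i) \<le> (\<Sum>i\<in>I. a i * x i)"
proof (cases "\<exists>i\<in>I. x i = 0")
  case True
  then have "(\<Prod>i\<in>I. x i powr a i) = 0"
    using assms(1) by (auto simp: prod_zero_iff)
  then show ?thesis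
    by (simp add: sum_nonneg a x less_imp_le)
next
  case False
  then have pos: "x i > 0" if "i \<in> I" for i
    using x[OF that] that by force
  have "(\<Sum>i\<in>I. a i * ln (x i)) \<le> ln (\<Sum>i\<in>I. a i *\<^sub>R x i)"
    by (intro concave_on_sum[OF assms(1,2) ln_concave])
       (use a pos in \<open>auto simp: less_imp_le\<close>)
  moreover have "0 < (\<Sum>i\<in>I. a i *\<^sub>R x i)"
    using a pos by (intro sum_pos assms) auto
  ultimately have "exp (\<Sum>i\<in>I. a i * ln (x i)) \<le> (\<Sum>i\<in>I. a i *\<^sub>R x i)"
    by (simp add: ln_ge_iff)
  moreover have "exp (\<Sum>i\<in>I. a i * ln (x i)) = (\<Prod>i\<in>I. x i powr a i)"
    by (auto simp: exp_sum[OF assms(1)] powr_def intro!: prod.cong dest: pos)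
  ultimately show ?thesis by simp
qed

lemma weighted_arith_geom_mean_ennreal:
  fixes x :: "'i \<Rightarrow> ennreal" and a :: "'i \<Rightarrow> real"
  assumes "finite I" "I \<noteq> {}" and a: "\<And>i. i \<in> I \<Longrightarrow> 0 < a i" "(\<Sum>i\<in>I. a i) = 1" 
  shows "(\<Prod>i\<in>I. enn_powr (x i) (a i)) \<le> (\<Sum>i\<in>I. ennreal (a i) * x i)"
proof (cases "\<exists>i\<in>I. x i = top")
  case True
  then obtain j where j: "j \<in> I" "x j = top" by auto
  then have "ennreal (a j) * x j = top"
    using a(1)[of j] by (simp add: ennreal_mult_top ennreal_eq_0_iff)
  then have "(\<Sum>i\<in>I. ennreal (a i) * x i) = top"
    using j(1) assms(1) member_le_sum[of j I "\<lambda>i. ennreal (a i) * x i"] by (simp add: top_unique)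
  then show ?thesis by simp
next
  case False
  define y where "y i = enn2real (x i)" for i
  have y: "x i = ennreal (y i)" "0 \<le> y i" if "i \<in> I" for i
    using False that by (auto simp: y_def less_top)
  have "(\<Prod>i\<in>I. enn_powr (x i) (a i)) = (\<Prod>i\<in>I. ennreal (y i powr a i))"
    by (intro prod.cong) (auto simp: y enn_powr_ennreal)
  also have "\<dots> = ennreal (\<Prod>i\<in>I. y i powr a i)"
    by (simp add: prod_ennreal)
  also have "\<dots> \<le> ennreal (\<Sum>i\<in>I. a i * y i)"
    by (intro ennreal_leI weighted_arith_geom_mean assms y)
  also have "\<dots> = (\<Sum>i\<in>I. ennreal (a i * y i))"
    using a y by (simp add: sum_ennreal less_imp_le)
  also have "\<dots> = (\<Sum>i\<in>I. ennreal (a i) * x i)"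
    using a by (intro sum.cong) (auto simp: y ennreal_mult less_imp_le)
  finally show ?thesis .
qed

text \<open>Each factor is normalised by its integral \<open>N i\<close>; the weighted
  arithmetic-geometric mean inequality is then integrated pointwise, and the weights sum to one. A
  factor with integral zero is treated before one with infinite integral, because 0 * top = 0 on the
  right-hand side.\<close>

lemma nn_integral_Holder:
  fixes F :: "'i \<Rightarrow> 'b \<Rightarrow> ennreal" and a :: "'i \<Rightarrow> real"
  assumes "finite I" "I \<noteq> {}" and a: "\<And>i. i \<in> I \<Longrightarrow> 0 < a i" "(\<Sum>i\<in>I. a i) = 1" 
    and F [measurable]: "\<And>i. i \<in> I \<Longrightarrow> F i \<in> borel_measurable M"
  shows "(\<integral>\<^sup>+ y. (\<Prod>i\<in>I. enn_powr (F i y) (a i)) \<partial>M) \<le> (\<Prod>i\<in>I. enn_powr (\<integral>\<^sup>+ y. F i y \<partial>M) (a i))"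
proof -
  define N where "N i = (\<integral>\<^sup>+ y. F i y \<partial>M)" for i
  consider (zero) j where "j \<in> I" "N j = 0"
    | (top) j where "j \<in> I" "N j = top" "\<forall>i\<in>I. N i \<noteq> 0"
    | (fin) "\<forall>i\<in>I. N i \<noteq> 0 \<and> N i \<noteq> top"
    by blast
  then show ?thesis
  proof cases
    case zero
    then have "AE y in M. F j y = 0"
      by (simp add: N_def nn_integral_0_iff_AE F)
    then have "AE y in M. (\<Prod>i\<in>I. enn_powr (F i y) (a i)) = 0"
      by eventually_elim (use zero assms(1) in \<open>auto simp: prod_zero_iff\<close>)
    then have "(\<integral>\<^sup>+ y. (\<Prod>i\<in>I. enn_powr (F i y) (a i)) \<partial>M) = 0"
      by (subst nn_integral_0_iff_AE) auto
    then show ?thesis by simp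
  next
    case top
    then have "(\<Prod>i\<in>I. enn_powr (N i) (a i)) = top"
      using assms(1) by (auto simp: ennreal_prod_eq_top)
    then show ?thesis by (simp add: N_def)
  next
    case fin
    define c where "c = (\<Prod>i\<in>I. enn_powr (N i) (a i))"
    have eq: "enn_powr (F i y) (a i) = enn_powr (N i) (a i) * enn_powr (F i y / N i) (a i)" if "i \<in> I" for i y
      using fin that
      by (simp add: enn_powr_mult[symmetric] ennreal_times_divide ennreal_mult_divide_eq mult.commute[of "N i"])
    have "(\<integral>\<^sup>+ y. (\<Prod>i\<in>I. enn_powr (F i y) (a i)) \<partial>M)
        = (\<integral>\<^sup>+ y. c * (\<Prod>i\<in>I. enn_powr (F i y / N i) (a i)) \<partial>M)"
      by (simp add: eq prod.distrib c_def cong: prod.cong)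
    also have "\<dots> = c * (\<integral>\<^sup>+ y. (\<Prod>i\<in>I. enn_powr (F i y / N i) (a i)) \<partial>M)"
      by (intro nn_integral_cmult) measurable
    also have "\<dots> \<le> c * (\<integral>\<^sup>+ y. (\<Sum>i\<in>I. ennreal (a i) * (F i y / N i)) \<partial>M)"
      by (intro mult_left_mono nn_integral_mono weighted_arith_geom_mean_ennreal assms) auto
    also have "(\<integral>\<^sup>+ y. (\<Sum>i\<in>I. ennreal (a i) * (F i y / N i)) \<partial>M) = (\<Sum>i\<in>I. ennreal (a i) * (N i / N i))"
      by (subst nn_integral_sum) (auto simp: nn_integral_cmult nn_integral_divide N_def intro!: sum.cong)
    also have "\<dots> = (\<Sum>i\<in>I. ennreal (a i))"
      using fin by (intro sum.cong) (auto simp: less_top)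
    also have "\<dots> = 1"
      using a by (simp add: sum_ennreal less_imp_le)
    finally show ?thesis by (simp add: c_def N_def)
  qed
qed

lemma nn_integral_Holder2:
  fixes F G :: "'b \<Rightarrow> ennreal" and a :: real
  assumes a: "0 < a" "a < 1" 
    and [measurable]: "F \<in> borel_measurable M" "G \<in> borel_measurable M"
  shows "(\<integral>\<^sup>+ y. enn_powr (F y) a * enn_powr (G y) (1 - a) \<partial>M)
     \<le> enn_powr (\<integral>\<^sup>+ y. F y \<partial>M) a * enn_powr (\<integral>\<^sup>+ y. G y \<partial>M) (1 - a)"
proof -
  have "(\<integral>\<^sup>+ y. (\<Prod>i\<in>UNIV. enn_powr ((if i then F else G) y) (if i then a else 1 - a)) \<partial>M)
     \<le> (\<Prod>i\<in>UNIV. enn_powr (\<integral>\<^sup>+ y. (if i then F else G) y \<partial>M) (if i then a else 1 - a))"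
    by (rule nn_integral_Holder) (use a in \<open>auto simp: UNIV_bool\<close>)
  then show ?thesis by (simp add: UNIV_bool mult.commute)
qed

section \<open>Maximal functions of doubling measures\<close>

lemma sets_lebesgue_ball [measurable]: "ball x r \<in> sets lebesgue"
  by simp

text \<open>Pointwise layer-cake formula: integrated over the space and combined with Tonelli, it
  expresses an L^p integral through the distribution function. The exponent condition is
  integrability at zero.\<close>

lemma nn_integral_powr_indicator:
  fixes a :: real and z :: ennreal
  assumes a: "-1 < a"
  shows "ennreal (a + 1) * (\<integral>\<^sup>+ l. ennreal (l powr a) * indicator {l. 0 < l \<and> ennreal l < z} l \<partial>lborel)
      = enn_powr z (a + 1)"
proof -
  have fin: "ennreal (a + 1) * (\<integral>\<^sup>+ l. ennreal (l powr a) * indicator {l. 0 < l \<and> ennreal l < ennreal c} l \<partial>lborel)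
      = enn_powr (ennreal c) (a + 1)" if c: "0 \<le> c" for c :: real
  proof -
    have "(\<integral>\<^sup>+ l. ennreal (l powr a) * indicator {l. 0 < l \<and> ennreal l < ennreal c} l \<partial>lborel)
       = (\<integral>\<^sup>+ l. ennreal (l powr a) * indicator {0..c} l \<partial>lborel)"
    proof (rule nn_integral_cong_AE)
      have "AE l in lborel. l \<noteq> 0 \<and> l \<noteq> c"
        using AE_lborel_singleton[of 0] AE_lborel_singleton[of c] by auto
      then show "AE l in lborel. ennreal (l powr a) * indicator {l. 0 < l \<and> ennreal l < ennreal c} l
           = ennreal (l powr a) * indicator {0..c} l"
        by eventually_elim (auto simp: indicator_def ennreal_less_iff)
    qed
    also have "\<dots> = ennreal (c powr (a + 1) / (a + 1))"
      by (rule nn_integral_has_integral_lebesgue'[OF _ has_integral_powr_from_0[OF a c]]) auto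
    finally show ?thesis
      using a c by (simp add: enn_powr_ennreal ennreal_mult[symmetric])
  qed
  show ?thesis
  proof (cases z)
    case (real c)
    then show ?thesis using fin[of c] by simp
  next
    case top
    \<comment> \<open>For infinite \<open>z\<close> the set contains every interval (0, n), so the
      integral exceeds each of the finite values already computed.\<close>
    have "enn_powr (ennreal (real n)) (a + 1) \<le>
       ennreal (a + 1) * (\<integral>\<^sup>+ l. ennreal (l powr a) * indicator {l. 0 < l \<and> ennreal l < z} l \<partial>lborel)" (is "_ \<le> ?R") for n
      unfolding fin[of "real n", symmetric, OF of_nat_0_le_iff]
      by (intro mult_left_mono nn_integral_mono) (auto simp: indicator_def top)
    then have "ennreal (real n) \<le> enn_powr ?R (1 / (a + 1))" for n
      using a by (simp add: enn_powr_le_iff2)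
    then have "enn_powr ?R (1 / (a + 1)) = top"
      by (metis ennreal_of_nat_eq_real_of_nat ennreal_Ex_less_of_nat not_le less_top)
    then show ?thesis using top by simp
  qed
qed

definition maximal_fn :: "'a::euclidean_space measure \<Rightarrow> ('a \<Rightarrow> ennreal) \<Rightarrow> 'a \<Rightarrow> ennreal" where
  "maximal_fn M g y = (SUP xr \<in> {xr. 0 < snd xr \<and> y \<in> ball (fst xr) (snd xr)}.
     (\<integral>\<^sup>+ z \<in> ball (fst xr) (snd xr). g z \<partial>M) / emeasure M (ball (fst xr) (snd xr)))"

text \<open>The dilation factor 5 is the one produced by the Vitali covering lemma. The
  sigma-algebra is that of \<open>lebesgue\<close>, so that densities of Lebesgue measure are
  instances.\<close>

locale doubling_measure =
  fixes M :: "'a::euclidean_space measure" and D :: real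
  assumes sets_M: "sets M = sets lebesgue"
    and ball_pos: "0 < r \<Longrightarrow> 0 < emeasure M (ball x r)"
    and ball_finite: "emeasure M (ball x r) < top"
    and doubling: "0 < r \<Longrightarrow> emeasure M (ball x (5 * r)) \<le> ennreal D * emeasure M (ball x r)"
begin

lemma space_M: "space M = UNIV"
  using sets_eq_imp_space_eq[OF sets_M] by simp

lemma open_sets_M [measurable]: "open U \<Longrightarrow> U \<in> sets M"
  by (simp add: sets_M borel_open)

lemma ball_sets_M [measurable]: "ball x r \<in> sets M"
  by (simp add: open_sets_M)

lemma sigma_finite: "sigma_finite_measure M"
proof
  show "\<exists>A. countable A \<and> A \<subseteq> sets M \<and> \<Union>A = space M \<and> (\<forall>a\<in>A. emeasure M a \<noteq> \<infinity>)"
  proof (intro exI conjI ballI)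
    show "\<Union>(range (\<lambda>n::nat. ball 0 (real n))) = space M"
      by (auto simp: space_M reals_Archimedean2)
  qed (use ball_finite in \<open>auto simp: less_top\<close>)
qed

lemma maximal_fn_superlevel:
  "{y. l < maximal_fn M g y} =
     (\<Union>xr\<in>{xr. 0 < snd xr \<and> l * emeasure M (ball (fst xr) (snd xr)) < (\<integral>\<^sup>+ z \<in> ball (fst xr) (snd xr). g z \<partial>M)}.
        ball (fst xr) (snd xr))"
proof -
  have *: "l < I / emeasure M (ball x r) \<longleftrightarrow> l * emeasure M (ball x r) < I" if "0 < r" for I x r
    using ball_pos[OF that, of x] ball_finite[of x r] by (intro ennreal_less_divide_iff) auto
  show ?thesis
    unfolding maximal_fn_def by (fastforce simp: less_SUP_iff *)
qed

lemma borel_measurable_maximal_fn [measurable]: "maximal_fn M g \<in> borel_measurable M"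
proof (rule borel_measurableI_greater)
  fix l
  have "open {y. l < maximal_fn M g y}"
    unfolding maximal_fn_superlevel by auto
  then show "{x \<in> space M. l < maximal_fn M g x} \<in> sets M"
    by (simp add: space_M)
qed

lemma borel_measurable_maximal_fn_lebesgue [measurable]: "maximal_fn M g \<in> borel_measurable lebesgue"
  using borel_measurable_maximal_fn[of g] measurable_cong_sets[OF sets_M refl] by blast

lemma maximal_fn_weak_type:
  assumes [measurable]: "g \<in> borel_measurable M"
  shows "l * emeasure M {y. l < maximal_fn M g y} \<le> ennreal D * (\<integral>\<^sup>+ y. g y \<partial>M)"
proof -
  define K where "K = {xr. 0 < snd xr \<and> l * emeasure M (ball (fst xr) (snd xr)) < (\<integral>\<^sup>+ z \<in> ball (fst xr) (snd xr). g z \<partial>M)}"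
  define B where "B xr = ball (fst xr) (snd xr)" for xr :: "'a \<times> real"
  \<comment> \<open>Vitali's lemma works with bounded radii: only balls of radius at most
    \<open>k\<close> enter, and \<open>k\<close> tends to infinity by continuity from below.\<close>
  define U where "U k = (\<Union>xr\<in>{xr\<in>K. snd xr \<le> real k}. B xr)" for k :: nat
  have U_sets [measurable]: "U k \<in> sets M" for k
    unfolding U_def B_def by (intro open_sets_M) auto
  have eq: "{y. l < maximal_fn M g y} = (\<Union>k. U k)"
  proof -
    have "\<exists>k. snd xr \<le> real k" for xr :: "'a \<times> real" by (rule real_arch_simple)
    then show ?thesis
      unfolding maximal_fn_superlevel K_def[symmetric] U_def B_def by blast
  qed
  have "incseq U"
  proof (rule incseq_SucI)
    show "U k \<subseteq> U (Suc k)" for k unfolding U_def by force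
  qed
  have "l * emeasure M (U k) \<le> ennreal D * (\<integral>\<^sup>+ y. g y \<partial>M)" for k
  proof -
    obtain C where C: "countable C" "C \<subseteq> {xr\<in>K. snd xr \<le> real k}"
      and disj: "pairwise (\<lambda>i j. disjnt (ball (fst i) (snd i)) (ball (fst j) (snd j))) C"
      and cov: "U k \<subseteq> (\<Union>i\<in>C. ball (fst i) (5 * snd i))"
      by (rule Vitali_covering_lemma_balls[of "U k" fst snd "{xr\<in>K. snd xr \<le> real k}" "real k"])
         (auto simp: U_def B_def K_def)
    have "emeasure M (U k) = (\<integral>\<^sup>+ y. indicator (U k) y \<partial>M)" by simp
    \<comment> \<open>Sums over the countable family are written as integrals over
      \<open>count_space C\<close>, so that exchanging sum and integral is an instance of
      Tonelli.\<close>
    also have "\<dots> \<le> (\<integral>\<^sup>+ y. (\<integral>\<^sup>+ i. indicator (ball (fst i) (5 * snd i)) y \<partial>count_space C) \<partial>M)"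
    proof (rule nn_integral_mono)
      fix y
      show "indicator (U k) y \<le> (\<integral>\<^sup>+ i. indicator (ball (fst i) (5 * snd i)) y \<partial>count_space C :: ennreal)"
      proof (cases "y \<in> U k")
        case True
        then obtain i where "i \<in> C" "y \<in> ball (fst i) (5 * snd i)" using cov by auto
        then show ?thesis
          using nn_integral_ge_point[of i C "\<lambda>i. indicator (ball (fst i) (5 * snd i)) y"] True by simp
      qed simp
    qed
    also have "\<dots> = (\<integral>\<^sup>+ i. emeasure M (ball (fst i) (5 * snd i)) \<partial>count_space C)"
      by (subst nn_integral_count_space_nn_integral[OF C(1)]) auto
    finally have "l * emeasure M (U k) \<le> l * (\<integral>\<^sup>+ i. emeasure M (ball (fst i) (5 * snd i)) \<partial>count_space C)"
      by (rule mult_left_mono) simp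
    also have "\<dots> = (\<integral>\<^sup>+ i. l * emeasure M (ball (fst i) (5 * snd i)) \<partial>count_space C)"
      by (simp add: nn_integral_cmult)
    also have "\<dots> \<le> (\<integral>\<^sup>+ i. ennreal D * (\<integral>\<^sup>+ z \<in> B i. g z \<partial>M) \<partial>count_space C)"
    proof (rule nn_integral_mono)
      fix i assume "i \<in> space (count_space C)"
      then have i: "i \<in> K" using C by auto
      then have "l * emeasure M (ball (fst i) (5 * snd i)) \<le> l * (ennreal D * emeasure M (B i))"
        unfolding B_def by (intro mult_left_mono doubling) (auto simp: K_def)
      also have "\<dots> = ennreal D * (l * emeasure M (B i))" by (simp add: ac_simps)
      also have "\<dots> \<le> ennreal D * (\<integral>\<^sup>+ z \<in> B i. g z \<partial>M)"
        using i by (intro mult_left_mono) (auto simp: K_def B_def)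
      finally show "l * emeasure M (ball (fst i) (5 * snd i)) \<le> ennreal D * (\<integral>\<^sup>+ z \<in> B i. g z \<partial>M)" .
    qed
    also have "\<dots> = ennreal D * (\<integral>\<^sup>+ i. (\<integral>\<^sup>+ z. g z * indicator (B i) z \<partial>M) \<partial>count_space C)"
      by (simp add: nn_integral_cmult)
    also have "(\<integral>\<^sup>+ i. (\<integral>\<^sup>+ z. g z * indicator (B i) z \<partial>M) \<partial>count_space C)
        = (\<integral>\<^sup>+ z. (\<integral>\<^sup>+ i. g z * indicator (B i) z \<partial>count_space C) \<partial>M)"
      by (subst nn_integral_count_space_nn_integral[OF C(1)]) (auto simp: B_def)
    also have "\<dots> \<le> (\<integral>\<^sup>+ z. g z \<partial>M)"
    proof (rule nn_integral_mono)
      fix z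
      show "(\<integral>\<^sup>+ i. g z * indicator (B i) z \<partial>count_space C) \<le> g z"
      proof (cases "\<exists>i\<in>C. z \<in> B i")
        case True
        then obtain i where i: "i \<in> C" "z \<in> B i" by auto
        have "z \<notin> B j" if "j \<in> C" "j \<noteq> i" for j
          using disj i that unfolding pairwise_def disjnt_def B_def by (metis disjoint_iff)
        then have "(\<integral>\<^sup>+ j. g z * indicator (B j) z \<partial>count_space C) = (\<integral>\<^sup>+ j. g z * indicator {i} j \<partial>count_space C)"
          using i by (intro nn_integral_cong) (auto simp: indicator_def)
        also have "\<dots> = g z"
          using i(1) by (simp add: nn_integral_cmult)
        finally show ?thesis by simp
      next
        case False
        then have "(\<integral>\<^sup>+ j. g z * indicator (B j) z \<partial>count_space C) = (\<integral>\<^sup>+ j. 0 \<partial>count_space C)"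
          by (intro nn_integral_cong) (auto simp: indicator_def)
        then show ?thesis by simp
      qed
    qed
    finally show ?thesis by (simp add: mult_left_mono)
  qed
  moreover have "emeasure M (\<Union>k. U k) = (SUP k. emeasure M (U k))"
    using \<open>incseq U\<close> by (intro SUP_emeasure_incseq[symmetric]) auto
  ultimately show ?thesis
    unfolding eq by (simp add: SUP_mult_left_ennreal SUP_le_iff)
qed

text \<open>Marcinkiewicz interpolation between the weak (1,1) bound and the trivial bound by the
  supremum. The constant arises as p * 2D * 2^(p-1) / (p-1): p from the layer-cake formula, 2D from
  the weak type at height l/2, the rest from integrating l^(p-2) over l < 2 g.\<close>

lemma maximal_fn_strong_type:
  fixes g :: "'a \<Rightarrow> ennreal" and p :: real
  assumes g [measurable]: "g \<in> borel_measurable M" and p: "1 < p"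
  shows "(\<integral>\<^sup>+ y. enn_powr (maximal_fn M g y) p \<partial>M)
       \<le> ennreal (D * (p / (p - 1)) * 2 powr p) * (\<integral>\<^sup>+ y. enn_powr (g y) p \<partial>M)"
proof -
  interpret sf: sigma_finite_measure M by (rule sigma_finite)
  interpret P: pair_sigma_finite M lborel ..
  note [measurable] = borel_measurable_maximal_fn
  \<comment> \<open>The part of \<open>g\<close> above height l/2. The condition is phrased as an
    indicator in \<open>l\<close>, so that after Tonelli it cuts the integral over \<open>l\<close>
    at 2 * g y.\<close>
  define g1 where "g1 l y = g y * indicator {l. 0 < l \<and> ennreal l < 2 * g y} l" for l :: real and y
  have [measurable]: "(\<lambda>(y, l). g1 l y) \<in> borel_measurable (M \<Otimes>\<^sub>M lborel)"
    unfolding g1_def by measurable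
  have [measurable]: "g1 l \<in> borel_measurable M" for l
    unfolding g1_def by measurable
  have split: "maximal_fn M g y \<le> maximal_fn M (g1 l) y + ennreal (l / 2)" if l: "0 < l" for l y
    unfolding maximal_fn_def
  proof (rule SUP_least)
    fix xr :: "'a \<times> real" assume xr: "xr \<in> {xr. 0 < snd xr \<and> y \<in> ball (fst xr) (snd xr)}"
    let ?B = "ball (fst xr) (snd xr)"
    have le: "g z \<le> g1 l z + ennreal (l / 2)" for z
    proof (cases "ennreal l < 2 * g z")
      case True
      then show ?thesis using l by (simp add: g1_def)
    next
      case False
      then have "2 * g z \<le> 2 * ennreal (l / 2)" 
        using l by (simp add: not_less ennreal_mult[symmetric] del: ennreal_half flip: ennreal_numeral)
      then have "g z \<le> ennreal (l / 2)" 
        by (subst (asm) ennreal_mult_le_mult_iff) auto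
      then show ?thesis by (simp add: add_increasing)
    qed
    have "(\<integral>\<^sup>+ z \<in> ?B. g z \<partial>M) \<le> (\<integral>\<^sup>+ z. g1 l z * indicator ?B z + ennreal (l / 2) * indicator ?B z \<partial>M)"
      using le by (intro nn_integral_mono) (auto simp: indicator_def)
    also have "\<dots> = (\<integral>\<^sup>+ z \<in> ?B. g1 l z \<partial>M) + ennreal (l / 2) * emeasure M ?B"
      by (subst nn_integral_add) (auto simp: nn_integral_cmult)
    finally have "(\<integral>\<^sup>+ z \<in> ?B. g z \<partial>M) / emeasure M ?B 
       \<le> ((\<integral>\<^sup>+ z \<in> ?B. g1 l z \<partial>M) + ennreal (l / 2) * emeasure M ?B) / emeasure M ?B"
      by (rule divide_right_mono_ennreal)
    also have "\<dots> = (\<integral>\<^sup>+ z \<in> ?B. g1 l z \<partial>M) / emeasure M ?B + ennreal (l / 2)"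
      using xr ball_pos[of "snd xr" "fst xr"] ball_finite[of "fst xr" "snd xr"]
      by (simp add: add_divide_distrib_ennreal ennreal_mult_divide_eq)
    also have "\<dots> \<le> (SUP xr \<in> {xr. 0 < snd xr \<and> y \<in> ball (fst xr) (snd xr)}.
     (\<integral>\<^sup>+ z \<in> ball (fst xr) (snd xr). g1 l z \<partial>M) / emeasure M (ball (fst xr) (snd xr))) + ennreal (l / 2)"
      using xr by (intro add_right_mono SUP_upper)
    finally show "(\<integral>\<^sup>+ z \<in> ?B. g z \<partial>M) / emeasure M ?B \<le> \<dots>" .
  qed
  have weak: "ennreal l * emeasure M {y. ennreal l < maximal_fn M g y} \<le> ennreal (2 * D) * (\<integral>\<^sup>+ y. g1 l y \<partial>M)"
    if l: "0 < l" for l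
  proof -
    \<comment> \<open>The discarded part of \<open>g\<close> is at most l/2, and so are its
      averages; where the maximal function exceeds l, more than l/2 must come from
      \<open>g1 l\<close>.\<close>
    have "{y. ennreal l < maximal_fn M g y} \<subseteq> {y. ennreal (l / 2) < maximal_fn M (g1 l) y}"
    proof safe
      fix y assume "ennreal l < maximal_fn M g y"
      also note split[OF l]
      finally have "ennreal (l / 2) + ennreal (l / 2) < maximal_fn M (g1 l) y + ennreal (l / 2)"
        using l by (simp flip: ennreal_plus)
      then show "ennreal (l / 2) < maximal_fn M (g1 l) y"
        by (meson add_right_mono leD leI)
    qed
    then have "ennreal (l / 2) * emeasure M {y. ennreal l < maximal_fn M g y}
       \<le> ennreal (l / 2) * emeasure M {y. ennreal (l / 2) < maximal_fn M (g1 l) y}"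
      by (intro mult_left_mono emeasure_mono) (auto simp: maximal_fn_superlevel intro!: open_sets_M)
    also have "\<dots> \<le> ennreal D * (\<integral>\<^sup>+ y. g1 l y \<partial>M)"
      by (rule maximal_fn_weak_type) measurable
    finally have "2 * (ennreal (l / 2) * emeasure M {y. ennreal l < maximal_fn M g y}) \<le> 2 * (ennreal D * (\<integral>\<^sup>+ y. g1 l y \<partial>M))"
      by (intro mult_left_mono) auto
    moreover have "2 * ennreal (l / 2) = ennreal l"
      using l by (simp add: ennreal_mult[symmetric] del: ennreal_half flip: ennreal_numeral)
    moreover have "2 * ennreal D = ennreal (2 * D)"
      by (simp add: ennreal_mult')
    ultimately show ?thesis by (simp add: mult.assoc[symmetric])
  qed
  have "(\<integral>\<^sup>+ y. enn_powr (maximal_fn M g y) p \<partial>M)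
      = (\<integral>\<^sup>+ y. ennreal p * (\<integral>\<^sup>+ l. ennreal (l powr (p - 1)) * indicator {l. 0 < l \<and> ennreal l < maximal_fn M g y} l \<partial>lborel) \<partial>M)"
    using nn_integral_powr_indicator[of "p - 1"] p by simp
  also have "\<dots> = ennreal p * (\<integral>\<^sup>+ y. (\<integral>\<^sup>+ l. ennreal (l powr (p - 1)) * indicator {l. 0 < l \<and> ennreal l < maximal_fn M g y} l \<partial>lborel) \<partial>M)"
    by (intro nn_integral_cmult) measurable
  also have "(\<integral>\<^sup>+ y. (\<integral>\<^sup>+ l. ennreal (l powr (p - 1)) * indicator {l. 0 < l \<and> ennreal l < maximal_fn M g y} l \<partial>lborel) \<partial>M)
      = (\<integral>\<^sup>+ l. (\<integral>\<^sup>+ y. ennreal (l powr (p - 1)) * indicator {l. 0 < l \<and> ennreal l < maximal_fn M g y} l \<partial>M) \<partial>lborel)"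
    by (rule P.Fubini'[symmetric]) measurable
  also have "\<dots> \<le> (\<integral>\<^sup>+ l. ennreal (2 * D) * (\<integral>\<^sup>+ y. ennreal (l powr (p - 2)) * g1 l y \<partial>M) \<partial>lborel)"
  proof (rule nn_integral_mono)
    fix l :: real
    show "(\<integral>\<^sup>+ y. ennreal (l powr (p - 1)) * indicator {l. 0 < l \<and> ennreal l < maximal_fn M g y} l \<partial>M)
       \<le> ennreal (2 * D) * (\<integral>\<^sup>+ y. ennreal (l powr (p - 2)) * g1 l y \<partial>M)"
    proof (cases "0 < l")
      case True
      have pp: "l powr (p - 1) = l powr (p - 2) * l"
        using True powr_add[of l "p - 2" 1] by simp
      have "(\<integral>\<^sup>+ y. ennreal (l powr (p - 1)) * indicator {l. 0 < l \<and> ennreal l < maximal_fn M g y} l \<partial>M)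
         = (\<integral>\<^sup>+ y. ennreal (l powr (p - 1)) * indicator {y. ennreal l < maximal_fn M g y} y \<partial>M)"
        using True by (intro nn_integral_cong) (auto simp: indicator_def)
      also have "\<dots> = ennreal (l powr (p - 1)) * emeasure M {y. ennreal l < maximal_fn M g y}"
        by (intro nn_integral_cmult_indicator) (auto simp: maximal_fn_superlevel intro!: open_sets_M)
      also have "\<dots> = ennreal (l powr (p - 2)) * (ennreal l * emeasure M {y. ennreal l < maximal_fn M g y})"
        using True by (simp add: pp ennreal_mult mult.assoc)
      also have "\<dots> \<le> ennreal (l powr (p - 2)) * (ennreal (2 * D) * (\<integral>\<^sup>+ y. g1 l y \<partial>M))"
        by (intro mult_left_mono weak True) simp
      also have "\<dots> = ennreal (2 * D) * (\<integral>\<^sup>+ y. ennreal (l powr (p - 2)) * g1 l y \<partial>M)"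
        by (subst nn_integral_cmult) (auto simp: ac_simps)
      finally show ?thesis .
    qed simp
  qed
  also have "\<dots> = ennreal (2 * D) * (\<integral>\<^sup>+ l. (\<integral>\<^sup>+ y. ennreal (l powr (p - 2)) * g1 l y \<partial>M) \<partial>lborel)"
    by (intro nn_integral_cmult) measurable
  also have "(\<integral>\<^sup>+ l. (\<integral>\<^sup>+ y. ennreal (l powr (p - 2)) * g1 l y \<partial>M) \<partial>lborel)
      = (\<integral>\<^sup>+ y. (\<integral>\<^sup>+ l. ennreal (l powr (p - 2)) * g1 l y \<partial>lborel) \<partial>M)"
    by (rule P.Fubini') measurable
  also have "\<dots> = (\<integral>\<^sup>+ y. ennreal (2 powr (p - 1) / (p - 1)) * enn_powr (g y) p \<partial>M)"
  proof (rule nn_integral_cong)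
    fix y
    define J where "J = (\<integral>\<^sup>+ l. ennreal (l powr (p - 2)) * indicator {l. 0 < l \<and> ennreal l < 2 * g y} l \<partial>lborel)"
    have "(\<integral>\<^sup>+ l. ennreal (l powr (p - 2)) * g1 l y \<partial>lborel) = g y * J"
      unfolding g1_def J_def by (subst nn_integral_cmult[symmetric]) (auto simp: ac_simps)
    moreover have "ennreal (p - 1) * J = ennreal (2 powr (p - 1)) * enn_powr (g y) (p - 1)"
      using nn_integral_powr_indicator[of "p - 2" "2 * g y"] p enn_powr_ennreal[of 2 "p - 1"]
      by (simp add: J_def enn_powr_mult)
    then have "ennreal (1 / (p - 1)) * (ennreal (p - 1) * J) = ennreal (2 powr (p - 1) / (p - 1)) * enn_powr (g y) (p - 1)"
      using p by (simp add: mult.assoc[symmetric] ennreal_mult[symmetric])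
    then have "J = ennreal (2 powr (p - 1) / (p - 1)) * enn_powr (g y) (p - 1)"
      using p by (simp add: mult.assoc[symmetric] ennreal_mult[symmetric])
    moreover have "g y * enn_powr (g y) (p - 1) = enn_powr (g y) p"
      using enn_powr_add[of "g y" 1 "p - 1"] by simp
    ultimately show "(\<integral>\<^sup>+ l. ennreal (l powr (p - 2)) * g1 l y \<partial>lborel) = ennreal (2 powr (p - 1) / (p - 1)) * enn_powr (g y) p"
      by (metis mult.left_commute)
  qed
  also have "\<dots> = ennreal (2 powr (p - 1) / (p - 1)) * (\<integral>\<^sup>+ y. enn_powr (g y) p \<partial>M)"
    by (intro nn_integral_cmult) measurable
  finally have "(\<integral>\<^sup>+ y. enn_powr (maximal_fn M g y) p \<partial>M)
      \<le> ennreal p * (ennreal (2 * D) * (ennreal (2 powr (p - 1) / (p - 1)) * (\<integral>\<^sup>+ y. enn_powr (g y) p \<partial>M)))"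
    by (simp add: mult_left_mono)
  also have "\<dots> = ennreal p * ennreal (2 * D) * ennreal (2 powr (p - 1) / (p - 1)) * (\<integral>\<^sup>+ y. enn_powr (g y) p \<partial>M)"
    by (simp add: mult.assoc)
  also have "ennreal p * ennreal (2 * D) * ennreal (2 powr (p - 1) / (p - 1)) = ennreal (D * (p / (p - 1)) * 2 powr p)"
  proof -
    have "p * (2 * D) * (2 powr (p - 1) / (p - 1)) = D * (p / (p - 1)) * 2 powr p"
      using p by (simp add: powr_diff field_simps)
    moreover have "ennreal (p * (2 * D) * (2 powr (p - 1) / (p - 1))) = ennreal p * ennreal (2 * D) * ennreal (2 powr (p - 1) / (p - 1))"
      using p by (subst ennreal_mult'', simp, subst ennreal_mult', simp_all)
    ultimately show ?thesis by (metis (no_types))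
  qed
  finally show ?thesis .
qed

end

section \<open>Muckenhoupt pairs of weights\<close>

lemma ball_meas_eq: "0 \<le> r \<Longrightarrow> ball_meas (x::'a::euclidean_space) r = ennreal (unit_ball_vol (real DIM('a)) * r ^ DIM('a))"
  unfolding ball_meas_def by (simp add: emeasure_ball)

lemma ball_meas_pos: "0 < r \<Longrightarrow> 0 < ball_meas (x::'a::euclidean_space) r"
  by (simp add: ball_meas_eq)

lemma ball_meas_finite: "ball_meas x r < top"
  unfolding ball_meas_def using emeasure_lborel_ball_finite[of x r] by simp

lemma ball_meas_scale:
  fixes x y :: "'a::euclidean_space"
  assumes "0 \<le> r" "0 \<le> c"
  shows "ball_meas x (c * r) = ennreal (c ^ DIM('a)) * ball_meas y r"
  using assms by (simp add: ball_meas_eq ennreal_mult[symmetric] power_mult_distrib mult.left_commute)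

lemma ball_meas_conv_measure: "ball_meas x r = ennreal (measure lebesgue (ball x r))"
  unfolding ball_meas_def using ball_meas_finite[of x r]
  by (intro emeasure_eq_ennreal_measure) (auto simp: ball_meas_def)

lemma wmeas_density:
  assumes "w \<in> borel_measurable lebesgue" "E \<in> sets lebesgue"
  shows "emeasure (density lebesgue (\<lambda>x. ennreal (w x))) E = wmeas w E"
  using assms by (simp add: emeasure_density wmeas_def)

lemma wmeas_mono: "E \<subseteq> F \<Longrightarrow> wmeas w E \<le> wmeas w F"
  unfolding wmeas_def by (intro nn_integral_mono) (auto simp: indicator_def)

text \<open>For \<open>w = \<omega>\<^sup>q\<close>, \<open>v = \<omega>\<^bsup>-p'\<^esup>\<close> and \<open>\<theta> = p' / (p' + q)\<close> this is the condition \<open>\<omega> \<in> A(p, q)\<close>,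
  with exponents normalised to sum to one so that it is symmetric in the two weights.\<close>

definition muck_pair :: "real \<Rightarrow> real \<Rightarrow> ('a::euclidean_space \<Rightarrow> real) \<Rightarrow> ('a \<Rightarrow> real) \<Rightarrow> bool" where
  "muck_pair \<theta> K w v \<longleftrightarrow> w \<in> borel_measurable lebesgue \<and> v \<in> borel_measurable lebesgue
     \<and> (\<forall>x. 0 \<le> w x) \<and> (\<forall>x. 0 \<le> v x)
     \<and> (AE x in lebesgue. w x powr \<theta> * v x powr (1 - \<theta>) = 1)
     \<and> (\<forall>x. \<forall>r>0. wmeas w (ball x r) < top \<and> wmeas v (ball x r) < top \<and>
          enn_powr (wmeas w (ball x r)) \<theta> * enn_powr (wmeas v (ball x r)) (1 - \<theta>) \<le> ennreal K * ball_meas x r)"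

lemma muck_pair_swap: "muck_pair \<theta> K w v \<Longrightarrow> muck_pair (1 - \<theta>) K v w"
  unfolding muck_pair_def by (simp add: mult.commute)

text \<open>Hoelder's inequality for 1 = w^\<theta> v^(1-\<theta>). It is the converse of the ball
  condition in \<open>muck_pair\<close>, and it holds on every measurable set; the interplay of the
  two gives all comparison results below.\<close>

lemma lebesgue_le_wmeas_product:
  fixes w v :: "'a::euclidean_space \<Rightarrow> real"
  assumes [measurable]: "w \<in> borel_measurable lebesgue" "v \<in> borel_measurable lebesgue"
    and nonneg: "\<And>x. 0 \<le> w x" "\<And>x. 0 \<le> v x"
    and ae: "AE x in lebesgue. w x powr \<theta> * v x powr (1 - \<theta>) = 1"
    and theta: "0 < \<theta>" "\<theta> < 1" and [measurable]: "F \<in> sets lebesgue"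
  shows "emeasure lebesgue F \<le> enn_powr (wmeas w F) \<theta> * enn_powr (wmeas v F) (1 - \<theta>)"
proof -
  have "emeasure lebesgue F = (\<integral>\<^sup>+ x. indicator F x \<partial>lebesgue)" by simp
  also have "\<dots> = (\<integral>\<^sup>+ x. enn_powr (ennreal (w x) * indicator F x) \<theta> * enn_powr (ennreal (v x) * indicator F x) (1 - \<theta>) \<partial>lebesgue)"
    using ae
    by (intro nn_integral_cong_AE, eventually_elim)
       (auto simp: indicator_def enn_powr_ennreal nonneg ennreal_mult[symmetric])
  also have "\<dots> \<le> enn_powr (wmeas w F) \<theta> * enn_powr (wmeas v F) (1 - \<theta>)"
    unfolding wmeas_def by (rule nn_integral_Holder2) (use theta in auto)
  finally show ?thesis .
qed

section \<open>Comparison of Lebesgue and weighted measure under a Muckenhoupt pair\<close>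

locale muckenhoupt =
  fixes \<theta> K :: real and w v :: "'a::euclidean_space \<Rightarrow> real"
  assumes theta: "0 < \<theta>" "\<theta> < 1" and pair: "muck_pair \<theta> K w v"
begin

lemma w_meas [measurable]: "w \<in> borel_measurable lebesgue"
  and v_meas [measurable]: "v \<in> borel_measurable lebesgue"
  and w_nonneg: "0 \<le> w x" and v_nonneg: "0 \<le> v x"
  and ae_prod: "AE x in lebesgue. w x powr \<theta> * v x powr (1 - \<theta>) = 1"
  using pair by (auto simp: muck_pair_def)

lemma ae_pos: "AE x in lebesgue. 0 < w x \<and> 0 < v x"
  using ae_prod by eventually_elim (use w_nonneg v_nonneg in \<open>force simp: less_le\<close>)

lemma wmeas_ball_finite: "wmeas w (ball x r) < top"
proof (cases "0 < r")
  case True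
  then show ?thesis using pair by (auto simp: muck_pair_def)
next
  case False
  then have "wmeas w (ball x r) = (\<integral>\<^sup>+ y. 0 \<partial>(lebesgue :: 'a measure))"
    unfolding wmeas_def by (intro nn_integral_cong) (simp add: ball_empty)
  then show ?thesis by simp
qed

lemma ball_product: "0 < r \<Longrightarrow> enn_powr (wmeas w (ball x r)) \<theta> * enn_powr (wmeas v (ball x r)) (1 - \<theta>) \<le> ennreal K * ball_meas x r"
  using pair by (auto simp: muck_pair_def)

lemma lebesgue_le_product:
  assumes "F \<in> sets lebesgue"
  shows "emeasure lebesgue F \<le> enn_powr (wmeas w F) \<theta> * enn_powr (wmeas v F) (1 - \<theta>)"
  by (rule lebesgue_le_wmeas_product[OF w_meas v_meas w_nonneg v_nonneg ae_prod theta assms])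

lemma wmeas_ball_pos: "0 < r \<Longrightarrow> 0 < wmeas w (ball x r)"
  using lebesgue_le_product[of "ball x r"] ball_meas_pos[of r x]
  by (auto simp: ball_meas_def zero_less_iff_neq_zero)

text \<open>The A-infinity property |F| / |B| <= K (w(F) / w(B))^\<theta>, cleared of denominators.
  The lower bound on F meets the upper bound on B, and v(F) <= v(B) eliminates the dual
  weight.\<close>

lemma wmeas_subset_lower:
  assumes [measurable]: "F \<in> sets lebesgue" and F: "F \<subseteq> ball x r" and r: "0 < r"
  shows "emeasure lebesgue F * enn_powr (wmeas w (ball x r)) \<theta> \<le> ennreal K * ball_meas x r * enn_powr (wmeas w F) \<theta>"
proof -
  have "emeasure lebesgue F * enn_powr (wmeas w (ball x r)) \<theta>
     \<le> enn_powr (wmeas w F) \<theta> * enn_powr (wmeas v F) (1 - \<theta>) * enn_powr (wmeas w (ball x r)) \<theta>"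
    by (intro mult_right_mono lebesgue_le_product) auto
  also have "\<dots> \<le> enn_powr (wmeas w F) \<theta> * enn_powr (wmeas v (ball x r)) (1 - \<theta>) * enn_powr (wmeas w (ball x r)) \<theta>"
    using theta by (intro mult_right_mono mult_left_mono enn_powr_mono wmeas_mono F) auto
  also have "\<dots> = enn_powr (wmeas w F) \<theta> * (enn_powr (wmeas w (ball x r)) \<theta> * enn_powr (wmeas v (ball x r)) (1 - \<theta>))"
    by (simp add: ac_simps)
  also have "\<dots> \<le> enn_powr (wmeas w F) \<theta> * (ennreal K * ball_meas x r)"
    by (intro mult_left_mono ball_product r) auto
  finally show ?thesis by (simp add: ac_simps)
qed

lemma K_pos: "0 < K"
proof (rule ccontr)
  assume "\<not> 0 < K"
  then have "ennreal K = 0" by (simp add: ennreal_neg)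
  moreover have "emeasure lebesgue (ball (0::'a) 1) * enn_powr (wmeas w (ball 0 1)) \<theta> \<noteq> 0"
    using wmeas_ball_pos[of 1 0] ball_meas_pos[of 1 "0::'a"] by (auto simp: ball_meas_def)
  ultimately show False
    using wmeas_subset_lower[of "ball 0 1" 0 1] by auto
qed

lemma wmeas_lower_bound:
  assumes "F \<in> sets lebesgue" and F: "F \<subseteq> ball x r" and r: "0 < r"
    and c: "0 < c" "ennreal c * ball_meas x r \<le> emeasure lebesgue F"
  shows "ennreal ((c / K) powr (1 / \<theta>)) * wmeas w (ball x r) \<le> wmeas w F"
proof -
  have "ball_meas x r * (ennreal c * enn_powr (wmeas w (ball x r)) \<theta>) = ennreal c * ball_meas x r * enn_powr (wmeas w (ball x r)) \<theta>"
    by (simp add: ac_simps)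
  also have "\<dots> \<le> emeasure lebesgue F * enn_powr (wmeas w (ball x r)) \<theta>"
    by (intro mult_right_mono c(2)) simp
  also have "\<dots> \<le> ball_meas x r * (ennreal K * enn_powr (wmeas w F) \<theta>)"
    using wmeas_subset_lower[OF assms(1) F r] by (simp add: ac_simps)
  finally have "ennreal c * enn_powr (wmeas w (ball x r)) \<theta> \<le> ennreal K * enn_powr (wmeas w F) \<theta>"
    using ball_meas_pos[OF r, of x] ball_meas_finite[of x r]
    by (subst (asm) ennreal_mult_le_mult_iff) auto
  then have "ennreal (1 / K) * (ennreal c * enn_powr (wmeas w (ball x r)) \<theta>) \<le> ennreal (1 / K) * (ennreal K * enn_powr (wmeas w F) \<theta>)"
    by (rule mult_left_mono) simp
  then have *: "ennreal (c / K) * enn_powr (wmeas w (ball x r)) \<theta> \<le> enn_powr (wmeas w F) \<theta>"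
    using K_pos c(1) by (simp add: mult.assoc[symmetric] ennreal_mult[symmetric])
  have "enn_powr (ennreal ((c / K) powr (1 / \<theta>)) * wmeas w (ball x r)) \<theta> = ennreal (c / K) * enn_powr (wmeas w (ball x r)) \<theta>"
    using theta K_pos c(1) by (simp add: enn_powr_mult enn_powr_ennreal powr_powr)
  then show ?thesis
    using * enn_powr_le_iff[OF theta(1)] by metis
qed

text \<open>The small ball fills the fraction c^(-n) of the large one, n being the dimension, so
  \<open>wmeas_lower_bound\<close> applies. Used with c = 5 for the doubling property, c = 2 for
  doubled balls, and c = 2n to return from a cube to the ball inside it.\<close>

lemma wmeas_ball_scale:
  assumes r: "0 < r" and c: "1 \<le> c"
  shows "wmeas w (ball x (c * r)) \<le> ennreal ((K * c ^ DIM('a)) powr (1 / \<theta>)) * wmeas w (ball x r)"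
proof -
  have "ennreal ((1 / c ^ DIM('a) / K) powr (1 / \<theta>)) * wmeas w (ball x (c * r)) \<le> wmeas w (ball x r)"
  proof (rule wmeas_lower_bound)
    show "ball x r \<subseteq> ball x (c * r)" using r c by (intro subset_ball) simp
    show "ennreal (1 / c ^ DIM('a)) * ball_meas x (c * r) \<le> emeasure lebesgue (ball x r)"
      using r c by (subst ball_meas_scale[of r c x x])
        (auto simp: mult.assoc[symmetric] ennreal_mult[symmetric] ball_meas_def)
  qed (use r c in auto)
  then have "ennreal ((K * c ^ DIM('a)) powr (1 / \<theta>)) * (ennreal ((1 / c ^ DIM('a) / K) powr (1 / \<theta>)) * wmeas w (ball x (c * r)))
       \<le> ennreal ((K * c ^ DIM('a)) powr (1 / \<theta>)) * wmeas w (ball x r)"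
    by (intro mult_left_mono) auto
  moreover have "ennreal ((K * c ^ DIM('a)) powr (1 / \<theta>)) * ennreal ((1 / c ^ DIM('a) / K) powr (1 / \<theta>)) = 1"
    using K_pos c by (simp add: ennreal_mult[symmetric] powr_mult[symmetric])
  ultimately show ?thesis by (simp add: mult.assoc[symmetric])
qed

lemma doubling_density: "doubling_measure (density lebesgue (\<lambda>x. ennreal (w x))) ((K * 5 ^ DIM('a)) powr (1 / \<theta>))"
  by standard (auto simp: wmeas_density wmeas_ball_finite wmeas_ball_pos wmeas_ball_scale)

end

lemma muckenhoupt_swap: "muckenhoupt \<theta> K w v \<Longrightarrow> muckenhoupt (1 - \<theta>) K v w"
  unfolding muckenhoupt_def by (auto intro: muck_pair_swap)

section \<open>The fractional maximal operator\<close>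

text \<open>The estimate for one ball B, in real numbers: a = w(B), b = v(B), c = |B|, A is the
  average of g over B with respect to v dx, and I bounds the integral of g^p v. The left side is the
  q-th power of the fractional average; the right side contains the w-average that H
  dominates.\<close>

lemma fractional_power_inequality:
  fixes a b c A I K p q s \<theta> :: real
  assumes p: "1 < p" "p < q" and s: "s = 1 / q + 1 - 1 / p" and th: "\<theta> = 1 / (q * s)" "0 < \<theta>" "\<theta> < 1"
    and pos: "0 < a" "0 < b" "0 < c" "0 < K" and A: "0 \<le> A" 
    and prod: "a powr \<theta> * b powr (1 - \<theta>) \<le> K * c" and AI: "b * A powr p \<le> I"
  shows "(c powr (- s) * (A * b)) powr q
     \<le> K powr (s * q + 1 / (1 - \<theta>)) * (I powr ((q - p) / p) * (A powr (p * (1 - \<theta>)) * c / a) powr (1 / (1 - \<theta>)))"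
proof (cases "A = 0")
  case True
  then show ?thesis using pos by simp
next
  case False
  with A have A: "0 < A" by simp
  then have "0 < b * A powr p" using pos by simp
  then have I: "0 < I" using AI by linarith
  define \<gamma> where "\<gamma> = 1 / (1 - \<theta>)"
  have g: "\<gamma> * (1 - \<theta>) = 1" using th by (simp add: \<gamma>_def)
  have "1 / p < 1" "0 < 1 / q" using p by simp_all
  then have spos: "0 < s" unfolding s by linarith
  have sq: "s * q * \<theta> = 1" using th(1) spos p by simp
  have sq2: "s * q = 1 + q - q / p" using p by (simp add: s field_simps)
  have l1: "0 \<le> ln K + ln c - \<theta> * ln a - (1 - \<theta>) * ln b"
  proof -
    have "ln (a powr \<theta> * b powr (1 - \<theta>)) \<le> ln (K * c)"
      using prod pos by (subst ln_le_cancel_iff) auto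
    then show ?thesis using pos by (simp add: ln_mult ln_powr)
  qed
  have l2: "0 \<le> ln I - ln b - p * ln A"
  proof -
    have "ln (b * A powr p) \<le> ln I"
      using AI pos A I by (subst ln_le_cancel_iff) auto
    then show ?thesis using pos A by (simp add: ln_mult ln_powr)
  qed
  \<comment> \<open>In logarithms the claim is linear. Comparing the coefficients of ln a and ln b
    forces the multipliers s q + \<gamma> for \<open>prod\<close> and (q - p)/p for
    \<open>AI\<close>; the coefficients of ln c and ln A then agree as well.\<close>
  have "0 \<le> (s * q + \<gamma>) * (ln K + ln c - \<theta> * ln a - (1 - \<theta>) * ln b) + ((q - p) / p) * (ln I - ln b - p * ln A)"
    using spos p th l1 l2 by (intro add_nonneg_nonneg mult_nonneg_nonneg) (auto simp: \<gamma>_def)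
  also have "\<dots> = (s * q + \<gamma>) * ln K + (((q - p) / p) * ln I + \<gamma> * (p * (1 - \<theta>) * ln A + ln c - ln a))
       - q * (- s * ln c + (ln A + ln b))"
  proof -
    have e1: "(s * q + \<gamma>) * \<theta> = \<gamma>" using sq g by (simp add: algebra_simps)
    have e2: "(s * q + \<gamma>) * (1 - \<theta>) = q - q / p + 1" using sq sq2 g by (simp add: algebra_simps)
    have e3: "\<gamma> * (p * (1 - \<theta>) * ln A) = p * ln A"
    proof -
      have "\<gamma> * (p * (1 - \<theta>) * ln A) = (\<gamma> * (1 - \<theta>)) * (p * ln A)" by (simp only: ac_simps)
      then show ?thesis by (simp add: g)
    qed
    have e4: "((q - p) / p) * ln b = (q / p - 1) * ln b" "((q - p) / p) * (p * ln A) = (q - p) * ln A"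
      using p by (simp_all add: field_simps)
    have "(s * q + \<gamma>) * (ln K + ln c - \<theta> * ln a - (1 - \<theta>) * ln b) + ((q - p) / p) * (ln I - ln b - p * ln A)
       = (s * q + \<gamma>) * ln K + (s * q + \<gamma>) * ln c - ((s * q + \<gamma>) * \<theta>) * ln a - ((s * q + \<gamma>) * (1 - \<theta>)) * ln b
         + ((q - p) / p) * ln I - ((q - p) / p) * ln b - ((q - p) / p) * (p * ln A)"
      by (simp only: right_diff_distrib distrib_left mult.assoc[symmetric] diff_diff_eq add.assoc add_diff_eq)
    also have "\<dots> = (s * q + \<gamma>) * ln K + (((q - p) / p) * ln I + \<gamma> * (p * (1 - \<theta>) * ln A) + \<gamma> * (ln c - ln a))
       - q * (- s * ln c + (ln A + ln b))"
      unfolding e1 e2 e3 e4 by (simp add: algebra_simps)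
    finally show ?thesis by (simp only: right_diff_distrib distrib_left add.assoc add_diff_eq)
  qed
  finally have le: "q * (- s * ln c + (ln A + ln b)) \<le> (s * q + \<gamma>) * ln K + (((q - p) / p) * ln I + \<gamma> * (p * (1 - \<theta>) * ln A + ln c - ln a))"
    by simp
  have L: "ln ((c powr (- s) * (A * b)) powr q) = q * (- s * ln c + (ln A + ln b))"
    using pos A by (simp add: ln_powr ln_mult)
  have R: "ln (K powr (s * q + \<gamma>) * (I powr ((q - p) / p) * (A powr (p * (1 - \<theta>)) * c / a) powr \<gamma>))
     = (s * q + \<gamma>) * ln K + (((q - p) / p) * ln I + \<gamma> * (p * (1 - \<theta>) * ln A + ln c - ln a))"
    using pos A I by (simp add: ln_powr ln_mult ln_div)
  have "(c powr (- s) * (A * b)) powr q \<le> K powr (s * q + \<gamma>) * (I powr ((q - p) / p) * (A powr (p * (1 - \<theta>)) * c / a) powr \<gamma>)"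
    using le unfolding L[symmetric] R[symmetric] using pos A I by (subst (asm) ln_le_cancel_iff) auto
  then show ?thesis by (simp add: \<gamma>_def)
qed

lemma wmeas_Holder:
  fixes g :: "'a::euclidean_space \<Rightarrow> ennreal"
  assumes [measurable]: "g \<in> borel_measurable lebesgue" "v \<in> borel_measurable lebesgue" "E \<in> sets lebesgue"
    and v: "\<And>x. 0 \<le> v x" and p: "1 < p"
  shows "(\<integral>\<^sup>+ y \<in> E. g y * ennreal (v y) \<partial>lebesgue)
     \<le> enn_powr (\<integral>\<^sup>+ y \<in> E. enn_powr (g y) p * ennreal (v y) \<partial>lebesgue) (1 / p) * enn_powr (wmeas v E) (1 - 1 / p)"
proof -
  have "(\<integral>\<^sup>+ y \<in> E. g y * ennreal (v y) \<partial>lebesgue)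
     = (\<integral>\<^sup>+ y. enn_powr (enn_powr (g y) p * ennreal (v y) * indicator E y) (1 / p)
          * enn_powr (ennreal (v y) * indicator E y) (1 - 1 / p) \<partial>lebesgue)"
  proof (intro nn_integral_cong)
    fix y
    have "enn_powr (ennreal (v y)) (1 / p) * enn_powr (ennreal (v y)) (1 - 1 / p) = ennreal (v y)"
      using enn_powr_add[of "ennreal (v y)" "1 / p" "1 - 1 / p"] by simp
    then show "g y * ennreal (v y) * indicator E y = enn_powr (enn_powr (g y) p * ennreal (v y) * indicator E y) (1 / p)
          * enn_powr (ennreal (v y) * indicator E y) (1 - 1 / p)"
      using p by (auto simp: indicator_def enn_powr_mult enn_powr_cancel mult.assoc)
  qed
  also have "\<dots> \<le> enn_powr (\<integral>\<^sup>+ y \<in> E. enn_powr (g y) p * ennreal (v y) \<partial>lebesgue) (1 / p) * enn_powr (wmeas v E) (1 - 1 / p)"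
    unfolding wmeas_def by (rule nn_integral_Holder2) (use p in auto)
  finally show ?thesis .
qed

text \<open>With \<open>G\<close> the maximal function of \<open>g\<close> relative to \<open>v dx\<close>, and \<open>H\<close> that of
  \<open>G\<^bsup>p(1-\<theta>)\<^esup> / w\<close> relative to \<open>w dx\<close>, the weight condition bounds the \<open>q\<close>-th power of the fractional
  maximal function by a multiple of \<open>H\<^bsup>1/(1-\<theta>)\<^esup>\<close>; since \<open>w\<^bsup>1-1/(1-\<theta>)\<^esup> = v\<close>, two applications of the
  strong type inequality finish the proof.\<close>

theorem fractional_maximal_bound:
  fixes p q s \<theta> K :: real
  assumes p: "1 < p" "p < q" and s: "s = 1 / q + 1 - 1 / p" and th: "\<theta> = 1 / (q * s)"
  shows "\<exists>C>0. \<forall>(w :: 'a::euclidean_space \<Rightarrow> real) v g. muckenhoupt \<theta> K w v \<longrightarrow> g \<in> borel_measurable lebesgue \<longrightarrow>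
     (\<integral>\<^sup>+ x. enn_powr (SUP t\<in>{0<..}. ennreal (measure lebesgue (ball x t) powr (- s)) * (\<integral>\<^sup>+ y \<in> ball x t. g y * ennreal (v y) \<partial>lebesgue)) q
        * ennreal (w x) \<partial>lebesgue)
     \<le> ennreal C * enn_powr (\<integral>\<^sup>+ y. enn_powr (g y) p * ennreal (v y) \<partial>lebesgue) (q / p)"
proof -
  define \<gamma> where "\<gamma> = 1 / (1 - \<theta>)"
  \<comment> \<open>C1 and C2 are the strong type constants for the two doubling measures, at
    exponent \<gamma> for w dx and at exponent p for v dx; the bases of the powers are their
    doubling constants.\<close>
  define C1 where "C1 = (K * 5 ^ DIM('a)) powr (1 / \<theta>) * (\<gamma> / (\<gamma> - 1)) * 2 powr \<gamma>"
  define C2 where "C2 = (K * 5 ^ DIM('a)) powr (1 / (1 - \<theta>)) * (p / (p - 1)) * 2 powr p"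
  define C where "C = K powr (s * q + \<gamma>) * (C1 * C2)"
  have main: "(\<integral>\<^sup>+ x. enn_powr (SUP t\<in>{0<..}. ennreal (measure lebesgue (ball x t) powr (- s)) * (\<integral>\<^sup>+ y \<in> ball x t. g y * ennreal (v y) \<partial>lebesgue)) q
        * ennreal (w x) \<partial>lebesgue)
     \<le> ennreal (C + 1) * enn_powr (\<integral>\<^sup>+ y. enn_powr (g y) p * ennreal (v y) \<partial>lebesgue) (q / p)"
    if mu: "muckenhoupt \<theta> K w v" and g [measurable]: "g \<in> borel_measurable lebesgue" for w v :: "'a \<Rightarrow> real" and g
  proof -
    interpret W: muckenhoupt \<theta> K w v by (rule mu)
    interpret V: muckenhoupt "1 - \<theta>" K v w by (rule muckenhoupt_swap[OF mu])
    define Mw where "Mw = density lebesgue (\<lambda>x. ennreal (w x))"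
    define Mv where "Mv = density lebesgue (\<lambda>x. ennreal (v x))"
    interpret DW: doubling_measure Mw "(K * 5 ^ DIM('a)) powr (1 / \<theta>)"
      unfolding Mw_def by (rule W.doubling_density)
    interpret DV: doubling_measure Mv "(K * 5 ^ DIM('a)) powr (1 / (1 - \<theta>))"
      unfolding Mv_def by (rule V.doubling_density)
    note th01 = W.theta
    have g1: "1 < \<gamma>" using th01 by (simp add: \<gamma>_def)
    have C12: "0 \<le> C1" "0 \<le> C2" using g1 p by (auto simp: C1_def C2_def)
    then have C0: "0 \<le> C" by (auto simp: C_def)
    define I where "I = (\<integral>\<^sup>+ y. enn_powr (g y) p * ennreal (v y) \<partial>lebesgue)"
    define G where "G = maximal_fn Mv g"
    have [measurable]: "G \<in> borel_measurable lebesgue" unfolding G_def by measurable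
    define h where "h y = enn_powr (G y) (p * (1 - \<theta>)) * ennreal (1 / w y)" for y
    have [measurable]: "h \<in> borel_measurable lebesgue" unfolding h_def by measurable
    define H where "H = maximal_fn Mw h"
    have [measurable]: "H \<in> borel_measurable lebesgue" unfolding H_def by measurable
    have meas_eq: "borel_measurable Mw = borel_measurable (lebesgue :: 'a measure)" "borel_measurable Mv = borel_measurable (lebesgue :: 'a measure)"
      by (auto intro!: measurable_cong_sets simp: DW.sets_M DV.sets_M)
    have int_w: "(\<integral>\<^sup>+ x. F x \<partial>Mw) = (\<integral>\<^sup>+ x. ennreal (w x) * F x \<partial>lebesgue)"
      and int_v: "(\<integral>\<^sup>+ x. F x \<partial>Mv) = (\<integral>\<^sup>+ x. ennreal (v x) * F x \<partial>lebesgue)"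
      if [measurable]: "F \<in> borel_measurable lebesgue" for F
      unfolding Mw_def Mv_def by (subst nn_integral_density; simp)+
    show ?thesis
    proof (cases "I = top")
      case True
      then show ?thesis using C0 unfolding I_def[symmetric] by (simp add: ennreal_mult_top)
    next
      case False
      then obtain I' where I': "I = ennreal I'" "0 \<le> I'" by (cases I) auto
      have pointwise: "enn_powr (SUP t\<in>{0<..}. ennreal (measure lebesgue (ball x t) powr (- s)) * (\<integral>\<^sup>+ y \<in> ball x t. g y * ennreal (v y) \<partial>lebesgue)) q
         \<le> ennreal (K powr (s * q + \<gamma>) * I' powr ((q - p) / p)) * enn_powr (H x) \<gamma>" (is "enn_powr (SUP t\<in>_. ?T t) q \<le> ?R") for x
      proof -
        have "?T t \<le> enn_powr ?R (1 / q)" if t: "t \<in> {0<..}" for t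
        proof -
          have t: "0 < t" using t by simp
          let ?B = "ball x t"
          obtain a where a: "wmeas w ?B = ennreal a" "0 < a"
            using W.wmeas_ball_finite[of x t] W.wmeas_ball_pos[OF t, of x] by (cases "wmeas w ?B") (auto simp: ennreal_less_zero_iff)
          obtain b where b: "wmeas v ?B = ennreal b" "0 < b"
            using V.wmeas_ball_finite[of x t] V.wmeas_ball_pos[OF t, of x] by (cases "wmeas v ?B") (auto simp: ennreal_less_zero_iff)
          define c where "c = measure lebesgue ?B"
          have c: "ball_meas x t = ennreal c" "0 < c"
            using ball_meas_pos[OF t, of x] by (simp_all add: c_def ball_meas_conv_measure ennreal_less_zero_iff)
          define J where "J = (\<integral>\<^sup>+ y \<in> ?B. g y * ennreal (v y) \<partial>lebesgue)"
          have "J \<le> enn_powr (\<integral>\<^sup>+ y \<in> ?B. enn_powr (g y) p * ennreal (v y) \<partial>lebesgue) (1 / p) * enn_powr (wmeas v ?B) (1 - 1 / p)"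
            unfolding J_def by (rule wmeas_Holder) (auto simp: W.v_nonneg p)
          also have "\<dots> \<le> enn_powr I (1 / p) * enn_powr (wmeas v ?B) (1 - 1 / p)"
            unfolding I_def using p
            by (intro mult_right_mono enn_powr_mono nn_integral_mono) (auto simp: indicator_def)
          also have "\<dots> = ennreal (I' powr (1 / p) * b powr (1 - 1 / p))"
            using I' b by (simp add: enn_powr_ennreal ennreal_mult)
          finally have JI: "J \<le> ennreal (I' powr (1 / p) * b powr (1 - 1 / p))" .
          then obtain j where j: "J = ennreal j" "0 \<le> j"
            by (cases J) (auto simp: top_unique)
          define A where "A = j / b"
          have A: "0 \<le> A" "j = A * b" using j b by (auto simp: A_def)
          \<comment> \<open>Jensen's inequality for the average A with respect to v dx, with the
            integral over the ball enlarged to the whole space.\<close>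
          have AI: "b * A powr p \<le> I'"
          proof -
            have "A * b \<le> I' powr (1 / p) * b powr (1 - 1 / p)"
              using JI j A by (simp add: ennreal_le_iff)
            then have "(A * b) powr p \<le> (I' powr (1 / p) * b powr (1 - 1 / p)) powr p"
              using A b p by (intro powr_mono2) auto
            also have "\<dots> = I' * b powr (p - 1)"
              using I' b p by (simp add: powr_mult powr_powr algebra_simps)
            finally have "A powr p * b powr p \<le> I' * b powr (p - 1)"
              using A b by (simp add: powr_mult)
            moreover have "b powr p = b powr (p - 1) * b"
              using powr_add[of b "p - 1" 1] b by simp
            ultimately have "b powr (p - 1) * (b * A powr p) \<le> b powr (p - 1) * I'" by (simp add: ac_simps)
            then show ?thesis using b by (simp add: mult_le_cancel_left_pos)
          qed
          have prod: "a powr \<theta> * b powr (1 - \<theta>) \<le> K * c"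
          proof -
            have "ennreal (a powr \<theta> * b powr (1 - \<theta>)) \<le> ennreal (K * c)"
              using W.ball_product[OF t, of x] a b c W.K_pos
              by (simp add: enn_powr_ennreal ennreal_mult)
            then show ?thesis using W.K_pos c by (simp add: ennreal_le_iff)
          qed
          have GA: "ennreal A \<le> G y" if y: "y \<in> ?B" for y
          proof -
            have "ennreal A = J / wmeas v ?B"
              using j b by (simp add: A_def divide_ennreal)
            also have "\<dots> = (\<integral>\<^sup>+ z \<in> ball (fst (x, t)) (snd (x, t)). g z \<partial>Mv) / emeasure Mv (ball (fst (x, t)) (snd (x, t)))"
              unfolding Mv_def J_def
              by (subst nn_integral_density) (auto simp: wmeas_density ac_simps)
            also have "\<dots> \<le> G y"
              unfolding G_def maximal_fn_def using y t by (intro SUP_upper) auto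
            finally show ?thesis .
          qed
          \<comment> \<open>The factor 1/w in \<open>h\<close> turns integration against w dx into
            Lebesgue integration. As G >= A on the ball, the w-average of \<open>h\<close> is
            therefore at least A^(p(1-\<theta>)) |B| / w(B).\<close>
          have HA: "ennreal (A powr (p * (1 - \<theta>)) * c / a) \<le> H x"
          proof -
            have "ennreal (A powr (p * (1 - \<theta>))) * ball_meas x t = (\<integral>\<^sup>+ z. ennreal (A powr (p * (1 - \<theta>))) * indicator ?B z \<partial>lebesgue)"
              by (simp add: ball_meas_def nn_integral_cmult_indicator)
            also have "\<dots> \<le> (\<integral>\<^sup>+ z. h z * ennreal (w z) * indicator ?B z \<partial>lebesgue)"
            proof (rule nn_integral_mono_AE)
              show "AE z in lebesgue. ennreal (A powr (p * (1 - \<theta>))) * indicator ?B z \<le> h z * ennreal (w z) * indicator ?B z"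
                using W.ae_pos
              proof eventually_elim
                case (elim z)
                then have "ennreal (1 / w z) * ennreal (w z) = 1"
                  by (simp add: ennreal_mult[symmetric])
                then have "h z * ennreal (w z) = enn_powr (G z) (p * (1 - \<theta>))"
                  by (simp add: h_def mult.assoc)
                moreover have "z \<in> ?B \<Longrightarrow> ennreal (A powr (p * (1 - \<theta>))) \<le> enn_powr (G z) (p * (1 - \<theta>))"
                  using enn_powr_mono[OF GA, of z "p * (1 - \<theta>)"] p th01 A by (simp add: enn_powr_ennreal)
                ultimately show ?case by (auto simp: indicator_def)
              qed
            qed
            finally have "ennreal (A powr (p * (1 - \<theta>))) * ball_meas x t / wmeas w ?B \<le> (\<integral>\<^sup>+ z. h z * ennreal (w z) * indicator ?B z \<partial>lebesgue) / wmeas w ?B"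
              by (rule divide_right_mono_ennreal)
            also have "\<dots> = (\<integral>\<^sup>+ z \<in> ball (fst (x, t)) (snd (x, t)). h z \<partial>Mw) / emeasure Mw (ball (fst (x, t)) (snd (x, t)))"
              unfolding Mw_def
              by (subst nn_integral_density) (auto simp: wmeas_density ac_simps)
            also have "\<dots> \<le> H x"
              unfolding H_def maximal_fn_def using t by (intro SUP_upper) auto
            finally show ?thesis
              using a c by (simp add: ennreal_mult[symmetric] divide_ennreal)
          qed
          have "?T t = ennreal (c powr (- s) * (A * b))"
            unfolding J_def[symmetric] c_def[symmetric] j(1) A(2)[symmetric] using j by (simp add: ennreal_mult)
          also have "enn_powr \<dots> q = ennreal ((c powr (- s) * (A * b)) powr q)"
            using A b by (simp add: enn_powr_ennreal)
          also have "\<dots> \<le> ennreal (K powr (s * q + \<gamma>) * (I' powr ((q - p) / p) * (A powr (p * (1 - \<theta>)) * c / a) powr \<gamma>))"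
            unfolding \<gamma>_def
            by (intro ennreal_leI fractional_power_inequality[OF p s th]) (use th01 a b c W.K_pos A prod AI in auto)
          also have "\<dots> = ennreal (K powr (s * q + \<gamma>) * I' powr ((q - p) / p)) * enn_powr (ennreal (A powr (p * (1 - \<theta>)) * c / a)) \<gamma>"
            using A a c by (simp add: enn_powr_ennreal ennreal_mult[symmetric] mult.assoc)
          also have "\<dots> \<le> ?R"
            using g1 by (intro mult_left_mono enn_powr_mono HA) auto
          finally show ?thesis using p by (subst enn_powr_le_iff2[symmetric]) auto
        qed
        then have "(SUP t\<in>{0<..}. ?T t) \<le> enn_powr ?R (1 / q)" by (rule SUP_least)
        then show ?thesis using p by (subst enn_powr_le_iff2) auto
      qed
      have H_int: "(\<integral>\<^sup>+ x. enn_powr (H x) \<gamma> * ennreal (w x) \<partial>lebesgue) \<le> ennreal (C1 * C2) * I"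
      proof -
        have "(\<integral>\<^sup>+ x. enn_powr (H x) \<gamma> * ennreal (w x) \<partial>lebesgue) = (\<integral>\<^sup>+ x. enn_powr (maximal_fn Mw h x) \<gamma> \<partial>Mw)"
          unfolding H_def[symmetric] by (subst int_w) (auto simp: mult.commute)
        also have "\<dots> \<le> ennreal C1 * (\<integral>\<^sup>+ x. enn_powr (h x) \<gamma> \<partial>Mw)"
          unfolding C1_def by (rule DW.maximal_fn_strong_type) (auto simp: meas_eq g1)
        also have "(\<integral>\<^sup>+ x. enn_powr (h x) \<gamma> \<partial>Mw) = (\<integral>\<^sup>+ x. ennreal (w x) * enn_powr (h x) \<gamma> \<partial>lebesgue)"
          by (subst int_w) auto
        also have "\<dots> = (\<integral>\<^sup>+ x. ennreal (v x) * enn_powr (G x) p \<partial>lebesgue)"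
        proof (rule nn_integral_cong_AE)
          show "AE x in lebesgue. ennreal (w x) * enn_powr (h x) \<gamma> = ennreal (v x) * enn_powr (G x) p"
            using W.ae_pos W.ae_prod
          proof eventually_elim
            case (elim x)
            have "w x * (1 / w x) powr \<gamma> = v x"
            proof -
              have "v x powr (1 - \<theta>) = w x powr (- \<theta>)"
                using elim by (simp add: powr_minus field_simps)
              then have "(v x powr (1 - \<theta>)) powr \<gamma> = (w x powr (- \<theta>)) powr \<gamma>" by simp
              then have "v x = w x powr (- \<theta> * \<gamma>)"
                using elim th01 by (simp add: powr_powr \<gamma>_def)
              also have "- \<theta> * \<gamma> = 1 - \<gamma>" using th01 by (simp add: \<gamma>_def field_simps)
              also have "w x powr (1 - \<gamma>) = w x * (1 / w x) powr \<gamma>"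
                using elim by (simp add: powr_diff powr_divide)
              finally show ?thesis by simp
            qed
            then have "ennreal (w x) * enn_powr (ennreal (1 / w x)) \<gamma> = ennreal (v x)"
              using elim by (simp add: enn_powr_ennreal ennreal_mult[symmetric])
            moreover have "p * (1 - \<theta>) * \<gamma> = p" using th01 by (simp add: \<gamma>_def)
            moreover have "ennreal (w x) * enn_powr (h x) \<gamma>
               = ennreal (w x) * enn_powr (ennreal (1 / w x)) \<gamma> * enn_powr (G x) (p * (1 - \<theta>) * \<gamma>)"
              unfolding h_def enn_powr_mult enn_powr_powr by (simp only: ac_simps)
            ultimately show ?case by (simp only:)
          qed
        qed
        also have "\<dots> = (\<integral>\<^sup>+ x. enn_powr (maximal_fn Mv g x) p \<partial>Mv)"
          unfolding G_def[symmetric] by (subst int_v) auto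
        also have "\<dots> \<le> ennreal C2 * (\<integral>\<^sup>+ x. enn_powr (g x) p \<partial>Mv)"
          unfolding C2_def by (rule DV.maximal_fn_strong_type) (auto simp: meas_eq p)
        also have "(\<integral>\<^sup>+ x. enn_powr (g x) p \<partial>Mv) = I"
          unfolding I_def by (subst int_v) (auto simp: mult.commute)
        finally show ?thesis using C12 by (simp add: mult_left_mono ennreal_mult mult.assoc)
      qed
      have "(\<integral>\<^sup>+ x. enn_powr (SUP t\<in>{0<..}. ennreal (measure lebesgue (ball x t) powr (- s)) * (\<integral>\<^sup>+ y \<in> ball x t. g y * ennreal (v y) \<partial>lebesgue)) q
        * ennreal (w x) \<partial>lebesgue) \<le> (\<integral>\<^sup>+ x. ennreal (K powr (s * q + \<gamma>) * I' powr ((q - p) / p)) * (enn_powr (H x) \<gamma> * ennreal (w x)) \<partial>lebesgue)"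
        unfolding mult.assoc[symmetric] by (intro nn_integral_mono mult_right_mono pointwise) auto
      also have "\<dots> = ennreal (K powr (s * q + \<gamma>) * I' powr ((q - p) / p)) * (\<integral>\<^sup>+ x. enn_powr (H x) \<gamma> * ennreal (w x) \<partial>lebesgue)"
        by (intro nn_integral_cmult) measurable
      also have "\<dots> \<le> ennreal (K powr (s * q + \<gamma>) * I' powr ((q - p) / p)) * (ennreal (C1 * C2) * I)"
        by (intro mult_left_mono H_int) auto
      also have "\<dots> = ennreal (C * (I' powr ((q - p) / p) * I'))"
        using C12 I' by (simp add: C_def ennreal_mult[symmetric] ac_simps)
      also have "I' powr ((q - p) / p) * I' = I' powr (q / p)"
        using powr_add[of I' "(q - p) / p" 1] I' p by (simp add: diff_divide_distrib)
      also have "ennreal (C * I' powr (q / p)) = ennreal C * enn_powr I (q / p)"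
        using C0 I' by (simp add: enn_powr_ennreal ennreal_mult)
      also have "\<dots> \<le> ennreal (C + 1) * enn_powr I (q / p)"
        by (intro mult_right_mono ennreal_leI) auto
      finally show ?thesis unfolding I_def .
    qed
  qed
  show ?thesis
  \<comment> \<open>Nonnegativity of C was obtained from the locale of a given pair; the maximum
    makes the constant positive before any pair is fixed.\<close>
  proof (intro exI[of _ "max 0 C + 1"] conjI allI impI)
    fix w v :: "'a \<Rightarrow> real" and g :: "'a \<Rightarrow> ennreal"
    assume "muckenhoupt \<theta> K w v" "g \<in> borel_measurable lebesgue"
    from main[OF this] show "(\<integral>\<^sup>+ x. enn_powr (SUP t\<in>{0<..}. ennreal (measure lebesgue (ball x t) powr (- s)) * (\<integral>\<^sup>+ y \<in> ball x t. g y * ennreal (v y) \<partial>lebesgue)) q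
        * ennreal (w x) \<partial>lebesgue)
     \<le> ennreal (max 0 C + 1) * enn_powr (\<integral>\<^sup>+ y. enn_powr (g y) p * ennreal (v y) \<partial>lebesgue) (q / p)"
      by (rule order_trans) (intro mult_right_mono ennreal_leI, auto)
  qed simp
qed

section \<open>Dyadic cubes\<close>

lemma nn_integral_Union_disjoint:
  assumes S: "countable S" "disjoint S" "\<And>D. D \<in> S \<Longrightarrow> D \<in> sets M" and F: "F \<in> borel_measurable M"
  shows "(\<integral>\<^sup>+ y \<in> \<Union>S. F y \<partial>M) = (\<integral>\<^sup>+ D. (\<integral>\<^sup>+ y \<in> D. F y \<partial>M) \<partial>count_space S)"
proof -
  have "F y * indicator (\<Union>S) y = (\<integral>\<^sup>+ D. F y * indicator D y \<partial>count_space S)" for y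
  proof (cases "y \<in> \<Union>S")
    case True
    then obtain E where E: "E \<in> S" "y \<in> E" by auto
    then have "y \<notin> D" if "D \<in> S" "D \<noteq> E" for D
      using S(2) that unfolding disjoint_def by blast
    then have "(\<integral>\<^sup>+ D. F y * indicator D y \<partial>count_space S) = (\<integral>\<^sup>+ D. F y * indicator {E} D \<partial>count_space S)"
      using E by (intro nn_integral_cong) (auto simp: indicator_def)
    also have "\<dots> = F y" using E(1) by (simp add: nn_integral_cmult)
    finally show ?thesis using True by simp
  next
    case False
    then have "(\<integral>\<^sup>+ D. F y * indicator D y \<partial>count_space S) = (\<integral>\<^sup>+ D. 0 \<partial>count_space S)"
      by (intro nn_integral_cong) (auto simp: indicator_def)
    then show ?thesis using False by simp
  qed
  then have "(\<integral>\<^sup>+ y \<in> \<Union>S. F y \<partial>M) = (\<integral>\<^sup>+ y. (\<integral>\<^sup>+ D. F y * indicator D y \<partial>count_space S) \<partial>M)" by simp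
  also have "\<dots> = (\<integral>\<^sup>+ D. (\<integral>\<^sup>+ y \<in> D. F y \<partial>M) \<partial>count_space S)"
    using F S(3) by (intro nn_integral_count_space_nn_integral S(1)) auto
  finally show ?thesis .
qed

text \<open>The half-open dyadic cube of side l / 2^k containing \<open>x\<close>, in the grid with
  vertex \<open>a\<close>. Cubes are indexed by their points: equality of cubes becomes equality of
  floors, and nesting becomes the identity floor(t) = floor(2t) div 2.\<close>

definition dcube :: "'a::euclidean_space \<Rightarrow> real \<Rightarrow> nat \<Rightarrow> 'a \<Rightarrow> 'a set" where
  "dcube a l k x = {y. \<forall>i\<in>Basis. \<lfloor>2 ^ k * ((y - a) \<bullet> i) / l\<rfloor> = \<lfloor>2 ^ k * ((x - a) \<bullet> i) / l\<rfloor>}"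

lemma dcube_self [simp]: "x \<in> dcube a l k x"
  by (simp add: dcube_def)

lemma dcube_eq: "y \<in> dcube a l k x \<Longrightarrow> dcube a l k y = dcube a l k x"
  by (auto simp: dcube_def)

lemma dcube_Suc_subset: "dcube a l (Suc k) x \<subseteq> dcube a l k x"
proof
  fix y assume y: "y \<in> dcube a l (Suc k) x"
  show "y \<in> dcube a l k x"
    unfolding dcube_def
  proof safe
    fix i :: 'a assume i: "i \<in> Basis"
    have *: "\<lfloor>2 ^ k * t / l\<rfloor> = \<lfloor>2 ^ Suc k * t / l\<rfloor> div 2" for t
      using floor_divide_real_eq_div[of 2 "2 ^ Suc k * t / l"] by simp
    show "\<lfloor>2 ^ k * ((y - a) \<bullet> i) / l\<rfloor> = \<lfloor>2 ^ k * ((x - a) \<bullet> i) / l\<rfloor>"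
      using y i unfolding * dcube_def by simp
  qed
qed

lemma dcube_mono: "j \<le> k \<Longrightarrow> dcube a l k x \<subseteq> dcube a l j x"
  by (induction k rule: dec_induct) (use dcube_Suc_subset in blast)+

lemma dcube_coord:
  assumes "0 < l" "y \<in> dcube a l k x" "i \<in> Basis"
  shows "\<bar>(y - x) \<bullet> i\<bar> < l / 2 ^ k"
proof -
  have "\<lfloor>2 ^ k * ((y - a) \<bullet> i) / l\<rfloor> = \<lfloor>2 ^ k * ((x - a) \<bullet> i) / l\<rfloor>"
    using assms by (simp add: dcube_def)
  then have "\<bar>2 ^ k * ((y - a) \<bullet> i) / l - 2 ^ k * ((x - a) \<bullet> i) / l\<bar> < 1" by linarith
  also have "2 ^ k * ((y - a) \<bullet> i) / l - 2 ^ k * ((x - a) \<bullet> i) / l = ((y - x) \<bullet> i) * (2 ^ k / l)"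
    by (simp add: algebra_simps diff_divide_distrib)
  finally show ?thesis using assms(1) by (simp add: abs_mult field_simps)
qed

lemma dcube_subset_ball:
  fixes x :: "'a::euclidean_space"
  assumes l: "0 < l"
  shows "dcube a l k x \<subseteq> ball x (real DIM('a) * (l / 2 ^ k))"
proof
  fix y assume y: "y \<in> dcube a l k x"
  have "norm (y - x) \<le> (\<Sum>i\<in>Basis. \<bar>(y - x) \<bullet> i\<bar>)" by (rule norm_le_l1)
  also have "\<dots> < (\<Sum>i\<in>(Basis::'a set). l / 2 ^ k)"
    using dcube_coord[OF l y] by (intro sum_strict_mono) auto
  finally show "y \<in> ball x (real DIM('a) * (l / 2 ^ k))"
    by (simp add: dist_norm norm_minus_commute)
qed

lemma dcube_half_open_box:
  fixes x a :: "'a::euclidean_space"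
  assumes l: "0 < l"
  obtains c where "box c (c + (l / 2 ^ k) *\<^sub>R One) \<subseteq> dcube a l k x" "dcube a l k x \<subseteq> cbox c (c + (l / 2 ^ k) *\<^sub>R One)"
proof -
  define z where "z i = \<lfloor>2 ^ k * ((x - a) \<bullet> i) / l\<rfloor>" for i
  define c where "c = a + (\<Sum>i\<in>Basis. (of_int (z i) * (l / 2 ^ k)) *\<^sub>R i)"
  have ci: "c \<bullet> i = a \<bullet> i + of_int (z i) * (l / 2 ^ k)" if "i \<in> Basis" for i
    using that by (simp add: c_def inner_add_left)
  have iff: "\<lfloor>2 ^ k * ((y - a) \<bullet> i) / l\<rfloor> = z i \<longleftrightarrow> c \<bullet> i \<le> y \<bullet> i \<and> y \<bullet> i < c \<bullet> i + l / 2 ^ k" if "i \<in> Basis" for y i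
  proof -
    have "\<lfloor>2 ^ k * ((y - a) \<bullet> i) / l\<rfloor> = z i \<longleftrightarrow> of_int (z i) \<le> 2 ^ k * ((y - a) \<bullet> i) / l \<and> 2 ^ k * ((y - a) \<bullet> i) / l < of_int (z i) + 1"
      by (simp add: floor_eq_iff)
    also have "\<dots> \<longleftrightarrow> c \<bullet> i \<le> y \<bullet> i \<and> y \<bullet> i < c \<bullet> i + l / 2 ^ k"
      unfolding ci[OF that] using l by (simp add: field_simps inner_diff_left)
    finally show ?thesis .
  qed
  show ?thesis
  proof
    show "box c (c + (l / 2 ^ k) *\<^sub>R One) \<subseteq> dcube a l k x"
      unfolding dcube_def z_def[symmetric] using iff by (auto simp: mem_box inner_add_left less_imp_le)
    show "dcube a l k x \<subseteq> cbox c (c + (l / 2 ^ k) *\<^sub>R One)"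
      unfolding dcube_def z_def[symmetric] using iff by (auto simp: mem_box inner_add_left less_imp_le)
  qed
qed

lemma sets_dcube [measurable]: "dcube a l k x \<in> sets lebesgue"
proof -
  have "dcube a l k x = (\<Inter>i\<in>Basis. {y. \<lfloor>2 ^ k * ((y - a) \<bullet> i) / l\<rfloor> = \<lfloor>2 ^ k * ((x - a) \<bullet> i) / l\<rfloor>})"
    by (auto simp: dcube_def)
  also have "\<dots> \<in> sets borel"
    by (intro sets.countable_INT'') (auto simp: countable_finite)
  finally show ?thesis by simp
qed

lemma emeasure_dcube:
  fixes x :: "'a::euclidean_space"
  assumes l: "0 < l"
  shows "emeasure lebesgue (dcube a l k x) = ennreal ((l / 2 ^ k) ^ DIM('a))"
proof -
  obtain c where c: "box c (c + (l / 2 ^ k) *\<^sub>R One) \<subseteq> dcube a l k x" "dcube a l k x \<subseteq> cbox c (c + (l / 2 ^ k) *\<^sub>R One)"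
    by (rule dcube_half_open_box[OF l])
  have "emeasure lebesgue (cbox c (c + (l / 2 ^ k) *\<^sub>R One)) = ennreal ((l / 2 ^ k) ^ DIM('a))"
    "emeasure lebesgue (box c (c + (l / 2 ^ k) *\<^sub>R One)) = ennreal ((l / 2 ^ k) ^ DIM('a))"
    using l by (auto simp: emeasure_lborel_cbox_eq emeasure_lborel_box_eq inner_add_left)
  moreover have "emeasure lebesgue (dcube a l k x) \<le> emeasure lebesgue (cbox c (c + (l / 2 ^ k) *\<^sub>R One))"
    "emeasure lebesgue (box c (c + (l / 2 ^ k) *\<^sub>R One)) \<le> emeasure lebesgue (dcube a l k x)"
    by (intro emeasure_mono c; simp)+
  ultimately show ?thesis by (intro antisym) auto
qed

lemma countable_dcubes: "countable (range (dcube a l k))"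
proof -
  let ?f = "\<lambda>z :: 'a::euclidean_space \<Rightarrow> int. {y. \<forall>i\<in>Basis. \<lfloor>2 ^ k * ((y - a) \<bullet> i) / l\<rfloor> = z i}"
  have "range (dcube a l k) \<subseteq> ?f ` (Pi\<^sub>E Basis (\<lambda>_. UNIV))"
  proof
    fix D assume "D \<in> range (dcube a l k)"
    then obtain x where "D = dcube a l k x" by auto
    then have "D = ?f (restrict (\<lambda>i. \<lfloor>2 ^ k * ((x - a) \<bullet> i) / l\<rfloor>) Basis)"
      by (simp add: dcube_def)
    then show "D \<in> ?f ` (Pi\<^sub>E Basis (\<lambda>_. UNIV))"
      by (intro rev_image_eqI[of "restrict (\<lambda>i. \<lfloor>2 ^ k * ((x - a) \<bullet> i) / l\<rfloor>) Basis"]) auto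
  qed
  then show ?thesis
    by (rule countable_subset) (intro countable_image countable_PiE, auto)
qed

text \<open>The maximal cubes with property P: generation 0 is the coarsest, and no ancestor of a
  selected cube satisfies P.\<close>

definition stopping_cubes :: "'a::euclidean_space \<Rightarrow> real \<Rightarrow> ('a set \<Rightarrow> bool) \<Rightarrow> 'a set set" where
  "stopping_cubes a l P = {D. \<exists>k x. D = dcube a l k x \<and> P D \<and> (\<forall>j<k. \<not> P (dcube a l j x))}"

lemma countable_stopping_cubes: "countable (stopping_cubes a l P)"
proof -
  have "stopping_cubes a l P \<subseteq> (\<Union>k. range (dcube a l k))"
    unfolding stopping_cubes_def by auto
  then show ?thesis
    by (rule countable_subset) (intro countable_UN countable_dcubes, auto)
qed

text \<open>A common point z would make both cubes the first one with property P in the decreasing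
  chain of cubes around z.\<close>

lemma disjoint_stopping_cubes: "disjoint (stopping_cubes a l P)"
  unfolding disjoint_def
proof (intro ballI impI)
  fix D E assume D: "D \<in> stopping_cubes a l P" and E: "E \<in> stopping_cubes a l P" and ne: "D \<noteq> E"
  show "D \<inter> E = {}"
  proof (rule ccontr)
    assume "D \<inter> E \<noteq> {}"
    then obtain z where z: "z \<in> D" "z \<in> E" by auto
    have rep: "\<exists>k. F = dcube a l k z \<and> P F \<and> (\<forall>j<k. \<not> P (dcube a l j z))" if "F \<in> stopping_cubes a l P" "z \<in> F" for F
    proof -
      obtain k x where k: "F = dcube a l k x" "P F" "\<forall>j<k. \<not> P (dcube a l j x)"
        using \<open>F \<in> _\<close> by (auto simp: stopping_cubes_def)
      have "dcube a l j z = dcube a l j x" if "j \<le> k" for j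
        using \<open>z \<in> F\<close> k(1) dcube_mono[OF that, of a l x] by (intro dcube_eq) auto
      then show ?thesis using k by (intro exI[of _ k]) auto
    qed
    obtain k where k: "D = dcube a l k z" "P D" "\<forall>j<k. \<not> P (dcube a l j z)" using rep[OF D z(1)] by auto
    obtain k' where k': "E = dcube a l k' z" "P E" "\<forall>j<k'. \<not> P (dcube a l j z)" using rep[OF E z(2)] by auto
    have "k = k'" using k k' by (metis linorder_neqE_nat)
    then show False using k k' ne by simp
  qed
qed

lemma Union_stopping_cubes: "\<Union>(stopping_cubes a l P) = {x. \<exists>k. P (dcube a l k x)}"
proof (intro equalityI subsetI)
  fix x assume "x \<in> \<Union>(stopping_cubes a l P)"
  then obtain k y where "x \<in> dcube a l k y" "P (dcube a l k y)" by (auto simp: stopping_cubes_def)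
  moreover from this have "dcube a l k x = dcube a l k y" by (intro dcube_eq)
  ultimately have "P (dcube a l k x)" by simp
  then show "x \<in> {x. \<exists>k. P (dcube a l k x)}" by blast
next
  fix x assume "x \<in> {x. \<exists>k. P (dcube a l k x)}"
  then have ex: "\<exists>k. P (dcube a l k x)" by simp
  define k where "k = (LEAST k. P (dcube a l k x))"
  have "P (dcube a l k x)" "\<forall>j<k. \<not> P (dcube a l j x)"
    unfolding k_def using LeastI_ex[OF ex] not_less_Least by auto
  then have "dcube a l k x \<in> stopping_cubes a l P" unfolding stopping_cubes_def by auto
  then show "x \<in> \<Union>(stopping_cubes a l P)" by (rule UnionI) simp
qed

lemma stopping_cubes_sets: "D \<in> stopping_cubes a l P \<Longrightarrow> D \<in> sets lebesgue"
  unfolding stopping_cubes_def using sets_dcube by auto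

lemma stopping_cubes_P: "D \<in> stopping_cubes a l P \<Longrightarrow> P D"
  unfolding stopping_cubes_def by auto

lemma dcube_small:
  fixes x :: "'a::euclidean_space"
  assumes "open U" "x \<in> U" and l: "0 < l"
  shows "\<exists>k\<ge>k0. dcube a l k x \<subseteq> U"
proof -
  obtain e where e: "0 < e" "ball x e \<subseteq> U" using assms by (auto simp: open_contains_ball)
  obtain N where N: "real DIM('a) * l / e < 2 ^ N" using real_arch_pow[of 2] by auto
  define k where "k = max N k0"
  have "real DIM('a) * l / e < 2 ^ k"
    using N by (rule less_le_trans) (simp add: k_def)
  then have "real DIM('a) * (l / 2 ^ k) < e" using e(1) by (simp add: field_simps)
  then have "dcube a l k x \<subseteq> U"
    using dcube_subset_ball[OF l, of a k x] e(2) subset_ball[of "real DIM('a) * (l / 2 ^ k)" e x] by auto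
  then show ?thesis by (intro exI[of _ k]) (auto simp: k_def)
qed

text \<open>A substitute for the Lebesgue differentiation theorem: the exceptional set is covered
  efficiently by maximal cubes inside a tight open neighbourhood.\<close>

lemma AE_le_of_dyadic_averages_le:
  fixes f :: "'a::euclidean_space \<Rightarrow> ennreal" and a x0 :: 'a and \<mu> l :: real and k0 :: nat
  assumes l: "0 < l" and f [measurable]: "f \<in> borel_measurable lebesgue" and \<mu>: "0 \<le> \<mu>"
  defines "Q \<equiv> dcube a l k0 x0"
  shows "AE x in lebesgue. x \<in> Q \<longrightarrow>
     (\<forall>k. dcube a l k x \<subseteq> Q \<longrightarrow> (\<integral>\<^sup>+ y \<in> dcube a l k x. f y \<partial>lebesgue) \<le> ennreal \<mu> * emeasure lebesgue (dcube a l k x))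
     \<longrightarrow> f x \<le> ennreal \<mu>"
proof -
  define P where "P D \<longleftrightarrow> D \<subseteq> Q \<and> \<not> (\<integral>\<^sup>+ y \<in> D. f y \<partial>lebesgue) \<le> ennreal \<mu> * emeasure lebesgue D" for D
  define E where "E = {x. \<exists>k. P (dcube a l k x)}"
  have [measurable]: "E \<in> sets lebesgue"
    unfolding E_def Union_stopping_cubes[symmetric]
    by (intro sets.countable_Union countable_stopping_cubes) (auto dest: stopping_cubes_sets)
  have Qs [measurable]: "Q \<in> sets lebesgue" by (simp add: Q_def)
  have "{x. ennreal \<mu> < f x} = {x \<in> space lebesgue. ennreal \<mu> < f x}" by simp
  also have "\<dots> \<in> sets lebesgue" by measurable
  finally have fl [measurable]: "{x. ennreal \<mu> < f x} \<in> sets lebesgue" .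
  \<comment> \<open>The points at which the conclusion fails although no cube around them inside Q
    has a large average. It will be shown that the integral of f over G is at most \<mu> |G|; since
    f > \<mu> on G, this forces G to be null.\<close>
  define G where "G = (Q \<inter> {x. ennreal \<mu> < f x}) - E"
  have [measurable]: "G \<in> sets lebesgue" unfolding G_def by measurable
  have Gfin: "emeasure lebesgue G < top"
  proof -
    have "emeasure lebesgue G \<le> emeasure lebesgue Q" by (intro emeasure_mono Qs) (auto simp: G_def)
    also have "\<dots> < top" by (simp add: Q_def emeasure_dcube[OF l])
    finally show ?thesis .
  qed
  have int_le: "(\<integral>\<^sup>+ y \<in> G. f y \<partial>lebesgue) \<le> ennreal \<mu> * emeasure lebesgue G"
  proof (rule ennreal_le_epsilon)
    fix e :: real assume e: "0 < e"
    \<comment> \<open>Dividing by \<mu> + 1 instead of \<mu> gives \<mu> e' <= e also when \<mu> =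
      0.\<close>
    define e' where "e' = e / (\<mu> + 1)"
    have e': "0 < e'" using e \<mu> by (simp add: e'_def)
    have "\<mu> * e' \<le> e" using e \<mu> by (simp add: e'_def field_simps)
    obtain U where U: "open U" "G \<subseteq> U" "emeasure lebesgue (U - G) < ennreal e'"
      by (rule sets_lebesgue_outer_open[OF \<open>G \<in> sets lebesgue\<close> e']) auto
    have [measurable]: "U \<in> sets lebesgue" using U(1) by simp
    \<comment> \<open>Every selected cube meets G, so it is a cube around a point outside E: its
      average of f is at most \<mu>. Lying inside U, the disjoint selected cubes have total measure
      at most |G| + e'.\<close>
    define R where "R D \<longleftrightarrow> D \<subseteq> U \<and> D \<subseteq> Q \<and> D \<inter> G \<noteq> {}" for D
    have cov: "G \<subseteq> \<Union>(stopping_cubes a l R)"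
    proof
      fix x assume x: "x \<in> G"
      then obtain k where k: "k \<ge> k0" "dcube a l k x \<subseteq> U" using dcube_small[OF U(1) _ l, of x k0 a] U(2) by auto
      have "x \<in> Q" using x by (simp add: G_def)
      then have "dcube a l k x \<subseteq> Q"
        using dcube_mono[OF k(1), of a l x] dcube_eq[of x a l k0 x0] by (auto simp: Q_def)
      moreover have "x \<in> dcube a l k x \<inter> G" using x by simp
      ultimately have "R (dcube a l k x)" using k(2) unfolding R_def by blast
      then show "x \<in> \<Union>(stopping_cubes a l R)" unfolding Union_stopping_cubes by auto
    qed
    have "(\<integral>\<^sup>+ y \<in> G. f y \<partial>lebesgue) \<le> (\<integral>\<^sup>+ y \<in> \<Union>(stopping_cubes a l R). f y \<partial>lebesgue)"
      using cov by (intro nn_integral_mono) (auto simp: indicator_def)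
    also have "\<dots> = (\<integral>\<^sup>+ D. (\<integral>\<^sup>+ y \<in> D. f y \<partial>lebesgue) \<partial>count_space (stopping_cubes a l R))"
      by (intro nn_integral_Union_disjoint countable_stopping_cubes disjoint_stopping_cubes stopping_cubes_sets f)
    also have "\<dots> \<le> (\<integral>\<^sup>+ D. ennreal \<mu> * emeasure lebesgue D \<partial>count_space (stopping_cubes a l R))"
    proof (rule nn_integral_mono)
      fix D assume "D \<in> space (count_space (stopping_cubes a l R))"
      then have D: "D \<in> stopping_cubes a l R" by simp
      then obtain x where x: "x \<in> D" "x \<in> G" and DQ: "D \<subseteq> Q" using stopping_cubes_P[OF D] by (auto simp: R_def)
      obtain k z where "D = dcube a l k z" using D by (auto simp: stopping_cubes_def)
      then have "D = dcube a l k x" using x dcube_eq by metis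
      then have "\<not> P D" using x(2) by (auto simp: G_def E_def)
      then show "(\<integral>\<^sup>+ y \<in> D. f y \<partial>lebesgue) \<le> ennreal \<mu> * emeasure lebesgue D"
        using DQ by (simp add: P_def)
    qed
    also have "\<dots> = ennreal \<mu> * (\<integral>\<^sup>+ D. (\<integral>\<^sup>+ y \<in> D. 1 \<partial>lebesgue) \<partial>count_space (stopping_cubes a l R))"
      by (subst nn_integral_cmult) (auto intro!: arg_cong2[of _ _ _ _ "(*)"] nn_integral_cong simp: stopping_cubes_sets)
    also have "(\<integral>\<^sup>+ D. (\<integral>\<^sup>+ y \<in> D. 1 \<partial>lebesgue) \<partial>count_space (stopping_cubes a l R)) = (\<integral>\<^sup>+ y \<in> \<Union>(stopping_cubes a l R). 1 \<partial>lebesgue)"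
      by (intro nn_integral_Union_disjoint[symmetric] countable_stopping_cubes disjoint_stopping_cubes stopping_cubes_sets) auto
    also have "\<dots> \<le> (\<integral>\<^sup>+ y. indicator U y \<partial>lebesgue)"
      by (intro nn_integral_mono) (auto simp: indicator_def dest!: stopping_cubes_P simp: R_def)
    also have "\<dots> = emeasure lebesgue (G \<union> (U - G))"
      using U(2) by (simp add: Un_absorb1)
    also have "\<dots> \<le> emeasure lebesgue G + emeasure lebesgue (U - G)"
      by (intro emeasure_subadditive) auto
    also have "\<dots> \<le> emeasure lebesgue G + ennreal e'"
      using U(3) by (intro add_left_mono) auto
    also have "ennreal \<mu> * (emeasure lebesgue G + ennreal e') = ennreal \<mu> * emeasure lebesgue G + ennreal (\<mu> * e')"
      using \<mu> e' by (simp add: distrib_left ennreal_mult)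
    also have "\<dots> \<le> ennreal \<mu> * emeasure lebesgue G + ennreal e"
      by (intro add_left_mono ennreal_leI \<open>\<mu> * e' \<le> e\<close>)
    finally show "(\<integral>\<^sup>+ y \<in> G. f y \<partial>lebesgue) \<le> ennreal \<mu> * emeasure lebesgue G + ennreal e"
      by (simp add: mult_left_mono)
  qed
  \<comment> \<open>Cancelling \<mu> |G| is legitimate because G lies in a cube of finite
    measure.\<close>
  have "(\<integral>\<^sup>+ y. (f y - ennreal \<mu>) * indicator G y \<partial>lebesgue) = 0"
  proof -
    have "(\<integral>\<^sup>+ y \<in> G. f y \<partial>lebesgue) = (\<integral>\<^sup>+ y. ennreal \<mu> * indicator G y + (f y - ennreal \<mu>) * indicator G y \<partial>lebesgue)"
      by (intro nn_integral_cong) (auto simp: indicator_def G_def add_diff_inverse_ennreal less_imp_le)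
    also have "\<dots> = ennreal \<mu> * emeasure lebesgue G + (\<integral>\<^sup>+ y. (f y - ennreal \<mu>) * indicator G y \<partial>lebesgue)"
      by (subst nn_integral_add) (auto simp: nn_integral_cmult_indicator)
    finally have "ennreal \<mu> * emeasure lebesgue G + (\<integral>\<^sup>+ y. (f y - ennreal \<mu>) * indicator G y \<partial>lebesgue) \<le> ennreal \<mu> * emeasure lebesgue G + 0"
      using int_le by simp
    then show ?thesis
      using Gfin by (subst (asm) ennreal_add_left_cancel_le) (auto simp: ennreal_mult_eq_top_iff)
  qed
  then have "AE y in lebesgue. (f y - ennreal \<mu>) * indicator G y = 0"
    by (subst (asm) nn_integral_0_iff_AE) auto
  then show ?thesis
  proof eventually_elim
    case (elim x)
    show ?case
    proof (intro impI)
      assume "x \<in> Q" and avg: "\<forall>k. dcube a l k x \<subseteq> Q \<longrightarrow> (\<integral>\<^sup>+ y \<in> dcube a l k x. f y \<partial>lebesgue) \<le> ennreal \<mu> * emeasure lebesgue (dcube a l k x)"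
      then have "x \<notin> E" by (auto simp: E_def P_def)
      show "f x \<le> ennreal \<mu>"
      proof (rule ccontr)
        assume "\<not> f x \<le> ennreal \<mu>"
        then have lt: "ennreal \<mu> < f x" by simp
        then have "x \<in> G" using \<open>x \<in> Q\<close> \<open>x \<notin> E\<close> by (simp add: G_def)
        then have "f x - ennreal \<mu> = 0" using elim by simp
        then show False using diff_gr0_ennreal[OF lt] by simp
      qed
    qed
  qed
qed

section \<open>A weighted John-Nirenberg inequality\<close>

definition set_avg :: "('a::euclidean_space \<Rightarrow> real) \<Rightarrow> 'a set \<Rightarrow> real" where
  "set_avg b D = (\<integral> y \<in> D. b y \<partial>lebesgue) / measure lebesgue D"

lemma ball_avg_eq_set_avg: "ball_avg b x r = set_avg b (ball x r)"
  by (simp add: ball_avg_def set_avg_def)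

lemma set_avg_deviation:
  assumes [measurable]: "D \<in> sets lebesgue" and D: "0 < emeasure lebesgue D" "emeasure lebesgue D < top"
    and b: "set_integrable lebesgue D b"
  shows "ennreal \<bar>set_avg b D - c\<bar> * emeasure lebesgue D \<le> (\<integral>\<^sup>+ y \<in> D. ennreal \<bar>b y - c\<bar> \<partial>lebesgue)"
proof -
  define d where "d = measure lebesgue D"
  have d1: "emeasure lebesgue D = ennreal d"
    using D unfolding d_def by (intro emeasure_eq_ennreal_measure) auto
  then have d: "emeasure lebesgue D = ennreal d" "0 < d"
    using D(1) by (auto simp: ennreal_less_zero_iff simp del: emeasure_completion)
  have ci: "set_integrable lebesgue D (\<lambda>_. c)"
    using D(2) by (simp add: set_integrable_def)
  have "(\<integral> y \<in> D. (b y - c) \<partial>lebesgue) = (\<integral> y \<in> D. b y \<partial>lebesgue) - c * d"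
    by (subst set_integral_diff(2)[OF b ci]) (simp add: set_lebesgue_integral_def d_def)
  also have "(\<integral> y \<in> D. b y \<partial>lebesgue) = set_avg b D * d"
    using d by (simp add: set_avg_def d_def)
  finally have eq: "(\<integral> y \<in> D. (b y - c) \<partial>lebesgue) = (set_avg b D - c) * d" by (simp add: algebra_simps)
  have "ennreal (norm (\<integral> y. indicator D y *\<^sub>R (b y - c) \<partial>lebesgue)) \<le> (\<integral>\<^sup>+ y. ennreal (norm (indicator D y *\<^sub>R (b y - c))) \<partial>lebesgue)"
    using set_integral_diff(1)[OF b ci] by (intro integral_norm_bound_ennreal) (simp add: set_integrable_def)
  also have "\<dots> = (\<integral>\<^sup>+ y \<in> D. ennreal \<bar>b y - c\<bar> \<partial>lebesgue)"
    by (intro nn_integral_cong) (auto simp: indicator_def)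
  finally have "ennreal \<bar>(set_avg b D - c) * d\<bar> \<le> (\<integral>\<^sup>+ y \<in> D. ennreal \<bar>b y - c\<bar> \<partial>lebesgue)"
    using eq by (simp add: set_lebesgue_integral_def)
  then show ?thesis using d by (simp add: abs_mult ennreal_mult)
qed

lemma set_avg_deviation_le:
  assumes [measurable]: "D \<in> sets lebesgue" and D: "0 < emeasure lebesgue D" "emeasure lebesgue D < top"
    and b: "set_integrable lebesgue D b" and t: "0 \<le> t"
    and le: "(\<integral>\<^sup>+ y \<in> D. ennreal \<bar>b y - c\<bar> \<partial>lebesgue) \<le> ennreal t * emeasure lebesgue D"
  shows "\<bar>set_avg b D - c\<bar> \<le> t"
proof -
  have "emeasure lebesgue D * ennreal \<bar>set_avg b D - c\<bar> \<le> emeasure lebesgue D * ennreal t"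
    using set_avg_deviation[OF assms(1-4), of c] le by (simp add: mult.commute)
  then have "ennreal \<bar>set_avg b D - c\<bar> \<le> ennreal t"
    using D by (subst (asm) ennreal_mult_le_mult_iff) auto
  then show ?thesis using t by (simp add: ennreal_le_iff)
qed

lemma bmo_ball:
  assumes "bmo_norm b \<le> ennreal \<beta>" "0 < r"
  shows "(\<integral>\<^sup>+ y \<in> ball x r. ennreal \<bar>b y - ball_avg b x r\<bar> \<partial>lebesgue) \<le> ennreal \<beta> * ball_meas x r"
proof -
  have "(\<integral>\<^sup>+ y \<in> ball (fst (x, r)) (snd (x, r)). ennreal \<bar>b y - ball_avg b (fst (x, r)) (snd (x, r))\<bar> \<partial>lebesgue)
        / ball_meas (fst (x, r)) (snd (x, r)) \<le> bmo_norm b"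
    unfolding bmo_norm_def using assms(2) by (intro SUP_upper) simp
  also note assms(1)
  finally show ?thesis
    using ball_meas_pos[OF assms(2), of x] ball_meas_finite[of x r]
    by (simp add: ennreal_divide_le_iff)
qed

text \<open>Volume of a ball of radius n times the side of a cube, divided by the volume of the
  cube. That ball, centred at any point of the cube, contains the cube.\<close>

definition cube_const :: "nat \<Rightarrow> real" where
  "cube_const n = unit_ball_vol (real n) * real n ^ n"

lemma cube_const_pos: "0 < n \<Longrightarrow> 0 < cube_const n"
  by (simp add: cube_const_def)

lemma ball_meas_dcube:
  fixes x :: "'a::euclidean_space"
  assumes l: "0 < l"
  shows "ball_meas x (real DIM('a) * (l / 2 ^ k)) = ennreal (cube_const DIM('a)) * emeasure lebesgue (dcube a l k x)"
  unfolding emeasure_dcube[OF l] using l cube_const_pos[of "DIM('a)"]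
  by (simp add: ball_meas_eq ennreal_mult[symmetric] cube_const_def power_mult_distrib power_divide mult.assoc)

lemma emeasure_dcube_pos: "0 < l \<Longrightarrow> 0 < emeasure lebesgue (dcube a l k x)"
  and emeasure_dcube_finite: "0 < l \<Longrightarrow> emeasure lebesgue (dcube a l k x) < top"
  by (simp_all add: emeasure_dcube del: emeasure_completion)

text \<open>The fraction of weighted measure of a cube that survives the removal of half of its
  Lebesgue measure: half a cube is the fraction 1/(2 \<kappa>) of the surrounding ball, and the
  power comes from \<open>wmeas_lower_bound\<close>. The cap 1/2 keeps 1 - c0 positive.\<close>

definition ainf_const :: "real \<Rightarrow> real \<Rightarrow> nat \<Rightarrow> real" where
  "ainf_const \<theta> K n = min ((1 / (2 * cube_const n * K)) powr (1 / \<theta>)) (1 / 2)"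

text \<open>The largest change of mean from a cube to one of its stopping cubes: the threshold 4
  \<kappa> holds on the dyadic parent, whose volume is 2^n times larger.\<close>

definition osc_const :: "nat \<Rightarrow> real" where
  "osc_const n = 2 ^ n * (4 * cube_const n)"

text \<open>Chosen so that exp(c L) = 1 + c0/2. Then one stopping step multiplies the remainder by
  (1 + c0/2)(1 - c0) <= 1 - c0/2, which is a contraction.\<close>

definition jn_const :: "real \<Rightarrow> real \<Rightarrow> nat \<Rightarrow> real" where
  "jn_const \<theta> K n = ln (1 + ainf_const \<theta> K n / 2) / osc_const n"

locale muckenhoupt_bmo = muckenhoupt \<theta> K w v
  for \<theta> K :: real and w v :: "'a::euclidean_space \<Rightarrow> real" +
  fixes b :: "'a \<Rightarrow> real"
  assumes b_meas [measurable]: "b \<in> borel_measurable lebesgue"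
    and b_int: "0 < r \<Longrightarrow> set_integrable lebesgue (ball x r) b"
    and b_bmo: "bmo_norm b \<le> 1"

text \<open>Only introduces short names. All four constants are functions of \<theta>, K and the
  dimension, which makes the resulting inequality uniform in w, v and b.\<close>

locale muckenhoupt_bmo_consts = muckenhoupt_bmo \<theta> K w v b
  for \<theta> K :: real and w v b :: "'a::euclidean_space \<Rightarrow> real" +
  fixes \<kappa> c0 L c :: real
  defines kappa_def: "\<kappa> \<equiv> cube_const DIM('a)" and c0_def: "c0 \<equiv> ainf_const \<theta> K DIM('a)"
    and L_def: "L \<equiv> osc_const DIM('a)" and c_def: "c \<equiv> jn_const \<theta> K DIM('a)"
begin

lemma kappa_pos: "0 < \<kappa>"
  unfolding kappa_def by (rule cube_const_pos) simp

lemma L_eq: "L = 2 ^ DIM('a) * (4 * \<kappa>)"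
  by (simp add: L_def osc_const_def kappa_def)

lemma c0_eq: "c0 = min ((1 / (2 * \<kappa> * K)) powr (1 / \<theta>)) (1 / 2)"
  by (simp add: c0_def ainf_const_def kappa_def)

lemma c_eq: "c = ln (1 + c0 / 2) / L"
  by (simp add: c_def jn_const_def c0_def L_def)

lemma L_pos: "0 < L"
  using kappa_pos by (simp add: L_eq)

lemma c0_pos: "0 < c0" and c0_le: "c0 \<le> 1 / 2"
  using kappa_pos K_pos by (auto simp: c0_eq)

lemma c_pos: "0 < c"
  using L_pos c0_pos by (simp add: c_eq)

lemma exp_cL: "exp (c * L) = 1 + c0 / 2"
  using L_pos c0_pos by (simp add: c_eq)

lemma b_int_dcube:
  assumes l: "0 < l" shows "set_integrable lebesgue (dcube a l k x) b"
  by (rule set_integrable_subset[OF b_int _ dcube_subset_ball[OF l]]) (use l in auto)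

text \<open>Passing to the ball around the cube costs the factor \<kappa>; replacing the mean over
  the ball by the mean over the cube doubles it.\<close>

lemma dcube_oscillation:
  assumes l: "0 < l"
  shows "(\<integral>\<^sup>+ y \<in> dcube a l k x. ennreal \<bar>b y - set_avg b (dcube a l k x)\<bar> \<partial>lebesgue)
     \<le> ennreal (2 * \<kappa>) * emeasure lebesgue (dcube a l k x)"
proof -
  define D where "D = dcube a l k x"
  define r where "r = real DIM('a) * (l / 2 ^ k)"
  have r: "0 < r" using l by (simp add: r_def)
  have [measurable]: "D \<in> sets lebesgue" by (simp add: D_def)
  have sub: "D \<subseteq> ball x r" using dcube_subset_ball[OF l] by (simp add: D_def r_def)
  define m where "m = ball_avg b x r"
  have osc: "(\<integral>\<^sup>+ y \<in> D. ennreal \<bar>b y - m\<bar> \<partial>lebesgue) \<le> ennreal \<kappa> * emeasure lebesgue D"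
  proof -
    have "(\<integral>\<^sup>+ y \<in> D. ennreal \<bar>b y - m\<bar> \<partial>lebesgue) \<le> (\<integral>\<^sup>+ y \<in> ball x r. ennreal \<bar>b y - m\<bar> \<partial>lebesgue)"
      using sub by (intro nn_integral_mono) (auto simp: indicator_def)
    also have "\<dots> \<le> ball_meas x r"
      using bmo_ball[of b 1 r x] b_bmo r by (simp add: m_def)
    also have "\<dots> = ennreal \<kappa> * emeasure lebesgue D"
      unfolding r_def D_def kappa_def by (rule ball_meas_dcube[OF l])
    finally show ?thesis .
  qed
  have "(\<integral>\<^sup>+ y \<in> D. ennreal \<bar>b y - set_avg b D\<bar> \<partial>lebesgue)
      \<le> (\<integral>\<^sup>+ y. ennreal \<bar>b y - m\<bar> * indicator D y + ennreal \<bar>set_avg b D - m\<bar> * indicator D y \<partial>lebesgue)"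
    by (intro nn_integral_mono) (auto simp: indicator_def ennreal_plus[symmetric] intro!: ennreal_leI simp del: ennreal_plus)
  also have "\<dots> = (\<integral>\<^sup>+ y \<in> D. ennreal \<bar>b y - m\<bar> \<partial>lebesgue) + ennreal \<bar>set_avg b D - m\<bar> * emeasure lebesgue D"
    by (subst nn_integral_add) (auto simp: nn_integral_cmult_indicator)
  also have "\<dots> \<le> ennreal \<kappa> * emeasure lebesgue D + ennreal \<kappa> * emeasure lebesgue D"
    using set_avg_deviation[of D b m] osc emeasure_dcube_pos[OF l, of a k x] emeasure_dcube_finite[OF l, of a k x] b_int_dcube[OF l, of a k x]
    by (intro add_mono) (auto simp: D_def)
  also have "\<dots> = ennreal (2 * \<kappa>) * emeasure lebesgue D"
    using kappa_pos by (simp add: distrib_right[symmetric] ennreal_plus[symmetric] del: ennreal_plus)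
  finally show ?thesis by (simp add: D_def)
qed

lemma wmeas_dcube_finite: assumes l: "0 < l" shows "wmeas w (dcube a l k x) < top"
  using wmeas_mono[OF dcube_subset_ball[OF l]] wmeas_ball_finite by (rule le_less_trans)

lemma wmeas_dcube_pos: assumes l: "0 < l" shows "0 < wmeas w (dcube a l k x)"
  using lebesgue_le_product[OF sets_dcube, of a l k x] emeasure_dcube_pos[OF l, of a k x]
  by (auto simp: zero_less_iff_neq_zero)

text \<open>The lower bound is applied to the complement of E in the cube, which has at least half
  of the Lebesgue measure; subtraction then gives the upper bound for E.\<close>

lemma wmeas_half:
  assumes l: "0 < l" and [measurable]: "E \<in> sets lebesgue" and E: "E \<subseteq> dcube a l k x"
    and half: "2 * emeasure lebesgue E \<le> emeasure lebesgue (dcube a l k x)"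
  shows "wmeas w E \<le> ennreal (1 - c0) * wmeas w (dcube a l k x)"
proof -
  define Q where "Q = dcube a l k x"
  have [measurable]: "Q \<in> sets lebesgue" by (simp add: Q_def)
  define r where "r = real DIM('a) * (l / 2 ^ k)"
  have r: "0 < r" using l by (simp add: r_def)
  have sub: "Q \<subseteq> ball x r" using dcube_subset_ball[OF l] by (simp add: Q_def r_def)
  obtain d where d: "emeasure lebesgue Q = ennreal d" "0 < d"
    using emeasure_dcube[OF l, of a k x] l by (auto simp: Q_def)
  have "emeasure lebesgue E \<le> emeasure lebesgue Q" using E by (intro emeasure_mono) (auto simp: Q_def)
  then obtain e where e: "emeasure lebesgue E = ennreal e" "0 \<le> e"
    using d by (cases "emeasure lebesgue E") (auto simp: top_unique)
  have "2 * e \<le> d" 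
    using half d e unfolding Q_def[symmetric] by (simp add: ennreal_mult[symmetric] flip: ennreal_numeral)
  have F: "emeasure lebesgue (Q - E) = ennreal (d - e)"
    using E d e by (subst emeasure_Diff) (auto simp: Q_def[symmetric] ennreal_minus)
  have "ennreal c0 * wmeas w Q \<le> ennreal ((1 / (2 * \<kappa>) / K) powr (1 / \<theta>)) * wmeas w (ball x r)"
    by (intro mult_mono wmeas_mono sub ennreal_leI) (auto simp: c0_eq mult.assoc)
  also have "\<dots> \<le> wmeas w (Q - E)"
  proof (rule wmeas_lower_bound)
    have "ennreal (1 / (2 * \<kappa>)) * ball_meas x r = ennreal (1 / (2 * \<kappa>)) * (ennreal \<kappa> * ennreal d)"
      using ball_meas_dcube[OF l, of x k a] d by (simp add: r_def Q_def kappa_def)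
    also have "\<dots> = ennreal (d / 2)"
      using kappa_pos d by (simp add: ennreal_mult[symmetric])
    also have "\<dots> \<le> ennreal (d - e)" using \<open>2 * e \<le> d\<close> by (intro ennreal_leI) simp
    finally show "ennreal (1 / (2 * \<kappa>)) * ball_meas x r \<le> emeasure lebesgue (Q - E)" by (simp add: F)
  qed (use sub r kappa_pos in auto)
  finally have le: "ennreal c0 * wmeas w Q \<le> wmeas w (Q - E)" .
  have add: "wmeas w Q = wmeas w (Q - E) + wmeas w E"
    using E unfolding wmeas_def
    by (subst nn_integral_add[symmetric]) (auto intro!: nn_integral_cong simp: indicator_def Q_def)
  obtain W where W: "wmeas w Q = ennreal W" "0 \<le> W"
    using wmeas_dcube_finite[OF l, of a k x] by (cases "wmeas w Q") (auto simp: Q_def)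
  obtain WE where WE: "wmeas w E = ennreal WE" "0 \<le> WE"
    using wmeas_mono[OF E, of w] W by (cases "wmeas w E") (auto simp: Q_def top_unique)
  obtain WF where WF: "wmeas w (Q - E) = ennreal WF" "0 \<le> WF"
    using add W by (cases "wmeas w (Q - E)") auto
  have "W = WF + WE" using add W WE WF by (simp add: ennreal_plus[symmetric] del: ennreal_plus)
  moreover have "c0 * W \<le> WF" using le W WF c0_pos by (simp add: ennreal_mult[symmetric])
  ultimately have "WE \<le> (1 - c0) * W" by (simp add: algebra_simps)
  then show ?thesis
    using W WE c0_le by (simp add: Q_def[symmetric] ennreal_mult[symmetric] ennreal_leI)
qed

text \<open>Truncation at N makes the ratio to w(D) at most exp(c N) for every cube. The supremum of
  these ratios is thus finite before any work is done, as the absorption argument requires.\<close>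

definition expint :: "real \<Rightarrow> 'a set \<Rightarrow> ennreal" where
  "expint N D = (\<integral>\<^sup>+ y \<in> D. ennreal (exp (c * min \<bar>b y - set_avg b D\<bar> N)) * ennreal (w y) \<partial>lebesgue)"

text \<open>Outside the stopped set E the oscillation is at most L almost everywhere, which
  contributes exp(c L) w(Q). On a stopping cube D it is at most L plus the oscillation about the
  mean over D, so the hypothesis on D applies with one more factor exp(c L), and the measures w(D)
  add up to w(E) <= (1 - c0) w(Q).\<close>

lemma expint_step:
  assumes l: "0 < l" and N: "0 \<le> N" and X: "0 \<le> X"
    and hyp: "\<And>k x. expint N (dcube a l k x) \<le> ennreal X * wmeas w (dcube a l k x)"
  shows "expint N (dcube a l k0 x0) \<le> ennreal ((1 + c0 / 2) * (1 + (1 - c0) * X)) * wmeas w (dcube a l k0 x0)"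
proof -
  define Q where "Q = dcube a l k0 x0"
  have [measurable]: "Q \<in> sets lebesgue" by (simp add: Q_def)
  define f where "f y = \<bar>b y - set_avg b Q\<bar>" for y
  have [measurable]: "f \<in> borel_measurable lebesgue" unfolding f_def by measurable
  \<comment> \<open>Twice the bound 2 \<kappa> for the mean oscillation on Q: the stopping cubes
    fill at most half of Q, and Q itself does not stop.\<close>
  define \<mu> where "\<mu> = 4 * \<kappa>"
  have mu: "0 < \<mu>" using kappa_pos by (simp add: \<mu>_def)
  define P where "P D \<longleftrightarrow> D \<subseteq> Q \<and> \<not> (\<integral>\<^sup>+ y \<in> D. ennreal (f y) \<partial>lebesgue) \<le> ennreal \<mu> * emeasure lebesgue D" for D
  define S where "S = stopping_cubes a l P"
  define E where "E = \<Union>S"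
  have S: "countable S" "disjoint S" "\<And>D. D \<in> S \<Longrightarrow> D \<in> sets lebesgue"
    unfolding S_def by (auto intro: countable_stopping_cubes disjoint_stopping_cubes stopping_cubes_sets)
  have [measurable]: "E \<in> sets lebesgue" unfolding E_def using S by (intro sets.countable_Union) auto
  have EQ: "E \<subseteq> Q" unfolding E_def S_def using stopping_cubes_P by (fastforce simp: P_def)
  have Qosc: "(\<integral>\<^sup>+ y \<in> Q. ennreal (f y) \<partial>lebesgue) \<le> ennreal (2 * \<kappa>) * emeasure lebesgue Q"
    unfolding f_def Q_def by (rule dcube_oscillation[OF l])
  have half: "2 * emeasure lebesgue E \<le> emeasure lebesgue Q"
  proof -
    have "ennreal \<mu> * emeasure lebesgue E = ennreal \<mu> * (\<integral>\<^sup>+ y \<in> E. 1 \<partial>lebesgue)" by simp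
    also have "(\<integral>\<^sup>+ y \<in> E. 1 \<partial>lebesgue) = (\<integral>\<^sup>+ D. (\<integral>\<^sup>+ y \<in> D. 1 \<partial>lebesgue) \<partial>count_space S)"
      unfolding E_def by (intro nn_integral_Union_disjoint S) auto
    also have "ennreal \<mu> * \<dots> = (\<integral>\<^sup>+ D. ennreal \<mu> * (\<integral>\<^sup>+ y \<in> D. 1 \<partial>lebesgue) \<partial>count_space S)"
      by (subst nn_integral_cmult) auto
    also have "\<dots> \<le> (\<integral>\<^sup>+ D. (\<integral>\<^sup>+ y \<in> D. ennreal (f y) \<partial>lebesgue) \<partial>count_space S)"
    proof (rule nn_integral_mono)
      fix D assume "D \<in> space (count_space S)"
      then have "P D" "D \<in> sets lebesgue" using S(3) by (auto simp: S_def stopping_cubes_P)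
      then show "ennreal \<mu> * (\<integral>\<^sup>+ y \<in> D. 1 \<partial>lebesgue) \<le> (\<integral>\<^sup>+ y \<in> D. ennreal (f y) \<partial>lebesgue)"
        by (auto simp: P_def simp del: emeasure_completion)
    qed
    also have "\<dots> = (\<integral>\<^sup>+ y \<in> E. ennreal (f y) \<partial>lebesgue)"
      unfolding E_def by (intro nn_integral_Union_disjoint[symmetric] S) auto
    also have "\<dots> \<le> (\<integral>\<^sup>+ y \<in> Q. ennreal (f y) \<partial>lebesgue)"
      using EQ by (intro nn_integral_mono) (auto simp: indicator_def)
    also note Qosc
    finally have "ennreal (2 * \<kappa>) * (2 * emeasure lebesgue E) \<le> ennreal (2 * \<kappa>) * emeasure lebesgue Q"
      using kappa_pos by (simp add: \<mu>_def mult.assoc[symmetric] ennreal_mult[symmetric] flip: ennreal_numeral)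
    then show ?thesis using kappa_pos by (subst (asm) ennreal_mult_le_mult_iff) (auto simp: ennreal_eq_0_iff not_le)
  qed
  have wE: "wmeas w E \<le> ennreal (1 - c0) * wmeas w Q"
    unfolding Q_def by (rule wmeas_half[OF l]) (use EQ half in \<open>auto simp: Q_def\<close>)
  have stop_avg: "\<bar>set_avg b D - set_avg b Q\<bar> \<le> L" and stop_cube: "\<exists>k x. D = dcube a l k x" if D: "D \<in> S" for D
  proof -
    obtain k x where k: "D = dcube a l k x" "P D" "\<And>j. j < k \<Longrightarrow> \<not> P (dcube a l j x)"
      using D by (auto simp: S_def stopping_cubes_def)
    show "\<exists>k x. D = dcube a l k x" using k by auto
    have xQ: "x \<in> Q" using k by (auto simp: P_def)
    then have Qx: "Q = dcube a l k0 x" by (simp add: Q_def dcube_eq)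
    have "\<not> P Q"
    proof -
      have "ennreal (2 * \<kappa>) * emeasure lebesgue Q \<le> ennreal \<mu> * emeasure lebesgue Q"
        using kappa_pos by (intro mult_right_mono ennreal_leI) (auto simp: \<mu>_def)
      then show ?thesis using Qosc by (auto simp: P_def)
    qed
    \<comment> \<open>A stopping cube is strictly smaller than Q, so its parent still lies in Q and,
      by minimality of the generation, satisfies the average bound.\<close>
    have "k0 < k"
    proof (rule ccontr)
      assume "\<not> k0 < k"
      then have "Q \<subseteq> D" unfolding Qx k(1) by (intro dcube_mono) simp
      then show False using k(2) \<open>\<not> P Q\<close> by (auto simp: P_def)
    qed
    then obtain j where j: "k = Suc j" "k0 \<le> j" by (cases k) auto
    define D' where "D' = dcube a l j x"
    have "D' \<subseteq> Q" unfolding D'_def Qx by (rule dcube_mono[OF j(2)])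
    then have avg': "(\<integral>\<^sup>+ y \<in> D'. ennreal (f y) \<partial>lebesgue) \<le> ennreal \<mu> * emeasure lebesgue D'"
      using k(3)[of j] j(1) by (auto simp: P_def D'_def)
    have "D \<subseteq> D'" unfolding k(1) D'_def j(1) by (rule dcube_Suc_subset)
    then have "(\<integral>\<^sup>+ y \<in> D. ennreal (f y) \<partial>lebesgue) \<le> (\<integral>\<^sup>+ y \<in> D'. ennreal (f y) \<partial>lebesgue)"
      by (intro nn_integral_mono) (auto simp: indicator_def)
    also note avg'
    \<comment> \<open>Here the parent's volume, 2^n times that of D, turns the threshold \<mu> into
      L.\<close>
    also have "ennreal \<mu> * emeasure lebesgue D' = ennreal L * emeasure lebesgue D"
      using l mu unfolding D'_def k(1) j(1) emeasure_dcube[OF l]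
      by (simp add: ennreal_mult[symmetric] L_eq \<mu>_def[symmetric] power_divide power_mult_distrib)
    finally show "\<bar>set_avg b D - set_avg b Q\<bar> \<le> L"
      unfolding f_def using L_pos S(3)[OF D] emeasure_dcube_pos[OF l] emeasure_dcube_finite[OF l] b_int_dcube[OF l]
      by (intro set_avg_deviation_le) (auto simp: k(1))
  qed
  have off: "AE y in lebesgue. y \<in> Q - E \<longrightarrow> f y \<le> L"
  proof -
    have "\<mu> \<le> L"
      using mu by (simp add: L_eq \<mu>_def[symmetric])
    have "AE x in lebesgue. x \<in> Q \<longrightarrow>
     (\<forall>k. dcube a l k x \<subseteq> Q \<longrightarrow> (\<integral>\<^sup>+ y \<in> dcube a l k x. ennreal (f y) \<partial>lebesgue) \<le> ennreal \<mu> * emeasure lebesgue (dcube a l k x))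
     \<longrightarrow> ennreal (f x) \<le> ennreal \<mu>"
      unfolding Q_def using mu by (intro AE_le_of_dyadic_averages_le[OF l]) auto
    then show ?thesis
    proof eventually_elim
      case (elim y)
      show ?case
      proof
        assume y: "y \<in> Q - E"
        then have "\<not> P (dcube a l k y)" for k
          unfolding E_def S_def Union_stopping_cubes by auto
        then have "ennreal (f y) \<le> ennreal \<mu>" using elim y by (auto simp: P_def)
        then show "f y \<le> L" using mu \<open>\<mu> \<le> L\<close> by (simp add: ennreal_le_iff)
      qed
    qed
  qed
  define F where "F y = ennreal (exp (c * min (f y) N)) * ennreal (w y)" for y
  have [measurable]: "F \<in> borel_measurable lebesgue" unfolding F_def by measurable
  have "expint N Q = (\<integral>\<^sup>+ y. F y * indicator (Q - E) y + F y * indicator E y \<partial>lebesgue)"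
    unfolding expint_def F_def f_def using EQ by (intro nn_integral_cong) (auto simp: indicator_def)
  also have "\<dots> = (\<integral>\<^sup>+ y \<in> Q - E. F y \<partial>lebesgue) + (\<integral>\<^sup>+ y \<in> E. F y \<partial>lebesgue)"
    by (subst nn_integral_add) auto
  also have "(\<integral>\<^sup>+ y \<in> Q - E. F y \<partial>lebesgue) \<le> (\<integral>\<^sup>+ y. ennreal (exp (c * L)) * (ennreal (w y) * indicator Q y) \<partial>lebesgue)"
  proof (rule nn_integral_mono_AE)
    show "AE y in lebesgue. F y * indicator (Q - E) y \<le> ennreal (exp (c * L)) * (ennreal (w y) * indicator Q y)"
      using off
    proof eventually_elim
      case (elim y)
      then show ?case
        using c_pos unfolding F_def
        by (auto simp: indicator_def intro!: mult_right_mono ennreal_leI)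
    qed
  qed
  also have "\<dots> = ennreal (exp (c * L)) * wmeas w Q"
    unfolding wmeas_def by (intro nn_integral_cmult) measurable
  also have "(\<integral>\<^sup>+ y \<in> E. F y \<partial>lebesgue) = (\<integral>\<^sup>+ D. (\<integral>\<^sup>+ y \<in> D. F y \<partial>lebesgue) \<partial>count_space S)"
    unfolding E_def by (intro nn_integral_Union_disjoint S) auto
  also have "\<dots> \<le> (\<integral>\<^sup>+ D. ennreal (exp (c * L) * X) * wmeas w D \<partial>count_space S)"
  proof (rule nn_integral_mono)
    fix D assume "D \<in> space (count_space S)"
    then have D: "D \<in> S" by simp
    note [measurable] = S(3)[OF D]
    obtain k x where k: "D = dcube a l k x" using stop_cube[OF D] by auto
    have "(\<integral>\<^sup>+ y \<in> D. F y \<partial>lebesgue)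
       \<le> (\<integral>\<^sup>+ y. ennreal (exp (c * L)) * (ennreal (exp (c * min \<bar>b y - set_avg b D\<bar> N)) * ennreal (w y) * indicator D y) \<partial>lebesgue)"
    proof (rule nn_integral_mono)
      fix y
      have "f y \<le> L + \<bar>b y - set_avg b D\<bar>" using stop_avg[OF D] unfolding f_def by linarith
      then have "min (f y) N \<le> L + min \<bar>b y - set_avg b D\<bar> N" using L_pos by linarith
      then have "exp (c * min (f y) N) \<le> exp (c * L + c * min \<bar>b y - set_avg b D\<bar> N)"
        using c_pos by (simp add: distrib_left[symmetric])
      then have "ennreal (exp (c * min (f y) N)) \<le> ennreal (exp (c * L)) * ennreal (exp (c * min \<bar>b y - set_avg b D\<bar> N))"
        by (simp add: exp_add ennreal_mult[symmetric] ennreal_leI)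
      then have "ennreal (exp (c * min (f y) N)) * (ennreal (w y) * indicator D y) \<le> ennreal (exp (c * L)) * ennreal (exp (c * min \<bar>b y - set_avg b D\<bar> N)) * (ennreal (w y) * indicator D y)"
        by (rule mult_right_mono) simp
      then show "F y * indicator D y \<le> ennreal (exp (c * L)) * (ennreal (exp (c * min \<bar>b y - set_avg b D\<bar> N)) * ennreal (w y) * indicator D y)"
        by (simp add: F_def mult.assoc)
    qed
    also have "\<dots> = ennreal (exp (c * L)) * expint N D"
      unfolding expint_def by (intro nn_integral_cmult) measurable
    also have "\<dots> \<le> ennreal (exp (c * L)) * (ennreal X * wmeas w D)"
      unfolding k by (intro mult_left_mono hyp) simp
    finally show "(\<integral>\<^sup>+ y \<in> D. F y \<partial>lebesgue) \<le> ennreal (exp (c * L) * X) * wmeas w D"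
      using X by (simp add: ennreal_mult mult.assoc)
  qed
  also have "\<dots> = ennreal (exp (c * L) * X) * (\<integral>\<^sup>+ D. wmeas w D \<partial>count_space S)"
    by (intro nn_integral_cmult) simp
  also have "(\<integral>\<^sup>+ D. wmeas w D \<partial>count_space S) = wmeas w E"
    unfolding E_def wmeas_def by (intro nn_integral_Union_disjoint[symmetric] S) auto
  also note wE
  finally have "expint N Q \<le> ennreal (exp (c * L)) * wmeas w Q + ennreal (exp (c * L) * X) * (ennreal (1 - c0) * wmeas w Q)"
    by (simp add: add_mono mult_left_mono)
  also have "\<dots> = ennreal (exp (c * L) * (1 + (1 - c0) * X)) * wmeas w Q"
  proof -
    have "ennreal (exp (c * L) * (1 + (1 - c0) * X)) = ennreal (exp (c * L)) + ennreal (exp (c * L) * X) * ennreal (1 - c0)"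
    proof -
      have nn: "0 \<le> exp (c * L) * X" "0 \<le> 1 - c0" using X c0_le by auto
      have "exp (c * L) * (1 + (1 - c0) * X) = exp (c * L) + exp (c * L) * X * (1 - c0)" by (simp add: algebra_simps)
      also have "ennreal \<dots> = ennreal (exp (c * L)) + ennreal (exp (c * L) * X * (1 - c0))"
        using nn by (intro ennreal_plus) auto
      also have "ennreal (exp (c * L) * X * (1 - c0)) = ennreal (exp (c * L) * X) * ennreal (1 - c0)"
        by (rule ennreal_mult[OF nn])
      finally show ?thesis .
    qed
    then show ?thesis by (simp add: distrib_right mult.assoc)
  qed
  finally show ?thesis by (simp add: exp_cL Q_def)
qed

text \<open>With X the supremum over all cubes of the grid, the stopping step yields X <= 2 + (1 -
  c0/2) X, and finiteness of X allows this to be solved: X <= 4/c0. The bound no longer depends on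
  N.\<close>

lemma expint_bound:
  assumes l: "0 < l" and N: "0 \<le> N"
  shows "expint N (dcube a l k x) \<le> ennreal (4 / c0) * wmeas w (dcube a l k x)"
proof -
  define Y where "Y = (SUP kx. expint N (dcube a l (fst kx) (snd kx)) / wmeas w (dcube a l (fst kx) (snd kx)))"
  have div: "expint N (dcube a l k x) / wmeas w (dcube a l k x) \<le> Z \<longleftrightarrow> expint N (dcube a l k x) \<le> Z * wmeas w (dcube a l k x)" for k x Z
    using wmeas_dcube_pos[OF l, of a k x] wmeas_dcube_finite[OF l, of a k x] by (intro ennreal_divide_le_iff) auto
  have "Y \<le> ennreal (exp (c * N))"
    unfolding Y_def
  proof (rule SUP_least, unfold div)
    fix kx :: "nat \<times> 'a"
    have "expint N (dcube a l (fst kx) (snd kx)) \<le> (\<integral>\<^sup>+ y. ennreal (exp (c * N)) * (ennreal (w y) * indicator (dcube a l (fst kx) (snd kx)) y) \<partial>lebesgue)"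
      unfolding expint_def using c_pos
      by (intro nn_integral_mono) (auto simp: indicator_def intro!: mult_right_mono ennreal_leI)
    also have "\<dots> = ennreal (exp (c * N)) * wmeas w (dcube a l (fst kx) (snd kx))"
      unfolding wmeas_def by (intro nn_integral_cmult) measurable
    finally show "expint N (dcube a l (fst kx) (snd kx)) \<le> ennreal (exp (c * N)) * wmeas w (dcube a l (fst kx) (snd kx))" .
  qed
  then obtain X where X: "Y = ennreal X" "0 \<le> X" by (cases Y) (auto simp: top_unique)
  have hyp: "expint N (dcube a l k x) \<le> ennreal X * wmeas w (dcube a l k x)" for k x
    using SUP_upper[of "(k, x)" UNIV "\<lambda>kx. expint N (dcube a l (fst kx) (snd kx)) / wmeas w (dcube a l (fst kx) (snd kx))"]
    by (simp add: Y_def[symmetric] X(1)[symmetric] div)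
  have "Y \<le> ennreal ((1 + c0 / 2) * (1 + (1 - c0) * X))"
    unfolding Y_def by (rule SUP_least, unfold div) (rule expint_step[OF l N X(2) hyp])
  then have "X \<le> (1 + c0 / 2) * (1 + (1 - c0) * X)"
    using X c0_pos c0_le by (simp add: ennreal_le_iff)
  also have "\<dots> \<le> 2 + (1 - c0 / 2) * X"
  proof -
    have "(1 + c0 / 2) * (1 - c0) \<le> 1 - c0 / 2" using c0_pos by (simp add: algebra_simps)
    then have "(1 + c0 / 2) * (1 - c0) * X \<le> (1 - c0 / 2) * X" using X(2) by (rule mult_right_mono)
    then show ?thesis using c0_le by (simp add: algebra_simps)
  qed
  finally have "X \<le> 4 / c0" using c0_pos by (simp add: field_simps)
  then have "ennreal X * wmeas w (dcube a l k x) \<le> ennreal (4 / c0) * wmeas w (dcube a l k x)"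
    by (intro mult_right_mono ennreal_leI) auto
  with hyp[of k x] show ?thesis by (rule order_trans)
qed

lemma John_Nirenberg_dcube:
  assumes l: "0 < l"
  shows "(\<integral>\<^sup>+ y \<in> dcube a l k x. ennreal (exp (c * \<bar>b y - set_avg b (dcube a l k x)\<bar>)) * ennreal (w y) \<partial>lebesgue)
     \<le> ennreal (4 / c0) * wmeas w (dcube a l k x)"
proof -
  define D where "D = dcube a l k x"
  have [measurable]: "D \<in> sets lebesgue" by (simp add: D_def)
  define f where "f y = \<bar>b y - set_avg b D\<bar>" for y
  define F where "F n y = ennreal (exp (c * min (f y) (real n))) * ennreal (w y) * indicator D y" for n y
  have [measurable]: "f \<in> borel_measurable lebesgue" unfolding f_def by measurable
  have [measurable]: "F n \<in> borel_measurable lebesgue" for n unfolding F_def by measurable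
  have "incseq F"
    unfolding F_def using c_pos
    by (intro monoI le_funI mult_right_mono ennreal_leI) (auto simp: min_def)
  have ptw: "ennreal (exp (c * f y)) * ennreal (w y) * indicator D y \<le> (SUP n. F n y)" for y
  proof -
    obtain n where "f y \<le> real n" using real_arch_simple by blast
    then have "ennreal (exp (c * f y)) * ennreal (w y) * indicator D y = F n y" by (simp add: F_def min_def)
    then show ?thesis using SUP_upper[of n UNIV "\<lambda>n. F n y"] by simp
  qed
  have "(\<integral>\<^sup>+ y. ennreal (exp (c * f y)) * ennreal (w y) * indicator D y \<partial>lebesgue) \<le> (\<integral>\<^sup>+ y. (SUP n. F n y) \<partial>lebesgue)"
    by (intro nn_integral_mono ptw)
  also have "\<dots> = (SUP n. \<integral>\<^sup>+ y. F n y \<partial>lebesgue)"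
    by (intro nn_integral_monotone_convergence_SUP \<open>incseq F\<close>) measurable
  also have "\<dots> \<le> ennreal (4 / c0) * wmeas w D"
  proof (rule SUP_least)
    fix n
    show "(\<integral>\<^sup>+ y. F n y \<partial>lebesgue) \<le> ennreal (4 / c0) * wmeas w D"
      using expint_bound[OF l, of "real n" a k x] by (simp add: expint_def F_def f_def D_def)
  qed
  finally show ?thesis by (simp add: f_def D_def)
qed

end

theorem weighted_John_Nirenberg:
  fixes \<theta> K :: real
  shows "\<exists>c>0. \<exists>C>0. \<forall>(w :: 'a::euclidean_space \<Rightarrow> real) v b. muckenhoupt_bmo \<theta> K w v b \<longrightarrow>
     (\<forall>x. \<forall>r>0. (\<integral>\<^sup>+ y \<in> ball x r. ennreal (exp (c * \<bar>b y - ball_avg b x r\<bar>)) * ennreal (w y) \<partial>lebesgue)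
        \<le> ennreal C * wmeas w (ball x r))"
\<comment> \<open>Positivity of the constants is read off from one instance of the locale; without
  any instance the claim is vacuous and arbitrary constants serve.\<close>
proof (cases "\<exists>(w :: 'a \<Rightarrow> real) v b. muckenhoupt_bmo \<theta> K w v b")
  case False
  then show ?thesis by (intro exI[of _ "1::real"] conjI) auto
next
  case True
  then obtain w0 v0 :: "'a \<Rightarrow> real" and b0 where "muckenhoupt_bmo \<theta> K w0 v0 b0" by auto
  then interpret B0: muckenhoupt_bmo_consts \<theta> K w0 v0 b0 "cube_const DIM('a)" "ainf_const \<theta> K DIM('a)" "osc_const DIM('a)" "jn_const \<theta> K DIM('a)"
    unfolding muckenhoupt_bmo_consts_def by auto
  define n where "n = DIM('a)"
  define c where "c = jn_const \<theta> K n"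
  \<comment> \<open>Bound for the difference of the means over a ball of radius r and the cube of
    side 2r around it: the oscillation constant 2 \<kappa> times the ratio of their volumes.\<close>
  define L2 where "L2 = 2 * cube_const n * 2 ^ n / unit_ball_vol (real n)"
  define C where "C = exp (c * L2) * (4 / ainf_const \<theta> K n * (K * (real n * 2) ^ n) powr (1 / \<theta>))"
  have c_jn: "c = jn_const \<theta> K DIM('a)" by (simp add: c_def n_def)
  have L2: "0 \<le> L2" using B0.kappa_pos by (simp add: L2_def n_def)
  have c: "0 < c" using B0.c_pos by (simp add: c_def n_def)
  have C: "0 < C" using B0.c0_pos B0.K_pos by (simp add: C_def n_def)
  have "(\<integral>\<^sup>+ y \<in> ball x r. ennreal (exp (c * \<bar>b y - ball_avg b x r\<bar>)) * ennreal (w y) \<partial>lebesgue) \<le> ennreal C * wmeas w (ball x r)"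
    if mb: "muckenhoupt_bmo \<theta> K w v b" and r: "0 < r" for w v b and x :: 'a and r
  proof -
    interpret muckenhoupt_bmo_consts \<theta> K w v b "cube_const DIM('a)" "ainf_const \<theta> K DIM('a)" "osc_const DIM('a)" "jn_const \<theta> K DIM('a)"
      using mb unfolding muckenhoupt_bmo_consts_def by auto
    \<comment> \<open>The grid is placed so that its generation 0 cube of side 2r is centred at x
      and thus contains the ball.\<close>
    define a where "a = x - r *\<^sub>R One"
    define Q where "Q = dcube a (2 * r) 0 x"
    have l: "0 < 2 * r" using r by simp
    have [measurable]: "Q \<in> sets lebesgue" by (simp add: Q_def)
    have BQ: "ball x r \<subseteq> Q"
    proof
      fix y assume y: "y \<in> ball x r"
      show "y \<in> Q" unfolding Q_def dcube_def
      proof safe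
        fix i :: 'a assume i: "i \<in> Basis"
        have "\<bar>(y - x) \<bullet> i\<bar> \<le> norm (y - x)" using i by (rule Basis_le_norm)
        also have "\<dots> < r" using y by (simp add: dist_norm norm_minus_commute)
        finally have "\<bar>(y - x) \<bullet> i\<bar> < r" .
        moreover have "(y - a) \<bullet> i = (y - x) \<bullet> i + r" "(x - a) \<bullet> i = r"
          using i by (simp_all add: a_def inner_diff_left inner_add_left)
        ultimately have "\<lfloor>2 ^ 0 * ((y - a) \<bullet> i) / (2 * r)\<rfloor> = 0" "\<lfloor>2 ^ 0 * ((x - a) \<bullet> i) / (2 * r)\<rfloor> = 0"
          using r by (auto simp: floor_eq_iff field_simps)
        then show "\<lfloor>2 ^ 0 * ((y - a) \<bullet> i) / (2 * r)\<rfloor> = \<lfloor>2 ^ 0 * ((x - a) \<bullet> i) / (2 * r)\<rfloor>" by simp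
      qed
    qed
    have QB: "Q \<subseteq> ball x (real n * 2 * r)"
      using dcube_subset_ball[OF l, of a 0 x] by (simp add: Q_def n_def mult.assoc)
    have dev: "\<bar>ball_avg b x r - set_avg b Q\<bar> \<le> L2"
      unfolding ball_avg_eq_set_avg
    proof (rule set_avg_deviation_le)
      have "(\<integral>\<^sup>+ y \<in> ball x r. ennreal \<bar>b y - set_avg b Q\<bar> \<partial>lebesgue) \<le> (\<integral>\<^sup>+ y \<in> Q. ennreal \<bar>b y - set_avg b Q\<bar> \<partial>lebesgue)"
        using BQ by (intro nn_integral_mono) (auto simp: indicator_def)
      also have "\<dots> \<le> ennreal (2 * cube_const DIM('a)) * emeasure lebesgue Q"
        unfolding Q_def by (rule dcube_oscillation[OF l])
      also have "\<dots> = ennreal L2 * emeasure lebesgue (ball x r)"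
        using r kappa_pos L2 less_imp_neq[OF unit_ball_vol_pos[of "real DIM('a)"], symmetric] unfolding Q_def emeasure_dcube[OF l] ball_meas_def[symmetric] ball_meas_eq[OF less_imp_le[OF r]]
        by (simp add: ennreal_mult[symmetric] L2_def n_def power_mult_distrib)
      finally show "(\<integral>\<^sup>+ y \<in> ball x r. ennreal \<bar>b y - set_avg b Q\<bar> \<partial>lebesgue) \<le> ennreal L2 * emeasure lebesgue (ball x r)" .
    qed (use r L2 b_int ball_meas_pos[OF r, of x] ball_meas_finite[of x r] in \<open>auto simp: ball_meas_def\<close>)
    have "(\<integral>\<^sup>+ y \<in> ball x r. ennreal (exp (c * \<bar>b y - ball_avg b x r\<bar>)) * ennreal (w y) \<partial>lebesgue)
       \<le> (\<integral>\<^sup>+ y. ennreal (exp (c * L2)) * (ennreal (exp (c * \<bar>b y - set_avg b Q\<bar>)) * ennreal (w y) * indicator Q y) \<partial>lebesgue)"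
    proof (rule nn_integral_mono)
      fix y
      have "\<bar>b y - ball_avg b x r\<bar> \<le> L2 + \<bar>b y - set_avg b Q\<bar>" using dev by linarith
      then have "exp (c * \<bar>b y - ball_avg b x r\<bar>) \<le> exp (c * L2 + c * \<bar>b y - set_avg b Q\<bar>)"
        using c by (simp add: distrib_left[symmetric])
      then have "ennreal (exp (c * \<bar>b y - ball_avg b x r\<bar>)) \<le> ennreal (exp (c * L2)) * ennreal (exp (c * \<bar>b y - set_avg b Q\<bar>))"
        by (simp add: exp_add ennreal_mult[symmetric] ennreal_leI)
      then have "ennreal (exp (c * \<bar>b y - ball_avg b x r\<bar>)) * (ennreal (w y) * indicator (ball x r) y)
         \<le> ennreal (exp (c * L2)) * ennreal (exp (c * \<bar>b y - set_avg b Q\<bar>)) * (ennreal (w y) * indicator Q y)"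
        using BQ by (intro mult_mono) (auto simp: indicator_def)
      then show "ennreal (exp (c * \<bar>b y - ball_avg b x r\<bar>)) * ennreal (w y) * indicator (ball x r) y
         \<le> ennreal (exp (c * L2)) * (ennreal (exp (c * \<bar>b y - set_avg b Q\<bar>)) * ennreal (w y) * indicator Q y)"
        by (simp add: mult.assoc)
    qed
    also have "\<dots> = ennreal (exp (c * L2)) * (\<integral>\<^sup>+ y \<in> Q. ennreal (exp (c * \<bar>b y - set_avg b Q\<bar>)) * ennreal (w y) \<partial>lebesgue)"
      by (intro nn_integral_cmult) measurable
    also have "\<dots> \<le> ennreal (exp (c * L2)) * (ennreal (4 / ainf_const \<theta> K n) * wmeas w Q)"
      unfolding Q_def c_jn n_def by (intro mult_left_mono John_Nirenberg_dcube[OF l]) simp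
    also have "wmeas w Q \<le> ennreal ((K * (real n * 2) ^ n) powr (1 / \<theta>)) * wmeas w (ball x r)"
    proof -
      have "1 \<le> real n" using DIM_positive[where 'a='a] unfolding n_def by linarith
      then have "wmeas w (ball x (real n * 2 * r)) \<le> ennreal ((K * (real n * 2) ^ n) powr (1 / \<theta>)) * wmeas w (ball x r)"
        unfolding n_def by (intro wmeas_ball_scale[OF r]) linarith
      with wmeas_mono[OF QB, of w] show ?thesis by (rule order_trans)
    qed
    finally have "(\<integral>\<^sup>+ y \<in> ball x r. ennreal (exp (c * \<bar>b y - ball_avg b x r\<bar>)) * ennreal (w y) \<partial>lebesgue)
        \<le> ennreal (exp (c * L2)) * (ennreal (4 / ainf_const \<theta> K n) * (ennreal ((K * (real n * 2) ^ n) powr (1 / \<theta>)) * wmeas w (ball x r)))"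
      by (simp add: mult_left_mono)
    moreover have "ennreal C = ennreal (exp (c * L2)) * (ennreal (4 / ainf_const \<theta> K n) * ennreal ((K * (real n * 2) ^ n) powr (1 / \<theta>)))"
      unfolding C_def n_def using c0_pos by (subst ennreal_mult, simp, simp, subst ennreal_mult, simp, simp) (rule refl)
    ultimately show ?thesis by (simp only: mult.assoc)
  qed
  then show ?thesis using c C by (intro exI[of _ c] conjI exI[of _ C] allI impI)
qed

section \<open>Consequences of exponential integrability: scaling, power moments, growth of
  means\<close>

text \<open>The divisor is any positive bound of the norm and not the norm itself, which vanishes
  for constant functions.\<close>

lemma bmo_norm_scale:
  assumes b: "in_BMO b" and \<beta>: "0 < \<beta>" "bmo_norm b \<le> ennreal \<beta>"
  shows "bmo_norm (\<lambda>y. b y / \<beta>) \<le> 1" "ball_avg (\<lambda>y. b y / \<beta>) x r = ball_avg b x r / \<beta>"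
proof -
  have [measurable]: "b \<in> borel_measurable lebesgue" using b by (simp add: in_BMO_def)
  have avg: "ball_avg (\<lambda>y. b y / \<beta>) x r = ball_avg b x r / \<beta>" for x r
    by (simp add: ball_avg_def)
  then show "ball_avg (\<lambda>y. b y / \<beta>) x r = ball_avg b x r / \<beta>" .
  show "bmo_norm (\<lambda>y. b y / \<beta>) \<le> 1"
    unfolding bmo_norm_def
  proof (rule SUP_least)
    fix xr :: "'a \<times> real" assume "xr \<in> {xr. 0 < snd xr}"
    then have r: "0 < snd xr" by simp
    let ?B = "ball (fst xr) (snd xr)"
    have "(\<integral>\<^sup>+ y \<in> ?B. ennreal \<bar>b y / \<beta> - ball_avg (\<lambda>y. b y / \<beta>) (fst xr) (snd xr)\<bar> \<partial>lebesgue)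
        = (\<integral>\<^sup>+ y. ennreal (1 / \<beta>) * (ennreal \<bar>b y - ball_avg b (fst xr) (snd xr)\<bar> * indicator ?B y) \<partial>lebesgue)"
    proof (intro nn_integral_cong)
      fix y
      have "\<bar>b y / \<beta> - ball_avg b (fst xr) (snd xr) / \<beta>\<bar> = 1 / \<beta> * \<bar>b y - ball_avg b (fst xr) (snd xr)\<bar>"
        using \<beta>(1) by (simp add: diff_divide_distrib[symmetric])
      then show "ennreal \<bar>b y / \<beta> - ball_avg (\<lambda>y. b y / \<beta>) (fst xr) (snd xr)\<bar> * indicator ?B y
         = ennreal (1 / \<beta>) * (ennreal \<bar>b y - ball_avg b (fst xr) (snd xr)\<bar> * indicator ?B y)"
        unfolding avg using \<beta>(1) by (simp add: mult.assoc[symmetric] ennreal_mult[symmetric])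
    qed
    also have "\<dots> = ennreal (1 / \<beta>) * (\<integral>\<^sup>+ y \<in> ?B. ennreal \<bar>b y - ball_avg b (fst xr) (snd xr)\<bar> \<partial>lebesgue)"
      by (intro nn_integral_cmult) measurable
    also have "\<dots> \<le> ennreal (1 / \<beta>) * (ennreal \<beta> * ball_meas (fst xr) (snd xr))"
      by (intro mult_left_mono bmo_ball \<beta> r) auto
    also have "\<dots> = 1 * ball_meas (fst xr) (snd xr)"
      using \<beta>(1) by (simp add: mult.assoc[symmetric] ennreal_mult[symmetric])
    finally show "(\<integral>\<^sup>+ y \<in> ?B. ennreal \<bar>b y / \<beta> - ball_avg (\<lambda>y. b y / \<beta>) (fst xr) (snd xr)\<bar> \<partial>lebesgue)
        / ball_meas (fst xr) (snd xr) \<le> 1"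
      using ball_meas_pos[OF r, of "fst xr"] ball_meas_finite[of "fst xr" "snd xr"]
      by (subst ennreal_divide_le_iff) auto
  qed
qed

lemma John_Nirenberg_scaled:
  fixes \<theta> K :: real
  shows "\<exists>c>0. \<exists>C>0. \<forall>(w :: 'a::euclidean_space \<Rightarrow> real) v b \<beta>. muckenhoupt \<theta> K w v \<longrightarrow> in_BMO b \<longrightarrow> 0 < \<beta> \<longrightarrow> bmo_norm b \<le> ennreal \<beta> \<longrightarrow>
     (\<forall>x. \<forall>r>0. (\<integral>\<^sup>+ y \<in> ball x r. ennreal (exp (c / \<beta> * \<bar>b y - ball_avg b x r\<bar>)) * ennreal (w y) \<partial>lebesgue)
        \<le> ennreal C * wmeas w (ball x r))"
proof -
  obtain c C where c: "0 < c" "0 < C" and jn: "\<And>(w :: 'a \<Rightarrow> real) v b x r. muckenhoupt_bmo \<theta> K w v b \<Longrightarrow> 0 < r \<Longrightarrow>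
     (\<integral>\<^sup>+ y \<in> ball x r. ennreal (exp (c * \<bar>b y - ball_avg b x r\<bar>)) * ennreal (w y) \<partial>lebesgue) \<le> ennreal C * wmeas w (ball x r)"
    using weighted_John_Nirenberg[of \<theta> K, where 'a='a] by blast
  show ?thesis
  proof (rule exI[of _ c], intro conjI, rule c(1), rule exI[of _ C], intro conjI allI impI, rule c(2))
    fix w v b :: "'a \<Rightarrow> real" and \<beta> x r
    assume mu: "muckenhoupt \<theta> K w v" and b: "in_BMO b" and \<beta>: "0 < \<beta>" "bmo_norm b \<le> ennreal \<beta>" and r: "0 < (r::real)"
    have "muckenhoupt_bmo \<theta> K w v (\<lambda>y. b y / \<beta>)"
      unfolding muckenhoupt_bmo_def muckenhoupt_bmo_axioms_def
      using mu b bmo_norm_scale(1)[OF b \<beta>] by (auto simp: in_BMO_def)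
    from jn[OF this r, of x] show "(\<integral>\<^sup>+ y \<in> ball x r. ennreal (exp (c / \<beta> * \<bar>b y - ball_avg b x r\<bar>)) * ennreal (w y) \<partial>lebesgue) \<le> ennreal C * wmeas w (ball x r)"
      unfolding bmo_norm_scale(2)[OF b \<beta>] using \<beta>(1) by (simp add: diff_divide_distrib[symmetric])
  qed
qed

text \<open>A power is dominated by an exponential, so this follows from exponential integrability.
  The added \<beta> is the form in which the oscillation enters later, where the pointwise factor
  has to absorb an error of size \<beta>.\<close>

lemma oscillation_power_bound:
  fixes \<theta> K s :: real
  assumes s: "0 < s"
  shows "\<exists>C>0. \<forall>(w :: 'a::euclidean_space \<Rightarrow> real) v b \<beta>. muckenhoupt \<theta> K w v \<longrightarrow> in_BMO b \<longrightarrow> 0 < \<beta> \<longrightarrow> bmo_norm b \<le> ennreal \<beta> \<longrightarrow>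
     (\<forall>x. \<forall>r>0. (\<integral>\<^sup>+ y \<in> ball x r. ennreal ((\<bar>b y - ball_avg b x r\<bar> + \<beta>) powr s) * ennreal (w y) \<partial>lebesgue)
        \<le> ennreal (C * \<beta> powr s) * wmeas w (ball x r))"
proof -
  obtain c C where c: "0 < c" "0 < C" and jn: "\<forall>(w :: 'a \<Rightarrow> real) v b \<beta>. muckenhoupt \<theta> K w v \<longrightarrow> in_BMO b \<longrightarrow> 0 < \<beta> \<longrightarrow> bmo_norm b \<le> ennreal \<beta> \<longrightarrow>
     (\<forall>x. \<forall>r>0. (\<integral>\<^sup>+ y \<in> ball x r. ennreal (exp (c / \<beta> * \<bar>b y - ball_avg b x r\<bar>)) * ennreal (w y) \<partial>lebesgue)
        \<le> ennreal C * wmeas w (ball x r))"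
    using John_Nirenberg_scaled[of \<theta> K, where 'a='a] by (elim exE conjE) (rule that)
  \<comment> \<open>From c u / s <= exp(c u / s), raised to the power s: u^s <= (s/c)^s exp(c u).
    With u = t/\<beta> + 1 the summand 1 costs the factor exp c.\<close>
  define D where "D = (s / c) powr s * exp c"
  have D: "0 < D" using s c by (simp add: D_def)
  show ?thesis
  proof (intro exI[of _ "D * C"] conjI allI impI)
    show "0 < D * C" using D c by simp
    fix w v b :: "'a \<Rightarrow> real" and \<beta> x r
    assume mu: "muckenhoupt \<theta> K w v" and b: "in_BMO b" and \<beta>: "0 < \<beta>" "bmo_norm b \<le> ennreal \<beta>" and r: "0 < (r::real)"
    have [measurable]: "b \<in> borel_measurable lebesgue" using b by (simp add: in_BMO_def)
    interpret muckenhoupt \<theta> K w v by (rule mu)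
    have ptw: "(t + \<beta>) powr s \<le> D * \<beta> powr s * exp (c / \<beta> * t)" if t: "0 \<le> t" for t
    proof -
      define u where "u = (t + \<beta>) / \<beta>"
      have u: "0 < u" "t + \<beta> = \<beta> * u" using t \<beta> by (auto simp: u_def)
      have "c * u / s \<le> exp (c * u / s)" using exp_ge_add_one_self[of "c * u / s"] by linarith
      then have "(c * u / s) powr s \<le> exp (c * u / s) powr s"
        using u c s by (intro powr_mono2) auto
      also have "\<dots> = exp (c * u)" using s by (simp add: powr_def)
      finally have "(s / c) powr s * (c * u / s) powr s \<le> (s / c) powr s * exp (c * u)"
        by (rule mult_left_mono) simp
      moreover have "(s / c) powr s * (c * u / s) powr s = u powr s"
        using u c s by (simp add: powr_mult[symmetric])
      ultimately have "u powr s \<le> (s / c) powr s * exp (c * u)" by simp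
      also have "c * u = c + c / \<beta> * t" using \<beta> by (simp add: u_def field_simps)
      finally have "u powr s \<le> D * exp (c / \<beta> * t)" by (simp add: D_def exp_add mult.assoc)
      then have "\<beta> powr s * u powr s \<le> \<beta> powr s * (D * exp (c / \<beta> * t))" by (rule mult_left_mono) simp
      then show ?thesis using \<beta> u by (simp add: powr_mult ac_simps)
    qed
    have "(\<integral>\<^sup>+ y \<in> ball x r. ennreal ((\<bar>b y - ball_avg b x r\<bar> + \<beta>) powr s) * ennreal (w y) \<partial>lebesgue)
       \<le> (\<integral>\<^sup>+ y. ennreal (D * \<beta> powr s) * (ennreal (exp (c / \<beta> * \<bar>b y - ball_avg b x r\<bar>)) * ennreal (w y) * indicator (ball x r) y) \<partial>lebesgue)"
    proof (rule nn_integral_mono)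
      fix y
      have "ennreal ((\<bar>b y - ball_avg b x r\<bar> + \<beta>) powr s) \<le> ennreal (D * \<beta> powr s) * ennreal (exp (c / \<beta> * \<bar>b y - ball_avg b x r\<bar>))"
        using ptw[of "\<bar>b y - ball_avg b x r\<bar>"] D by (subst ennreal_mult[symmetric]) (auto intro!: ennreal_leI)
      then have "ennreal ((\<bar>b y - ball_avg b x r\<bar> + \<beta>) powr s) * (ennreal (w y) * indicator (ball x r) y)
         \<le> ennreal (D * \<beta> powr s) * ennreal (exp (c / \<beta> * \<bar>b y - ball_avg b x r\<bar>)) * (ennreal (w y) * indicator (ball x r) y)"
        by (rule mult_right_mono) simp
      then show "ennreal ((\<bar>b y - ball_avg b x r\<bar> + \<beta>) powr s) * ennreal (w y) * indicator (ball x r) y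
         \<le> ennreal (D * \<beta> powr s) * (ennreal (exp (c / \<beta> * \<bar>b y - ball_avg b x r\<bar>)) * ennreal (w y) * indicator (ball x r) y)"
        by (simp only: mult.assoc)
    qed
    also have "\<dots> = ennreal (D * \<beta> powr s) * (\<integral>\<^sup>+ y \<in> ball x r. ennreal (exp (c / \<beta> * \<bar>b y - ball_avg b x r\<bar>)) * ennreal (w y) \<partial>lebesgue)"
      by (intro nn_integral_cmult) measurable
    also have "\<dots> \<le> ennreal (D * \<beta> powr s) * (ennreal C * wmeas w (ball x r))"
      by (intro mult_left_mono jn[rule_format, OF mu b \<beta> r]) simp
    also have "\<dots> = ennreal (D * C * \<beta> powr s) * wmeas w (ball x r)"
      using D c by (simp add: ennreal_mult ac_simps)
    finally show "(\<integral>\<^sup>+ y \<in> ball x r. ennreal ((\<bar>b y - ball_avg b x r\<bar> + \<beta>) powr s) * ennreal (w y) \<partial>lebesgue)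
       \<le> ennreal (D * C * \<beta> powr s) * wmeas w (ball x r)" .
  qed
qed

text \<open>Enlarging the radius by a factor of at most 2 moves the mean by at most 2^n \<beta>,
  because the smaller ball fills at least the fraction 2^(-n) of the larger; such steps are
  chained.\<close>

lemma ball_avg_log_growth:
  fixes b :: "'a::euclidean_space \<Rightarrow> real"
  assumes b: "in_BMO b" and \<beta>: "0 < \<beta>" "bmo_norm b \<le> ennreal \<beta>" and r: "0 < r" "r \<le> \<tau>"
  shows "\<bar>ball_avg b x r - ball_avg b x \<tau>\<bar> \<le> 2 ^ (DIM('a) + 1) * \<beta> * (1 + ln (\<tau> / r))"
proof -
  define G where "G = 2 ^ DIM('a) * \<beta>"
  have G: "0 < G" using \<beta> by (simp add: G_def)
  have step: "\<bar>ball_avg b x r - ball_avg b x \<tau>\<bar> \<le> G" if r: "0 < r" and le: "r \<le> \<tau>" "\<tau> \<le> 2 * r" for r \<tau>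
    unfolding ball_avg_eq_set_avg[of b x r]
  proof (rule set_avg_deviation_le)
    have "(\<integral>\<^sup>+ y \<in> ball x r. ennreal \<bar>b y - ball_avg b x \<tau>\<bar> \<partial>lebesgue) \<le> (\<integral>\<^sup>+ y \<in> ball x \<tau>. ennreal \<bar>b y - ball_avg b x \<tau>\<bar> \<partial>lebesgue)"
      using le by (intro nn_integral_mono) (auto simp: indicator_def)
    also have "\<dots> \<le> ennreal \<beta> * ball_meas x \<tau>" using r le by (intro bmo_ball \<beta>) auto
    also have "\<dots> \<le> ennreal \<beta> * ball_meas x (2 * r)"
      unfolding ball_meas_def using le by (intro mult_left_mono emeasure_mono subset_ball) auto
    also have "\<dots> = ennreal G * emeasure lebesgue (ball x r)"
      using r \<beta> by (subst ball_meas_scale[of r 2 x x])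
        (auto simp: G_def ball_meas_def mult.assoc[symmetric] ennreal_mult[symmetric] mult.commute simp del: emeasure_completion)
    finally show "(\<integral>\<^sup>+ y \<in> ball x r. ennreal \<bar>b y - ball_avg b x \<tau>\<bar> \<partial>lebesgue) \<le> ennreal G * emeasure lebesgue (ball x r)" .
  qed (use r b G ball_meas_pos[OF r, of x] ball_meas_finite[of x r] in \<open>auto simp: ball_meas_def in_BMO_def\<close>)
  have chain: "\<forall>\<tau>. r \<le> \<tau> \<longrightarrow> \<tau> \<le> 2 ^ k * r \<longrightarrow> \<bar>ball_avg b x r - ball_avg b x \<tau>\<bar> \<le> real k * G" for k
  proof (induction k)
    case 0
    then show ?case by (auto dest: antisym)
  next
    case (Suc k)
    show ?case
    proof (intro allI impI)
      fix \<tau> assume t: "r \<le> \<tau>" "\<tau> \<le> 2 ^ Suc k * r"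
      show "\<bar>ball_avg b x r - ball_avg b x \<tau>\<bar> \<le> real (Suc k) * G"
      proof (cases "\<tau> \<le> 2 * r")
        case True
        then have "\<bar>ball_avg b x r - ball_avg b x \<tau>\<bar> \<le> G" using step[OF r(1) t(1)] by simp
        also have "\<dots> \<le> real (Suc k) * G" using G by (simp add: algebra_simps)
        finally show ?thesis .
      next
        case False
        then have "\<bar>ball_avg b x r - ball_avg b x (\<tau> / 2)\<bar> \<le> real k * G" using Suc t by auto
        moreover have "\<bar>ball_avg b x (\<tau> / 2) - ball_avg b x \<tau>\<bar> \<le> G" using False r(1) by (intro step) auto
        moreover have "real (Suc k) * G = real k * G + G" by (simp add: algebra_simps)
        ultimately show ?thesis by linarith
      qed
    qed
  qed
  \<comment> \<open>The number of doublings from r to \<tau>. Rounding up costs one, and the binary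
    logarithm is at most 2 ln since ln 2 >= 1/2; hence k <= 2 (1 + ln (\<tau> / r)).\<close>
  define k where "k = nat \<lceil>log 2 (\<tau> / r)\<rceil>"
  have ge1: "1 \<le> \<tau> / r" using r by simp
  have l0: "0 \<le> log 2 (\<tau> / r)" using ge1 by (simp add: zero_le_log_cancel_iff)
  have rk: "log 2 (\<tau> / r) \<le> real k" "real k \<le> log 2 (\<tau> / r) + 1"
    unfolding k_def using l0 by linarith+
  have "\<tau> / r = 2 powr (log 2 (\<tau> / r))" using ge1 by simp
  also have "\<dots> \<le> 2 powr (real k)" using rk by simp
  finally have "\<tau> \<le> 2 ^ k * r" using r by (simp add: powr_realpow field_simps)
  then have "\<bar>ball_avg b x r - ball_avg b x \<tau>\<bar> \<le> real k * G" using chain r by blast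
  also have "\<dots> \<le> (2 * (1 + ln (\<tau> / r))) * G"
  proof (rule mult_right_mono)
    have ln2: "1 / 2 \<le> ln (2::real)" using ln2_ge_two_thirds by linarith
    have "log 2 (\<tau> / r) = ln (\<tau> / r) / ln 2" by (simp add: log_def)
    also have "\<dots> \<le> ln (\<tau> / r) / (1 / 2)"
      using ln2 ge1 by (intro divide_left_mono) auto
    finally show "real k \<le> 2 * (1 + ln (\<tau> / r))" using rk(2) by simp
  qed (use G in simp)
  finally show ?thesis by (simp add: G_def algebra_simps)
qed

section \<open>Commutators by exponential conjugation\<close>

text \<open>With p' conjugate to p, s = 1/q + 1/p', and \<theta> and 1 - \<theta> are the shares of
  1/q and 1/p' in s. The last identity is what makes \<omega>^q and \<omega>^(-p') a pair with
  w^\<theta> v^(1-\<theta>) = 1.\<close>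

lemma exponent_relations:
  fixes p q s \<theta> :: real
  assumes p: "1 < p" "p < q" and s: "s = 1 / q + 1 - 1 / p" and th: "\<theta> = 1 / (q * s)"
  shows "0 < s" "0 < \<theta>" "\<theta> < 1" "s * \<theta> = 1 / q" "s * (1 - \<theta>) = 1 - 1 / p"
    "q * \<theta> = p / (p - 1) * (1 - \<theta>)"
proof -
  have i: "1 / p < 1" "0 < 1 / q" using p by simp_all
  then show s0: "0 < s" unfolding s by linarith
  then show "0 < \<theta>" using p by (simp add: th)
  show e1: "s * \<theta> = 1 / q" using s0 p by (simp add: th)
  then show e2: "s * (1 - \<theta>) = 1 - 1 / p" by (simp add: right_diff_distrib s)
  then have "0 < s * (1 - \<theta>)" using i by simp
  then show "\<theta> < 1" using s0 by (simp add: zero_less_mult_iff)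
  have "s * (q * \<theta>) = 1" using e1 p by (simp add: field_simps)
  moreover have "s * (p / (p - 1) * (1 - \<theta>)) = p / (p - 1) * (s * (1 - \<theta>))" by simp
  then have "s * (p / (p - 1) * (1 - \<theta>)) = 1" unfolding e2 using p by (simp add: field_simps)
  ultimately show "q * \<theta> = p / (p - 1) * (1 - \<theta>)"
    using s0 by (metis mult_left_cancel less_irrefl)
qed

lemma wmeas_exp_perturb:
  fixes w b :: "'a::euclidean_space \<Rightarrow> real"
  assumes [measurable]: "w \<in> borel_measurable lebesgue" "b \<in> borel_measurable lebesgue" and w: "\<And>y. 0 \<le> w y"
    and jn: "(\<integral>\<^sup>+ y \<in> ball x r. ennreal (exp (c * \<bar>b y - m\<bar>)) * ennreal (w y) \<partial>lebesgue) \<le> ennreal C * wmeas w (ball x r)"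
    and d: "\<bar>d\<bar> \<le> c"
  shows "wmeas (\<lambda>y. w y * exp (d * b y)) (ball x r) \<le> ennreal (exp (d * m)) * (ennreal C * wmeas w (ball x r))"
proof -
  have "wmeas (\<lambda>y. w y * exp (d * b y)) (ball x r)
     \<le> (\<integral>\<^sup>+ y. ennreal (exp (d * m)) * (ennreal (exp (c * \<bar>b y - m\<bar>)) * ennreal (w y) * indicator (ball x r) y) \<partial>lebesgue)"
    unfolding wmeas_def
  proof (rule nn_integral_mono)
    fix y
    have "d * (b y - m) \<le> \<bar>d\<bar> * \<bar>b y - m\<bar>" by (metis abs_ge_self abs_mult)
    also have "\<dots> \<le> c * \<bar>b y - m\<bar>" using d by (intro mult_right_mono) auto
    finally have "exp (d * b y) \<le> exp (d * m) * exp (c * \<bar>b y - m\<bar>)"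
      by (simp add: exp_add[symmetric] algebra_simps)
    then have "w y * exp (d * b y) \<le> exp (d * m) * (exp (c * \<bar>b y - m\<bar>) * w y)"
      using mult_right_mono[OF _ w, of "exp (d * b y)" "exp (d * m) * exp (c * \<bar>b y - m\<bar>)" y] by (simp add: ac_simps)
    then have "ennreal (w y * exp (d * b y)) \<le> ennreal (exp (d * m)) * (ennreal (exp (c * \<bar>b y - m\<bar>)) * ennreal (w y))"
      using w[of y] by (simp add: ennreal_mult[symmetric] ennreal_leI)
    then show "ennreal (w y * exp (d * b y)) * indicator (ball x r) y
       \<le> ennreal (exp (d * m)) * (ennreal (exp (c * \<bar>b y - m\<bar>)) * ennreal (w y) * indicator (ball x r) y)"
      by (auto simp: indicator_def)
  qed
  also have "\<dots> = ennreal (exp (d * m)) * (\<integral>\<^sup>+ y \<in> ball x r. ennreal (exp (c * \<bar>b y - m\<bar>)) * ennreal (w y) \<partial>lebesgue)"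
    by (intro nn_integral_cmult) measurable
  also have "\<dots> \<le> ennreal (exp (d * m)) * (ennreal C * wmeas w (ball x r))"
    by (intro mult_left_mono jn) simp
  finally show ?thesis .
qed

text \<open>On each ball b is replaced by its mean m at the cost of the exponential integrals. The
  remaining factors exp(e A m)^\<theta> and exp(-e B m)^(1-\<theta>) cancel because A \<theta> = B
  (1 - \<theta>), so the new constant is the same for all balls and all admissible e.\<close>

lemma muckenhoupt_exp_perturb:
  fixes w v b :: "'a::euclidean_space \<Rightarrow> real" and A B e :: real
  assumes mu: "muckenhoupt \<theta> K w v" and [measurable]: "b \<in> borel_measurable lebesgue" and C: "0 < C" "0 < C'"
    and jnw: "\<And>x r. 0 < r \<Longrightarrow> (\<integral>\<^sup>+ y \<in> ball x r. ennreal (exp (c * \<bar>b y - ball_avg b x r\<bar>)) * ennreal (w y) \<partial>lebesgue) \<le> ennreal C * wmeas w (ball x r)"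
    and jnv: "\<And>x r. 0 < r \<Longrightarrow> (\<integral>\<^sup>+ y \<in> ball x r. ennreal (exp (c' * \<bar>b y - ball_avg b x r\<bar>)) * ennreal (v y) \<partial>lebesgue) \<le> ennreal C' * wmeas v (ball x r)"
    and AB: "A * \<theta> = B * (1 - \<theta>)" and e: "\<bar>e * A\<bar> \<le> c" "\<bar>e * B\<bar> \<le> c'"
  shows "muckenhoupt \<theta> (C powr \<theta> * C' powr (1 - \<theta>) * K) (\<lambda>y. w y * exp (e * A * b y)) (\<lambda>y. v y * exp (- (e * B) * b y))"
proof -
  interpret W: muckenhoupt \<theta> K w v by (rule mu)
  interpret V: muckenhoupt "1 - \<theta>" K v w by (rule muckenhoupt_swap[OF mu])
  have cancel: "exp (e * A * t) powr \<theta> * exp (- (e * B) * t) powr (1 - \<theta>) = 1" for t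
  proof -
    have "exp (e * A * t) powr \<theta> * exp (- (e * B) * t) powr (1 - \<theta>) = exp (\<theta> * (e * A * t) + (1 - \<theta>) * (- (e * B) * t))"
      by (simp only: powr_def exp_not_eq_zero if_False ln_exp exp_add)
    also have "\<theta> * (e * A * t) + (1 - \<theta>) * (- (e * B) * t) = e * t * (A * \<theta> - B * (1 - \<theta>))"
      by (simp add: algebra_simps)
    finally show ?thesis using AB by simp
  qed
  show ?thesis
    unfolding muckenhoupt_def muck_pair_def
  proof (intro conjI allI impI W.theta)
    show "(\<lambda>y. w y * exp (e * A * b y)) \<in> borel_measurable lebesgue" "(\<lambda>y. v y * exp (- (e * B) * b y)) \<in> borel_measurable lebesgue"
      by measurable
    show "0 \<le> w x * exp (e * A * b x)" "0 \<le> v x * exp (- (e * B) * b x)" for x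
      using W.w_nonneg W.v_nonneg by auto
    show "AE x in lebesgue. (w x * exp (e * A * b x)) powr \<theta> * (v x * exp (- (e * B) * b x)) powr (1 - \<theta>) = 1"
      using W.ae_prod
    proof eventually_elim
      case (elim x)
      have "(w x * exp (e * A * b x)) powr \<theta> * (v x * exp (- (e * B) * b x)) powr (1 - \<theta>)
         = (w x powr \<theta> * v x powr (1 - \<theta>)) * (exp (e * A * b x) powr \<theta> * exp (- (e * B) * b x) powr (1 - \<theta>))"
        using W.w_nonneg[of x] W.v_nonneg[of x] by (simp only: powr_mult exp_ge_zero ac_simps)
      then show ?case using elim cancel by simp
    qed
    fix x :: 'a and r :: real assume r: "0 < r"
    define m where "m = ball_avg b x r"
    have w': "wmeas (\<lambda>y. w y * exp (e * A * b y)) (ball x r) \<le> ennreal (exp (e * A * m)) * (ennreal C * wmeas w (ball x r))"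
      unfolding m_def by (rule wmeas_exp_perturb[where c=c]) (use jnw r e W.w_nonneg in auto)
    have v': "wmeas (\<lambda>y. v y * exp (- (e * B) * b y)) (ball x r) \<le> ennreal (exp (- (e * B) * m)) * (ennreal C' * wmeas v (ball x r))"
      unfolding m_def by (rule wmeas_exp_perturb[where c=c']) (use jnv r e W.v_nonneg in auto)
    show "wmeas (\<lambda>y. w y * exp (e * A * b y)) (ball x r) < top"
      using w' by (rule le_less_trans) (simp add: ennreal_mult_less_top W.wmeas_ball_finite)
    show "wmeas (\<lambda>y. v y * exp (- (e * B) * b y)) (ball x r) < top"
      using v' by (rule le_less_trans) (simp add: ennreal_mult_less_top V.wmeas_ball_finite)
    have "enn_powr (wmeas (\<lambda>y. w y * exp (e * A * b y)) (ball x r)) \<theta> * enn_powr (wmeas (\<lambda>y. v y * exp (- (e * B) * b y)) (ball x r)) (1 - \<theta>)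
       \<le> enn_powr (ennreal (exp (e * A * m)) * (ennreal C * wmeas w (ball x r))) \<theta> * enn_powr (ennreal (exp (- (e * B) * m)) * (ennreal C' * wmeas v (ball x r))) (1 - \<theta>)"
      using W.theta by (intro mult_mono enn_powr_mono w' v') auto
    also have "\<dots> = ennreal (exp (e * A * m) powr \<theta> * exp (- (e * B) * m) powr (1 - \<theta>)) * (ennreal (C powr \<theta> * C' powr (1 - \<theta>)) *
          (enn_powr (wmeas w (ball x r)) \<theta> * enn_powr (wmeas v (ball x r)) (1 - \<theta>)))"
      using C by (simp add: enn_powr_mult enn_powr_ennreal ennreal_mult ac_simps)
    also have "\<dots> = ennreal (C powr \<theta> * C' powr (1 - \<theta>)) * (enn_powr (wmeas w (ball x r)) \<theta> * enn_powr (wmeas v (ball x r)) (1 - \<theta>))"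
      unfolding cancel by simp
    also have "\<dots> \<le> ennreal (C powr \<theta> * C' powr (1 - \<theta>)) * (ennreal K * ball_meas x r)"
      by (intro mult_left_mono W.ball_product r) simp
    also have "\<dots> = ennreal (C powr \<theta> * C' powr (1 - \<theta>) * K) * ball_meas x r"
      using W.K_pos by (simp add: ennreal_mult mult.assoc)
    finally show "enn_powr (wmeas (\<lambda>y. w y * exp (e * A * b y)) (ball x r)) \<theta> * enn_powr (wmeas (\<lambda>y. v y * exp (- (e * B) * b y)) (ball x r)) (1 - \<theta>)
       \<le> ennreal (C powr \<theta> * C' powr (1 - \<theta>) * K) * ball_meas x r" .
  qed
qed

text \<open>The commutator of the linear fractional maximal operator; for s = 1/q + 1 - 1/p it has
  order \<alpha> with s = 1 - \<alpha>/n.\<close>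

definition comm_max :: "real \<Rightarrow> ('a::euclidean_space \<Rightarrow> real) \<Rightarrow> ('a \<Rightarrow> real) \<Rightarrow> 'a \<Rightarrow> ennreal" where
  "comm_max s b f x = (SUP t\<in>{0<..}. ennreal (measure lebesgue (ball x t) powr (- s)) *
      (\<integral>\<^sup>+ y \<in> ball x t. ennreal (\<bar>b x - b y\<bar> * \<bar>f y\<bar>) \<partial>lebesgue))"

lemma enn_powr_add_le:
  assumes "0 \<le> q" shows "enn_powr (x + y) q \<le> ennreal (2 powr q) * (enn_powr x q + enn_powr y q)"
proof -
  have "x + y \<le> 2 * max x y" unfolding mult_2 by (intro add_mono) auto
  then have "enn_powr (x + y) q \<le> enn_powr (2 * max x y) q" using assms by (rule enn_powr_mono)
  also have "\<dots> = ennreal (2 powr q) * enn_powr (max x y) q"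
    using enn_powr_ennreal[of 2 q] by (simp add: enn_powr_mult)
  also have "\<dots> \<le> ennreal (2 powr q) * (enn_powr x q + enn_powr y q)"
    by (intro mult_left_mono) (auto simp: max_def)
  finally show ?thesis .
qed

text \<open>The exponential of b(x) - b(y) factors, so the dependence on b(x) leaves the integral.
  What remains inside is a fractional maximal function of \<bar>f\<bar> times an exponential of b,
  which can be treated with perturbed weights.\<close>

lemma comm_max_le_conjugated:
  fixes b f :: "'a::euclidean_space \<Rightarrow> real" and s \<epsilon> :: real
  assumes [measurable]: "b \<in> borel_measurable lebesgue" "f \<in> borel_measurable lebesgue" and \<epsilon>: "0 < \<epsilon>"
  defines "T \<equiv> \<lambda>e x. SUP t\<in>{0<..}. ennreal (measure lebesgue (ball x t) powr (- s)) * (\<integral>\<^sup>+ y \<in> ball x t. ennreal (\<bar>f y\<bar> * exp (- e * b y)) \<partial>lebesgue)"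
  shows "comm_max s b f x \<le> ennreal (1 / \<epsilon>) * (ennreal (exp (\<epsilon> * b x)) * T \<epsilon> x + ennreal (exp (- \<epsilon> * b x)) * T (- \<epsilon>) x)"
  unfolding comm_max_def
proof (rule SUP_least)
  fix t :: real assume t: "t \<in> {0<..}"
  let ?B = "ball x t" and ?k = "ennreal (measure lebesgue (ball x t) powr (- s))"
  define J where "J e = (\<integral>\<^sup>+ y \<in> ?B. ennreal (\<bar>f y\<bar> * exp (- e * b y)) \<partial>lebesgue)" for e
  have JT: "?k * J e \<le> T e x" for e
    unfolding J_def T_def using t by (intro SUP_upper) auto
  have ptw: "\<bar>b x - b y\<bar> * \<bar>f y\<bar> \<le> 1 / \<epsilon> * (exp (\<epsilon> * b x) * (\<bar>f y\<bar> * exp (- \<epsilon> * b y)) + exp (- \<epsilon> * b x) * (\<bar>f y\<bar> * exp (\<epsilon> * b y)))" for y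
  proof -
    define u where "u = \<epsilon> * (b x - b y)"
    have "\<bar>u\<bar> \<le> exp \<bar>u\<bar>" using exp_ge_add_one_self[of "\<bar>u\<bar>"] by linarith
    also have "\<dots> \<le> exp u + exp (- u)" by (cases "0 \<le> u") auto
    finally have "\<epsilon> * \<bar>b x - b y\<bar> \<le> exp u + exp (- u)" using \<epsilon> by (simp add: u_def abs_mult)
    then have "\<bar>b x - b y\<bar> \<le> 1 / \<epsilon> * (exp u + exp (- u))" using \<epsilon> by (simp add: field_simps)
    then have "\<bar>b x - b y\<bar> * \<bar>f y\<bar> \<le> 1 / \<epsilon> * (exp u + exp (- u)) * \<bar>f y\<bar>" by (rule mult_right_mono) simp
    also have "exp u = exp (\<epsilon> * b x) * exp (- \<epsilon> * b y)" by (simp add: u_def exp_add[symmetric] right_diff_distrib)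
    also have "exp (- u) = exp (- \<epsilon> * b x) * exp (\<epsilon> * b y)" by (simp add: u_def exp_add[symmetric] right_diff_distrib)
    finally show ?thesis by (simp add: algebra_simps)
  qed
  have "(\<integral>\<^sup>+ y \<in> ?B. ennreal (\<bar>b x - b y\<bar> * \<bar>f y\<bar>) \<partial>lebesgue)
     \<le> (\<integral>\<^sup>+ y. ennreal (1 / \<epsilon>) * (ennreal (exp (\<epsilon> * b x)) * (ennreal (\<bar>f y\<bar> * exp (- \<epsilon> * b y)) * indicator ?B y)
          + ennreal (exp (- \<epsilon> * b x)) * (ennreal (\<bar>f y\<bar> * exp (- (- \<epsilon>) * b y)) * indicator ?B y)) \<partial>lebesgue)"
  proof (rule nn_integral_mono)
    fix y
    show "ennreal (\<bar>b x - b y\<bar> * \<bar>f y\<bar>) * indicator ?B y \<le> ennreal (1 / \<epsilon>) * (ennreal (exp (\<epsilon> * b x)) * (ennreal (\<bar>f y\<bar> * exp (- \<epsilon> * b y)) * indicator ?B y)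
          + ennreal (exp (- \<epsilon> * b x)) * (ennreal (\<bar>f y\<bar> * exp (- (- \<epsilon>) * b y)) * indicator ?B y))"
    proof (cases "y \<in> ?B")
      case True
      have comb: "ennreal (1 / \<epsilon>) * (ennreal a * ennreal a' + ennreal c * ennreal c') = ennreal (1 / \<epsilon> * (a * a' + c * c'))"
        if "0 \<le> a" "0 \<le> a'" "0 \<le> c" "0 \<le> c'" for a a' c c'
        using that \<epsilon> by (simp add: ennreal_mult[symmetric] ennreal_plus[symmetric] del: ennreal_plus)
      show ?thesis
        using True ennreal_leI[OF ptw[of y]] by (simp add: comb del: times_divide_eq_left)
    qed simp
  qed
  also have "\<dots> = ennreal (1 / \<epsilon>) * (ennreal (exp (\<epsilon> * b x)) * J \<epsilon> + ennreal (exp (- \<epsilon> * b x)) * J (- \<epsilon>))"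
    unfolding J_def by (simp add: nn_integral_cmult nn_integral_add)
  finally have "?k * (\<integral>\<^sup>+ y \<in> ?B. ennreal (\<bar>b x - b y\<bar> * \<bar>f y\<bar>) \<partial>lebesgue)
      \<le> ?k * (ennreal (1 / \<epsilon>) * (ennreal (exp (\<epsilon> * b x)) * J \<epsilon> + ennreal (exp (- \<epsilon> * b x)) * J (- \<epsilon>)))"
    by (rule mult_left_mono) simp
  also have "\<dots> = ennreal (1 / \<epsilon>) * (ennreal (exp (\<epsilon> * b x)) * (?k * J \<epsilon>) + ennreal (exp (- \<epsilon> * b x)) * (?k * J (- \<epsilon>)))"
    by (simp add: distrib_left ac_simps)
  also have "\<dots> \<le> ennreal (1 / \<epsilon>) * (ennreal (exp (\<epsilon> * b x)) * T \<epsilon> x + ennreal (exp (- \<epsilon> * b x)) * T (- \<epsilon>) x)"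
    by (intro mult_left_mono add_mono JT) auto
  finally show "?k * (\<integral>\<^sup>+ y \<in> ?B. ennreal (\<bar>b x - b y\<bar> * \<bar>f y\<bar>) \<partial>lebesgue)
      \<le> ennreal (1 / \<epsilon>) * (ennreal (exp (\<epsilon> * b x)) * T \<epsilon> x + ennreal (exp (- \<epsilon> * b x)) * T (- \<epsilon>) x)" .
qed


section \<open>Measurability of suprema over all radii\<close>

lemma sigma_finite_lebesgue: "sigma_finite_measure (lebesgue :: 'a::euclidean_space measure)"
proof
  show "\<exists>A. countable A \<and> A \<subseteq> sets (lebesgue :: 'a measure) \<and> \<Union>A = space (lebesgue :: 'a measure) \<and> (\<forall>a\<in>A. emeasure (lebesgue :: 'a measure) a \<noteq> \<infinity>)"
  proof (intro exI conjI ballI)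
    show "\<Union>(range (\<lambda>n::nat. ball (0::'a) (real n))) = space lebesgue"
      by (auto simp: reals_Archimedean2)
  qed (use ball_meas_finite[of "0::'a"] in \<open>auto simp: less_top ball_meas_def\<close>)
qed

lemma prod_mono_ennreal:
  fixes f g :: "'i \<Rightarrow> ennreal"
  assumes "\<And>i. i \<in> I \<Longrightarrow> f i \<le> g i"
  shows "(\<Prod>i\<in>I. f i) \<le> (\<Prod>i\<in>I. g i)"
  using assms by (induction I rule: infinite_finite_induct) (auto intro!: mult_mono)

lemma SUP_mult_incseq_ennreal:
  fixes a b :: "nat \<Rightarrow> ennreal"
  assumes "incseq a" "incseq b"
  shows "(SUP n. a n) * (SUP n. b n) = (SUP n. a n * b n)"
proof (rule antisym)
  have "(SUP n. a n) * (SUP n. b n) = (SUP i. SUP j. a i * b j)"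
    by (simp add: SUP_mult_left_ennreal SUP_mult_right_ennreal) (rule SUP_commute)
  also have "\<dots> \<le> (SUP n. a n * b n)"
  proof (intro SUP_least)
    fix i j
    have "a i * b j \<le> a (max i j) * b (max i j)"
      using assms by (intro mult_mono) (auto simp: incseq_def)
    also have "\<dots> \<le> (SUP n. a n * b n)" by (rule SUP_upper) simp
    finally show "a i * b j \<le> (SUP n. a n * b n)" .
  qed
  finally show "(SUP n. a n) * (SUP n. b n) \<le> (SUP n. a n * b n)" .
  show "(SUP n. a n * b n) \<le> (SUP n. a n) * (SUP n. b n)"
    by (intro SUP_least mult_mono SUP_upper) auto
qed

text \<open>All factors share one radius; monotonicity is what lets left continuity pass from the
  factors to their product.\<close>

lemma SUP_prod_incseq_ennreal:
  fixes a :: "'i \<Rightarrow> nat \<Rightarrow> ennreal"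
  assumes "finite I" "\<And>i. i \<in> I \<Longrightarrow> incseq (a i)"
  shows "(\<Prod>i\<in>I. SUP n. a i n) = (SUP n. \<Prod>i\<in>I. a i n)"
  using assms
proof (induction I rule: finite_induct)
  case (insert j I)
  have "incseq (\<lambda>n. \<Prod>i\<in>I. a i n)"
    using insert by (intro monoI prod_mono_ennreal) (auto simp: incseq_def)
  then show ?case using insert by (simp add: SUP_mult_incseq_ennreal)
qed simp

text \<open>Left continuity in the radius reduces the supremum to rational radii.\<close>

lemma borel_measurable_SUP_radius:
  fixes \<Phi> :: "'a::euclidean_space \<Rightarrow> real \<Rightarrow> ennreal" and k :: "real \<Rightarrow> ennreal"
  assumes meas: "\<And>t. 0 < t \<Longrightarrow> (\<lambda>x. \<Phi> x t) \<in> borel_measurable M"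
    and mono: "\<And>x t t'. 0 < t \<Longrightarrow> t \<le> t' \<Longrightarrow> \<Phi> x t \<le> \<Phi> x t'"
    and left: "\<And>x t. 0 < t \<Longrightarrow> \<Phi> x t = (SUP n. \<Phi> x (t - t / (real n + 2)))"
    and k: "\<And>t t'. 0 < t \<Longrightarrow> t \<le> t' \<Longrightarrow> k t' \<le> k t"
  shows "(\<lambda>x. SUP t\<in>{0<..}. k t * \<Phi> x t) \<in> borel_measurable M"
proof -
  define Q where "Q = {t::real. t \<in> \<rat> \<and> 0 < t}"
  have "(SUP t\<in>{0<..}. k t * \<Phi> x t) = (SUP t\<in>Q. k t * \<Phi> x t)" for x
  proof (rule antisym)
    show "(SUP t\<in>{0<..}. k t * \<Phi> x t) \<le> (SUP t\<in>Q. k t * \<Phi> x t)"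
    proof (rule SUP_least)
      fix t :: real assume "t \<in> {0<..}"
      then have t: "0 < t" by simp
      have "k t * \<Phi> x t = (SUP n. k t * \<Phi> x (t - t / (real n + 2)))"
        by (subst left[OF t]) (simp add: SUP_mult_left_ennreal)
      also have "\<dots> \<le> (SUP t\<in>Q. k t * \<Phi> x t)"
      proof (rule SUP_least)
        fix n
        \<comment> \<open>The offset 2 keeps every approximating radius at least t/2, hence
          positive, already for n = 0.\<close>
        have lt: "0 < t - t / (real n + 2)" "t - t / (real n + 2) < t" 
        proof -
          have "t / (real n + 2) \<le> t / 2" using t by (intro divide_left_mono) auto
          moreover have "0 < t / (real n + 2)" using t by simp
          ultimately show "0 < t - t / (real n + 2)" "t - t / (real n + 2) < t" using t by linarith+
        qed
        then obtain u where u: "u \<in> \<rat>" "t - t / (real n + 2) < u" "u < t" using Rats_dense_in_real by blast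
        have "k t * \<Phi> x (t - t / (real n + 2)) \<le> k u * \<Phi> x u"
          using lt u by (intro mult_mono k mono) auto
        also have "\<dots> \<le> (SUP t\<in>Q. k t * \<Phi> x t)" using u lt by (intro SUP_upper) (auto simp: Q_def)
        finally show "k t * \<Phi> x (t - t / (real n + 2)) \<le> (SUP t\<in>Q. k t * \<Phi> x t)" .
      qed
      finally show "k t * \<Phi> x t \<le> (SUP t\<in>Q. k t * \<Phi> x t)" .
    qed
    show "(SUP t\<in>Q. k t * \<Phi> x t) \<le> (SUP t\<in>{0<..}. k t * \<Phi> x t)"
      by (rule SUP_subset_mono) (auto simp: Q_def)
  qed
  moreover have "countable Q"
    unfolding Q_def by (rule countable_subset[OF _ countable_rat]) auto
  then have "(\<lambda>x. SUP t\<in>Q. k t * \<Phi> x t) \<in> borel_measurable M"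
    using meas by (intro borel_measurable_SUP borel_measurable_times_ennreal) (auto simp: Q_def)
  ultimately show ?thesis by simp
qed

lemma SUP_ball_integral:
  fixes h :: "'a::euclidean_space \<Rightarrow> ennreal"
  assumes [measurable]: "h \<in> borel_measurable lebesgue" and t: "0 < t"
  shows "incseq (\<lambda>n. \<integral>\<^sup>+ y \<in> ball x (t - t / (real n + 2)). h y \<partial>lebesgue)"
    "(\<integral>\<^sup>+ y \<in> ball x t. h y \<partial>lebesgue) = (SUP n. \<integral>\<^sup>+ y \<in> ball x (t - t / (real n + 2)). h y \<partial>lebesgue)"
proof -
  have mono: "t - t / (real n + 2) \<le> t - t / (real k + 2)" if "n \<le> k" for n k
    using t that by (intro diff_left_mono divide_left_mono) auto
  then have inc: "incseq (\<lambda>n y. h y * indicator (ball x (t - t / (real n + 2))) y)"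
    by (intro monoI le_funI) (force simp: indicator_def)
  show "incseq (\<lambda>n. \<integral>\<^sup>+ y \<in> ball x (t - t / (real n + 2)). h y \<partial>lebesgue)"
    using inc by (intro monoI nn_integral_mono) (auto simp: incseq_def le_fun_def)
  have "(SUP n. h y * indicator (ball x (t - t / (real n + 2))) y) = h y * indicator (ball x t) y" for y
  proof (rule antisym)
    show "(SUP n. h y * indicator (ball x (t - t / (real n + 2))) y) \<le> h y * indicator (ball x t) y"
    proof (rule SUP_least)
      fix n
      have "t - t / (real n + 2) \<le> t" using t by simp
      then show "h y * indicator (ball x (t - t / (real n + 2))) y \<le> h y * indicator (ball x t) y"
        by (auto simp: indicator_def)
    qed
    show "h y * indicator (ball x t) y \<le> (SUP n. h y * indicator (ball x (t - t / (real n + 2))) y)"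
    proof (cases "y \<in> ball x t")
      case True
      then have d: "0 < t - dist x y" by simp
      obtain n where n: "t / (t - dist x y) < real n" using reals_Archimedean2 by blast
      then have "t < real n * (t - dist x y)" using d by (simp add: field_simps)
      also have "\<dots> \<le> (real n + 2) * (t - dist x y)" using d by (intro mult_right_mono) auto
      finally have "t / (real n + 2) < t - dist x y" by (simp add: field_simps)
      then have "y \<in> ball x (t - t / (real n + 2))" by simp
      then have "h y * indicator (ball x t) y = h y * indicator (ball x (t - t / (real n + 2))) y" using True by simp
      also have "\<dots> \<le> (SUP n. h y * indicator (ball x (t - t / (real n + 2))) y)" by (rule SUP_upper) simp
      finally show ?thesis .
    qed simp
  qed
  then have "(\<integral>\<^sup>+ y \<in> ball x t. h y \<partial>lebesgue) = (\<integral>\<^sup>+ y. (SUP n. h y * indicator (ball x (t - t / (real n + 2))) y) \<partial>lebesgue)"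
    by simp
  also have "\<dots> = (SUP n. \<integral>\<^sup>+ y \<in> ball x (t - t / (real n + 2)). h y \<partial>lebesgue)"
    by (intro nn_integral_monotone_convergence_SUP inc) measurable
  finally show "(\<integral>\<^sup>+ y \<in> ball x t. h y \<partial>lebesgue) = (SUP n. \<integral>\<^sup>+ y \<in> ball x (t - t / (real n + 2)). h y \<partial>lebesgue)" .
qed

text \<open>The variable x occurs in the integrand and in the domain. The domain is rewritten as the
  indicator of {dist < t}, a measurable subset of the product, so that measurability of parameter
  integrals applies.\<close>

lemma borel_measurable_ball_integral:
  fixes H :: "'a::euclidean_space \<Rightarrow> 'a \<Rightarrow> ennreal"
  assumes [measurable]: "case_prod H \<in> borel_measurable (lebesgue \<Otimes>\<^sub>M lebesgue)"
  shows "(\<lambda>x. \<integral>\<^sup>+ y \<in> ball x t. H x y \<partial>lebesgue) \<in> borel_measurable lebesgue"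
proof -
  interpret sigma_finite_measure "lebesgue :: 'a measure" by (rule sigma_finite_lebesgue)
  have id: "(\<lambda>x. x) \<in> lebesgue \<rightarrow>\<^sub>M (borel :: 'a measure)" by (intro measurable_completion) simp
  have [measurable]: "fst \<in> (lebesgue \<Otimes>\<^sub>M lebesgue) \<rightarrow>\<^sub>M (borel :: 'a measure)" "snd \<in> (lebesgue \<Otimes>\<^sub>M lebesgue) \<rightarrow>\<^sub>M (borel :: 'a measure)"
    using measurable_compose[OF measurable_fst id] measurable_compose[OF measurable_snd id] by auto
  have "{z \<in> space (lebesgue \<Otimes>\<^sub>M lebesgue). dist (fst z) (snd z :: 'a) < t} \<in> sets (lebesgue \<Otimes>\<^sub>M lebesgue)"
    by measurable
  then have [measurable]: "{z :: 'a \<times> 'a. dist (fst z) (snd z) < t} \<in> sets (lebesgue \<Otimes>\<^sub>M lebesgue)"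
    by (simp add: space_pair_measure)
  have "(\<lambda>(x, y). H x y * indicator {z. dist (fst z) (snd z) < t} (x, y)) \<in> borel_measurable (lebesgue \<Otimes>\<^sub>M lebesgue)"
    by measurable
  then have "(\<lambda>x. \<integral>\<^sup>+ y. H x y * indicator {z. dist (fst z) (snd z) < t} (x, y) \<partial>lebesgue) \<in> borel_measurable lebesgue"
    by (rule borel_measurable_nn_integral)
  moreover have "indicator {z. dist (fst z) (snd z) < t} (x, y) = (indicator (ball x t) y :: ennreal)" for x y :: 'a
    by (simp add: indicator_def)
  ultimately show ?thesis by simp
qed

lemma measure_ball_powr_antimono:
  fixes x y :: "'a::euclidean_space"
  assumes "0 \<le> s" "0 < t" "t \<le> t'"
  shows "ennreal (measure lebesgue (ball x t') powr (- s)) \<le> ennreal (measure lebesgue (ball y t) powr (- s))"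
proof (intro ennreal_leI powr_mono2')
  show "0 < measure lebesgue (ball y t)" using assms by (simp add: content_ball_pos)
  show "measure lebesgue (ball y t) \<le> measure lebesgue (ball x t')"
    using assms by (auto simp: content_ball intro!: mult_left_mono power_mono)
qed (use assms in simp)

text \<open>The volume of a ball depends on its radius only; replacing the centre by 0 makes the
  factor in front independent of x. A one-element index set covers the linear operators.\<close>

lemma borel_measurable_frac_max:
  fixes H :: "'i \<Rightarrow> 'a::euclidean_space \<Rightarrow> 'a \<Rightarrow> ennreal"
  assumes H: "\<And>i. i \<in> I \<Longrightarrow> case_prod (H i) \<in> borel_measurable (lebesgue \<Otimes>\<^sub>M lebesgue)" and I: "finite I"
    and Hx: "\<And>i x. i \<in> I \<Longrightarrow> H i x \<in> borel_measurable lebesgue" and s: "0 \<le> s"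
  shows "(\<lambda>x. SUP t\<in>{0<..}. ennreal (measure lebesgue (ball x t) powr (- s)) * (\<Prod>i\<in>I. \<integral>\<^sup>+ y \<in> ball x t. H i x y \<partial>lebesgue)) \<in> borel_measurable lebesgue"
proof -
  have "(\<lambda>x. SUP t\<in>{0<..}. ennreal (measure lebesgue (ball (0::'a) t) powr (- s)) * (\<Prod>i\<in>I. \<integral>\<^sup>+ y \<in> ball x t. H i x y \<partial>lebesgue)) \<in> borel_measurable lebesgue"
  proof (rule borel_measurable_SUP_radius)
    show "(\<lambda>x. \<Prod>i\<in>I. \<integral>\<^sup>+ y \<in> ball x t. H i x y \<partial>lebesgue) \<in> borel_measurable lebesgue" if "0 < t" for t
      using H by (intro borel_measurable_prod_ennreal borel_measurable_ball_integral)
    show "(\<Prod>i\<in>I. \<integral>\<^sup>+ y \<in> ball x t. H i x y \<partial>lebesgue) \<le> (\<Prod>i\<in>I. \<integral>\<^sup>+ y \<in> ball x t'. H i x y \<partial>lebesgue)" if "0 < t" "t \<le> t'" for x t t'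
      using that by (intro prod_mono_ennreal nn_integral_mono) (auto simp: indicator_def)
    show "(\<Prod>i\<in>I. \<integral>\<^sup>+ y \<in> ball x t. H i x y \<partial>lebesgue) = (SUP n. \<Prod>i\<in>I. \<integral>\<^sup>+ y \<in> ball x (t - t / (real n + 2)). H i x y \<partial>lebesgue)" if "0 < t" for x t
      using SUP_ball_integral[OF Hx that] by (subst SUP_prod_incseq_ennreal[symmetric, OF I]) (auto intro!: prod.cong)
    show "ennreal (measure lebesgue (ball (0::'a) t') powr (- s)) \<le> ennreal (measure lebesgue (ball (0::'a) t) powr (- s))" if "0 < t" "t \<le> t'" for t t'
      using measure_ball_powr_antimono[OF s that] .
  qed
  moreover have "(\<lambda>x. SUP t\<in>{0<..}. ennreal (measure lebesgue (ball x t) powr (- s)) * (\<Prod>i\<in>I. \<integral>\<^sup>+ y \<in> ball x t. H i x y \<partial>lebesgue))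
      = (\<lambda>x. SUP t\<in>{0<..}. ennreal (measure lebesgue (ball (0::'a) t) powr (- s)) * (\<Prod>i\<in>I. \<integral>\<^sup>+ y \<in> ball x t. H i x y \<partial>lebesgue))"
    by (intro ext SUP_cong refl) (simp add: content_ball)
  ultimately show ?thesis by (simp only:)
qed

text \<open>The factor exp(d b) in front of a conjugated maximal function is moved into the weight:
  w becomes w exp(d q b) and v becomes v exp(-d p' b). On the right-hand side the same perturbation
  cancels, and the unperturbed norm of f reappears.\<close>

theorem commutator_maximal_bound:
  fixes p q s \<theta> K :: real
  assumes p: "1 < p" "p < q" and s: "s = 1 / q + 1 - 1 / p" and th: "\<theta> = 1 / (q * s)"
  shows "\<exists>C>0. \<forall>(\<omega> :: 'a::euclidean_space \<Rightarrow> real) b \<beta> f. \<omega> \<in> borel_measurable lebesgue \<longrightarrow> (\<forall>y. 0 \<le> \<omega> y) \<longrightarrow>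
     muckenhoupt \<theta> K (\<lambda>y. \<omega> y powr q) (\<lambda>y. \<omega> y powr (- (p / (p - 1)))) \<longrightarrow> in_BMO b \<longrightarrow> 0 < \<beta> \<longrightarrow> bmo_norm b \<le> ennreal \<beta> \<longrightarrow>
     f \<in> borel_measurable lebesgue \<longrightarrow>
     (\<integral>\<^sup>+ x. enn_powr (comm_max s b f x) q * ennreal (\<omega> x powr q) \<partial>lebesgue)
     \<le> ennreal (C * \<beta> powr q) * enn_powr (\<integral>\<^sup>+ y. enn_powr (ennreal \<bar>f y\<bar>) p * ennreal (\<omega> y powr p) \<partial>lebesgue) (q / p)"
proof -
  note ex = exponent_relations[OF p s th]
  define p' where "p' = p / (p - 1)"
  have p': "1 < p'" "p' * (p - 1) = p" using p by (auto simp: p'_def)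
  obtain c1 C1 where c1: "0 < c1" "0 < C1" and jn1: "\<forall>(w :: 'a \<Rightarrow> real) v b \<beta>. muckenhoupt \<theta> K w v \<longrightarrow> in_BMO b \<longrightarrow> 0 < \<beta> \<longrightarrow> bmo_norm b \<le> ennreal \<beta> \<longrightarrow>
     (\<forall>x. \<forall>r>0. (\<integral>\<^sup>+ y \<in> ball x r. ennreal (exp (c1 / \<beta> * \<bar>b y - ball_avg b x r\<bar>)) * ennreal (w y) \<partial>lebesgue)
        \<le> ennreal C1 * wmeas w (ball x r))"
    using John_Nirenberg_scaled[of \<theta> K, where 'a='a] by (elim exE conjE) (rule that)
  obtain c2 C2 where c2: "0 < c2" "0 < C2" and jn2: "\<forall>(w :: 'a \<Rightarrow> real) v b \<beta>. muckenhoupt (1 - \<theta>) K w v \<longrightarrow> in_BMO b \<longrightarrow> 0 < \<beta> \<longrightarrow> bmo_norm b \<le> ennreal \<beta> \<longrightarrow>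
     (\<forall>x. \<forall>r>0. (\<integral>\<^sup>+ y \<in> ball x r. ennreal (exp (c2 / \<beta> * \<bar>b y - ball_avg b x r\<bar>)) * ennreal (w y) \<partial>lebesgue)
        \<le> ennreal C2 * wmeas w (ball x r))"
    using John_Nirenberg_scaled[of "1 - \<theta>" K, where 'a='a] by (elim exE conjE) (rule that)
  define K' where "K' = C1 powr \<theta> * C2 powr (1 - \<theta>) * K"
  obtain C3 where C3: "0 < C3" and fm: "\<forall>(w :: 'a \<Rightarrow> real) v g. muckenhoupt \<theta> K' w v \<longrightarrow> g \<in> borel_measurable lebesgue \<longrightarrow>
     (\<integral>\<^sup>+ x. enn_powr (SUP t\<in>{0<..}. ennreal (measure lebesgue (ball x t) powr (- s)) * (\<integral>\<^sup>+ y \<in> ball x t. g y * ennreal (v y) \<partial>lebesgue)) q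
        * ennreal (w x) \<partial>lebesgue)
     \<le> ennreal C3 * enn_powr (\<integral>\<^sup>+ y. enn_powr (g y) p * ennreal (v y) \<partial>lebesgue) (q / p)"
    using fractional_maximal_bound[OF p s th, of K', where 'a='a] by (elim exE conjE) (rule that)
  \<comment> \<open>Small enough for both perturbations, with exponents e q / \<beta> on w and e p'
    / \<beta> on v, to stay within the exponential integrability of b.\<close>
  define e where "e = min (c1 / q) (c2 / p')"
  have e: "0 < e" "e * q \<le> c1" "e * p' \<le> c2"
    using c1 c2 p p' by (auto simp: e_def min_def field_simps)
  \<comment> \<open>(1/e)^q comes from the prefactor \<beta>/e of the conjugation inequality, 2^q
    from the power of a sum, and 2 * C3 from the two signs of the exponent.\<close>
  define C where "C = (1 / e) powr q * (2 powr q * (2 * C3))"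
  have C: "0 < C" using e C3 by (simp add: C_def)
  show ?thesis
  proof (intro exI[of _ C] conjI C allI impI)
    fix \<omega> b f :: "'a \<Rightarrow> real" and \<beta> :: real
    assume om [measurable]: "\<omega> \<in> borel_measurable lebesgue" and om0: "\<forall>y. 0 \<le> \<omega> y"
      and mu0: "muckenhoupt \<theta> K (\<lambda>y. \<omega> y powr q) (\<lambda>y. \<omega> y powr (- (p / (p - 1))))"
      and b: "in_BMO b" and \<beta>: "0 < \<beta>" "bmo_norm b \<le> ennreal \<beta>" and f [measurable]: "f \<in> borel_measurable lebesgue"
    have [measurable]: "b \<in> borel_measurable lebesgue" using b by (simp add: in_BMO_def)
    define w where "w y = \<omega> y powr q" for y
    define v where "v y = \<omega> y powr (- p')" for y
    have mu: "muckenhoupt \<theta> K w v" using mu0 by (simp add: w_def[abs_def] v_def[abs_def] p'_def)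
    interpret W: muckenhoupt \<theta> K w v by (rule mu)
    have om_pos: "AE y in lebesgue. 0 < \<omega> y"
      using W.ae_pos by eventually_elim (use om0 in \<open>force simp: w_def less_le\<close>)
    define N where "N = (\<integral>\<^sup>+ y. enn_powr (ennreal \<bar>f y\<bar>) p * ennreal (\<omega> y powr p) \<partial>lebesgue)"
    define T where "T e x = (SUP t\<in>{0<..}. ennreal (measure lebesgue (ball x t) powr (- s)) * (\<integral>\<^sup>+ y \<in> ball x t. ennreal (\<bar>f y\<bar> * exp (- e * b y)) \<partial>lebesgue))" for e and x :: 'a
    have T_bound: "(\<integral>\<^sup>+ x. enn_powr (ennreal (exp (d * b x)) * T d x) q * ennreal (w x) \<partial>lebesgue) \<le> ennreal C3 * enn_powr N (q / p)"
      if d: "\<bar>d\<bar> = e / \<beta>" for d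
    proof -
      define w' where "w' y = w y * exp (d * q * b y)" for y
      define v' where "v' y = v y * exp (- (d * p') * b y)" for y
      have mu': "muckenhoupt \<theta> K' w' v'"
        unfolding K'_def w'_def[abs_def] v'_def[abs_def]
      proof (rule muckenhoupt_exp_perturb[OF mu _ c1(2) c2(2), where c = "c1 / \<beta>" and c' = "c2 / \<beta>"])
        show "q * \<theta> = p' * (1 - \<theta>)" using ex by (simp add: p'_def)
        show "\<bar>d * q\<bar> \<le> c1 / \<beta>" using d e \<beta> p by (simp add: abs_mult divide_right_mono)
        show "\<bar>d * p'\<bar> \<le> c2 / \<beta>" using d e \<beta> p' by (simp add: abs_mult divide_right_mono)
      qed (use jn1[rule_format, OF mu b \<beta>] jn2[rule_format, OF muckenhoupt_swap[OF mu] b \<beta>] in auto)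
      interpret W': muckenhoupt \<theta> K' w' v' by (rule mu')
      \<comment> \<open>Division by v' fits the form g v' in which the fractional estimate is
        stated. Since p' (p - 1) = p, one gets g^p v' = \<bar>f\<bar>^p \<omega>^p, with no trace of
        b.\<close>
      define g where "g y = ennreal (\<bar>f y\<bar> * exp (- d * b y) / v' y)" for y
      have [measurable]: "g \<in> borel_measurable lebesgue" unfolding g_def by measurable
      have gv: "AE y in lebesgue. g y * ennreal (v' y) = ennreal (\<bar>f y\<bar> * exp (- d * b y))"
        using W'.ae_pos by eventually_elim (auto simp: g_def ennreal_mult[symmetric])
      have gp: "AE y in lebesgue. enn_powr (g y) p * ennreal (v' y) = enn_powr (ennreal \<bar>f y\<bar>) p * ennreal (\<omega> y powr p)"
        using W'.ae_pos om_pos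
      proof eventually_elim
        case (elim y)
        have "v' y powr (1 - p) = \<omega> y powr p * exp (d * p * b y)"
        proof -
          have "v' y powr (1 - p) = (\<omega> y powr (- p')) powr (1 - p) * exp (- (d * p') * b y) powr (1 - p)"
            unfolding v'_def v_def by (simp add: powr_mult)
          also have "(\<omega> y powr (- p')) powr (1 - p) = \<omega> y powr p"
            using p' by (simp add: powr_powr algebra_simps)
          also have "exp (- (d * p') * b y) powr (1 - p) = exp (d * (p' * (p - 1)) * b y)"
            by (simp add: powr_def algebra_simps)
          finally show ?thesis unfolding p' .
        qed
        moreover have "(\<bar>f y\<bar> * exp (- d * b y) / v' y) powr p * v' y = \<bar>f y\<bar> powr p * (exp (- d * b y) powr p * v' y powr (1 - p))"
        proof -
          have "v' y powr (1 - p) = v' y / v' y powr p" using elim by (simp add: powr_diff)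
          then show ?thesis using elim by (simp add: powr_mult powr_divide)
        qed
        moreover have "exp (- d * b y) powr p * exp (d * p * b y) = 1"
          by (simp add: powr_def exp_add[symmetric] algebra_simps)
        ultimately have "(\<bar>f y\<bar> * exp (- d * b y) / v' y) powr p * v' y = \<bar>f y\<bar> powr p * \<omega> y powr p"
          by (simp only: mult.left_commute[of _ "\<omega> y powr p"] mult_1_right)
        then show ?case
          using elim unfolding g_def by (simp add: enn_powr_ennreal ennreal_mult[symmetric] del: mult_minus_left)
      qed
      have T_eq: "T d x = (SUP t\<in>{0<..}. ennreal (measure lebesgue (ball x t) powr (- s)) * (\<integral>\<^sup>+ y \<in> ball x t. g y * ennreal (v' y) \<partial>lebesgue))" for x
        unfolding T_def
      proof (intro SUP_cong refl arg_cong2[of _ _ _ _ "(*)"] nn_integral_cong_AE)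
        fix t
        show "AE y in lebesgue. ennreal (\<bar>f y\<bar> * exp (- d * b y)) * indicator (ball x t) y = g y * ennreal (v' y) * indicator (ball x t) y"
          using gv by eventually_elim simp
      qed
      have "(\<integral>\<^sup>+ x. enn_powr (ennreal (exp (d * b x)) * T d x) q * ennreal (w x) \<partial>lebesgue)
          = (\<integral>\<^sup>+ x. enn_powr (T d x) q * ennreal (w' x) \<partial>lebesgue)"
      proof (rule nn_integral_cong)
        fix x
        have "exp (d * b x) powr q * w x = w' x" by (simp add: w'_def powr_def ac_simps)
        then have "ennreal (exp (d * b x) powr q) * ennreal (w x) = ennreal (w' x)"
          using W.w_nonneg[of x] by (simp add: ennreal_mult[symmetric])
        moreover have "enn_powr (ennreal (exp (d * b x)) * T d x) q * ennreal (w x) = enn_powr (T d x) q * (ennreal (exp (d * b x) powr q) * ennreal (w x))"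
          by (simp add: enn_powr_mult enn_powr_ennreal ac_simps)
        ultimately show "enn_powr (ennreal (exp (d * b x)) * T d x) q * ennreal (w x) = enn_powr (T d x) q * ennreal (w' x)"
          by (simp only:)
      qed
      also have "\<dots> \<le> ennreal C3 * enn_powr (\<integral>\<^sup>+ y. enn_powr (g y) p * ennreal (v' y) \<partial>lebesgue) (q / p)"
        unfolding T_eq using fm mu' by auto
      also have "(\<integral>\<^sup>+ y. enn_powr (g y) p * ennreal (v' y) \<partial>lebesgue) = N"
        unfolding N_def using gp by (rule nn_integral_cong_AE)
      finally show ?thesis .
    qed
    define \<epsilon> where "\<epsilon> = e / \<beta>"
    have eps: "0 < \<epsilon>" using e \<beta> by (simp add: \<epsilon>_def)
    define P where "P d x = enn_powr (ennreal (exp (d * b x)) * T d x) q * ennreal (w x)" for d x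
    show "(\<integral>\<^sup>+ x. enn_powr (comm_max s b f x) q * ennreal (\<omega> x powr q) \<partial>lebesgue)
     \<le> ennreal (C * \<beta> powr q) * enn_powr (\<integral>\<^sup>+ y. enn_powr (ennreal \<bar>f y\<bar>) p * ennreal (\<omega> y powr p) \<partial>lebesgue) (q / p)"
    proof -
      have Tm [measurable]: "T d \<in> borel_measurable lebesgue" for d
        using borel_measurable_frac_max[of "{()}" "\<lambda>_ x y. ennreal (\<bar>f y\<bar> * exp (- d * b y))" s] ex(1)
        unfolding T_def[abs_def] by simp
      have "(\<integral>\<^sup>+ x. enn_powr (comm_max s b f x) q * ennreal (\<omega> x powr q) \<partial>lebesgue)
          \<le> (\<integral>\<^sup>+ x. ennreal ((1 / \<epsilon>) powr q * 2 powr q) * (P \<epsilon> x + P (- \<epsilon>) x) \<partial>lebesgue)"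
      proof (rule nn_integral_mono)
        fix x
        have "enn_powr (comm_max s b f x) q \<le> enn_powr (ennreal (1 / \<epsilon>) * (ennreal (exp (\<epsilon> * b x)) * T \<epsilon> x + ennreal (exp (- \<epsilon> * b x)) * T (- \<epsilon>) x)) q"
          unfolding T_def using p by (intro enn_powr_mono comm_max_le_conjugated eps) auto
        also have "\<dots> \<le> ennreal ((1 / \<epsilon>) powr q) * (ennreal (2 powr q) *
             (enn_powr (ennreal (exp (\<epsilon> * b x)) * T \<epsilon> x) q + enn_powr (ennreal (exp (- \<epsilon> * b x)) * T (- \<epsilon>) x) q))"
          unfolding enn_powr_mult[of "ennreal (1 / \<epsilon>)"] using p eps
          by (subst enn_powr_ennreal) (auto intro!: mult_left_mono enn_powr_add_le)
        finally have "enn_powr (comm_max s b f x) q * ennreal (w x) \<le> ennreal ((1 / \<epsilon>) powr q) * (ennreal (2 powr q) *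
             (enn_powr (ennreal (exp (\<epsilon> * b x)) * T \<epsilon> x) q + enn_powr (ennreal (exp (- \<epsilon> * b x)) * T (- \<epsilon>) x) q)) * ennreal (w x)"
          by (rule mult_right_mono) simp
        also have "\<dots> = ennreal ((1 / \<epsilon>) powr q * 2 powr q) * (P \<epsilon> x + P (- \<epsilon>) x)"
          unfolding P_def by (simp add: ennreal_mult distrib_right distrib_left mult.assoc)
        finally show "enn_powr (comm_max s b f x) q * ennreal (\<omega> x powr q) \<le> ennreal ((1 / \<epsilon>) powr q * 2 powr q) * (P \<epsilon> x + P (- \<epsilon>) x)"
          by (simp add: w_def)
      qed
      also have "\<dots> = ennreal ((1 / \<epsilon>) powr q * 2 powr q) * ((\<integral>\<^sup>+ x. P \<epsilon> x \<partial>lebesgue) + (\<integral>\<^sup>+ x. P (- \<epsilon>) x \<partial>lebesgue))"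
        unfolding P_def by (subst nn_integral_cmult) (auto simp: nn_integral_add)
      also have "\<dots> \<le> ennreal ((1 / \<epsilon>) powr q * 2 powr q) * (ennreal C3 * enn_powr N (q / p) + ennreal C3 * enn_powr N (q / p))"
        unfolding P_def using e \<beta> by (intro mult_left_mono add_mono T_bound) (auto simp: \<epsilon>_def)
      also have "\<dots> = ennreal ((1 / \<epsilon>) powr q * 2 powr q) * (ennreal (2 * C3) * enn_powr N (q / p))"
        using C3 by (simp add: distrib_right[symmetric] ennreal_plus[symmetric] del: ennreal_plus)
      also have "\<dots> = ennreal ((1 / \<epsilon>) powr q * 2 powr q * (2 * C3)) * enn_powr N (q / p)"
        using C3 by (simp add: ennreal_mult mult.assoc)
      also have "(1 / \<epsilon>) powr q * 2 powr q * (2 * C3) = C * \<beta> powr q"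
      proof -
        have "(1 / \<epsilon>) powr q = (1 / e) powr q * \<beta> powr q"
          using e \<beta> by (simp add: \<epsilon>_def powr_mult[symmetric])
        then show ?thesis by (simp add: C_def)
      qed
      finally show ?thesis unfolding N_def .
    qed
  qed
qed

section \<open>Averages over large radii\<close>

lemma weighted_Holder_dual:
  fixes \<omega> f G :: "'a::euclidean_space \<Rightarrow> real"
  assumes [measurable]: "\<omega> \<in> borel_measurable lebesgue" "f \<in> borel_measurable lebesgue" "G \<in> borel_measurable lebesgue" "E \<in> sets lebesgue"
    and om: "AE y in lebesgue. 0 < \<omega> y" and G: "\<And>y. 0 \<le> G y" and p: "1 < p"
  shows "(\<integral>\<^sup>+ y \<in> E. ennreal (G y * \<bar>f y\<bar>) \<partial>lebesgue)
     \<le> enn_powr (\<integral>\<^sup>+ y \<in> E. enn_powr (ennreal \<bar>f y\<bar>) p * ennreal (\<omega> y powr p) \<partial>lebesgue) (1 / p)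
       * enn_powr (\<integral>\<^sup>+ y \<in> E. ennreal (G y powr (p / (p - 1))) * ennreal (\<omega> y powr (- (p / (p - 1)))) \<partial>lebesgue) (1 - 1 / p)"
proof -
  define p' where "p' = p / (p - 1)"
  have p': "p' * (1 - 1 / p) = 1" using p by (simp add: p'_def field_simps)
  have "(\<integral>\<^sup>+ y \<in> E. ennreal (G y * \<bar>f y\<bar>) \<partial>lebesgue)
      = (\<integral>\<^sup>+ y. enn_powr (enn_powr (ennreal \<bar>f y\<bar>) p * ennreal (\<omega> y powr p) * indicator E y) (1 / p)
          * enn_powr (ennreal (G y powr p') * ennreal (\<omega> y powr (- p')) * indicator E y) (1 - 1 / p) \<partial>lebesgue)"
  proof (rule nn_integral_cong_AE)
    show "AE y in lebesgue. ennreal (G y * \<bar>f y\<bar>) * indicator E y = enn_powr (enn_powr (ennreal \<bar>f y\<bar>) p * ennreal (\<omega> y powr p) * indicator E y) (1 / p)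
          * enn_powr (ennreal (G y powr p') * ennreal (\<omega> y powr (- p')) * indicator E y) (1 - 1 / p)"
      using om
    proof eventually_elim
      case (elim y)
      have a: "enn_powr (enn_powr (ennreal \<bar>f y\<bar>) p * ennreal (\<omega> y powr p)) (1 / p) = ennreal (\<bar>f y\<bar> * \<omega> y)"
        using elim p by (simp add: enn_powr_mult enn_powr_cancel enn_powr_ennreal powr_powr ennreal_mult)
      have "enn_powr (ennreal (G y powr p') * ennreal (\<omega> y powr (- p'))) (1 - 1 / p) = ennreal ((G y powr p') powr (1 - 1 / p)) * ennreal ((\<omega> y powr (- p')) powr (1 - 1 / p))"
        by (simp add: enn_powr_mult enn_powr_ennreal)
      also have "(G y powr p') powr (1 - 1 / p) = G y" using G[of y] p' by (simp add: powr_powr)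
      also have "(\<omega> y powr (- p')) powr (1 - 1 / p) = \<omega> y powr (- (p' * (1 - 1 / p)))" by (simp add: powr_powr)
      also have "\<dots> = 1 / \<omega> y" unfolding p' using elim by (simp add: powr_minus_divide)
      finally have b: "enn_powr (ennreal (G y powr p') * ennreal (\<omega> y powr (- p'))) (1 - 1 / p) = ennreal (G y * (1 / \<omega> y))"
        using G[of y] elim by (simp add: ennreal_mult[symmetric])
      have "ennreal (\<bar>f y\<bar> * \<omega> y) * ennreal (G y * (1 / \<omega> y)) = ennreal (G y * \<bar>f y\<bar>)"
        using G[of y] elim by (simp add: ennreal_mult[symmetric] field_simps)
      then show ?case
        using a b by (cases "y \<in> E") auto
    qed
  qed
  also have "\<dots> \<le> enn_powr (\<integral>\<^sup>+ y \<in> E. enn_powr (ennreal \<bar>f y\<bar>) p * ennreal (\<omega> y powr p) \<partial>lebesgue) (1 / p)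
       * enn_powr (\<integral>\<^sup>+ y \<in> E. ennreal (G y powr p') * ennreal (\<omega> y powr (- p')) \<partial>lebesgue) (1 - 1 / p)"
    by (rule nn_integral_Holder2) (use p in auto)
  finally show ?thesis unfolding p'_def .
qed

text \<open>After Hoelder's inequality against the dual weight, the product of w(B)^(1/q) and
  v(B)^(1-1/p) is at most a constant times |B|^s, which cancels the normalisation of the average.
  Taking means over B = ball x0 (2t) instead of ball x0 r costs the logarithm.\<close>

lemma comm_average_far:
  fixes p q s \<theta> K :: real
  assumes p: "1 < p" "p < q" and s: "s = 1 / q + 1 - 1 / p" and th: "\<theta> = 1 / (q * s)"
  shows "\<exists>C>0. \<forall>(\<omega> :: 'a::euclidean_space \<Rightarrow> real) b \<beta> f. \<omega> \<in> borel_measurable lebesgue \<longrightarrow> (\<forall>y. 0 \<le> \<omega> y) \<longrightarrow>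
     muckenhoupt \<theta> K (\<lambda>y. \<omega> y powr q) (\<lambda>y. \<omega> y powr (- (p / (p - 1)))) \<longrightarrow> in_BMO b \<longrightarrow> 0 < \<beta> \<longrightarrow> bmo_norm b \<le> ennreal \<beta> \<longrightarrow>
     f \<in> borel_measurable lebesgue \<longrightarrow>
     (\<forall>x0 r x t. 0 < r \<longrightarrow> x \<in> ball x0 r \<longrightarrow> r \<le> t \<longrightarrow>
        ennreal (measure lebesgue (ball x t) powr (- s)) * (\<integral>\<^sup>+ y \<in> ball x t. ennreal (\<bar>b x - b y\<bar> * \<bar>f y\<bar>) \<partial>lebesgue)
          * enn_powr (wmeas (\<lambda>y. \<omega> y powr q) (ball x0 (2 * t))) (1 / q)
        \<le> ennreal (C * (1 + ln (2 * t / r)) * (\<bar>b x - ball_avg b x0 r\<bar> + \<beta>))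
          * enn_powr (\<integral>\<^sup>+ y \<in> ball x0 (2 * t). enn_powr (ennreal \<bar>f y\<bar>) p * ennreal (\<omega> y powr p) \<partial>lebesgue) (1 / p))"
proof -
  note ex = exponent_relations[OF p s th]
  define n where "n = DIM('a)"
  define p' where "p' = p / (p - 1)"
  have p': "1 < p'" "p' * (1 - 1 / p) = 1" using p by (auto simp: p'_def field_simps)
  then have p'0: "0 < p'" by simp
  obtain C4 where C4: "0 < C4" and osc: "\<forall>(w :: 'a \<Rightarrow> real) v b \<beta>. muckenhoupt (1 - \<theta>) K w v \<longrightarrow> in_BMO b \<longrightarrow> 0 < \<beta> \<longrightarrow> bmo_norm b \<le> ennreal \<beta> \<longrightarrow>
     (\<forall>x. \<forall>r>0. (\<integral>\<^sup>+ y \<in> ball x r. ennreal ((\<bar>b y - ball_avg b x r\<bar> + \<beta>) powr p') * ennreal (w y) \<partial>lebesgue)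
        \<le> ennreal (C4 * \<beta> powr p') * wmeas w (ball x r))"
    using oscillation_power_bound[OF p'0, of "1 - \<theta>" K, where 'a='a] by (elim exE conjE) (rule that)
  \<comment> \<open>2^n is the ratio of the volumes of the balls of radii 2t and t, 2^(n+1) the
    constant of logarithmic growth. \<open>max K 1\<close> makes positivity evident before a pair of
    weights is given.\<close>
  define C where "C = (2 ^ n) powr s * 2 ^ (n + 1) * C4 powr (1 - 1 / p) * (max K 1) powr s"
  have C: "0 < C" using C4 by (simp add: C_def)
  show ?thesis
  proof (intro exI[of _ C] conjI C allI impI)
    fix \<omega> b f :: "'a \<Rightarrow> real" and \<beta> :: real and x0 x :: 'a and r t :: real
    assume om [measurable]: "\<omega> \<in> borel_measurable lebesgue" and om0: "\<forall>y. 0 \<le> \<omega> y"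
      and mu0: "muckenhoupt \<theta> K (\<lambda>y. \<omega> y powr q) (\<lambda>y. \<omega> y powr (- (p / (p - 1))))"
      and b: "in_BMO b" and \<beta>: "0 < \<beta>" "bmo_norm b \<le> ennreal \<beta>" and f [measurable]: "f \<in> borel_measurable lebesgue"
      and r: "0 < r" and x: "x \<in> ball x0 r" and t: "r \<le> t"
    have [measurable]: "b \<in> borel_measurable lebesgue" using b by (simp add: in_BMO_def)
    define w where "w y = \<omega> y powr q" for y
    define v where "v y = \<omega> y powr (- p')" for y
    have mu: "muckenhoupt \<theta> K w v" using mu0 by (simp add: w_def[abs_def] v_def[abs_def] p'_def)
    interpret W: muckenhoupt \<theta> K w v by (rule mu)
    interpret V: muckenhoupt "1 - \<theta>" K v w by (rule muckenhoupt_swap[OF mu])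
    have om_pos: "AE y in lebesgue. 0 < \<omega> y"
      using W.ae_pos by eventually_elim (use om0 in \<open>force simp: w_def less_le\<close>)
    define \<tau> where "\<tau> = 2 * t"
    have tau: "0 < \<tau>" "r \<le> \<tau>" "0 < t" using r t by (auto simp: \<tau>_def)
    let ?B = "ball x0 \<tau>"
    define M where "M = measure lebesgue ?B"
    have M: "0 < M" "ball_meas x0 \<tau> = ennreal M"
      using tau by (auto simp: M_def ball_meas_conv_measure content_ball_pos)
    define L where "L = 1 + ln (\<tau> / r)"
    have L: "1 \<le> L" using r tau by (simp add: L_def)
    define m where "m = ball_avg b x0 \<tau>"
    \<comment> \<open>Dominates both \<beta> and \<bar>b x - m\<bar>, so that \<bar>b x - b y\<bar>
      <= (A/\<beta>) (\<bar>b y - m\<bar> + \<beta>). As a product it separates the dependence on t,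
      contained in L, from the dependence on x.\<close>
    define A where "A = 2 ^ (n + 1) * L * (\<bar>b x - ball_avg b x0 r\<bar> + \<beta>)"
    have two: "(1::real) \<le> 2 ^ (n + 1) * L"
    proof -
      have "(1::real) * 1 \<le> 2 ^ (n + 1) * L" using L by (intro mult_mono one_le_power) auto
      then show ?thesis by simp
    qed
    have A: "\<beta> \<le> A" "\<bar>b x - ball_avg b x0 r\<bar> + 2 ^ (n + 1) * L * \<beta> \<le> A" "0 < A"
    proof -
      have "1 * (\<bar>b x - ball_avg b x0 r\<bar> + \<beta>) \<le> A" unfolding A_def using two \<beta>(1) by (intro mult_right_mono) auto
      then show "\<beta> \<le> A" using abs_ge_zero[of "b x - ball_avg b x0 r"] by simp
      then show "0 < A" using \<beta>(1) by linarith
      have "1 * \<bar>b x - ball_avg b x0 r\<bar> \<le> 2 ^ (n + 1) * L * \<bar>b x - ball_avg b x0 r\<bar>" using two by (intro mult_right_mono) auto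
      then show "\<bar>b x - ball_avg b x0 r\<bar> + 2 ^ (n + 1) * L * \<beta> \<le> A" by (simp add: A_def distrib_left)
    qed
    define G where "G y = \<bar>b y - m\<bar> + \<beta>" for y
    have [measurable]: "G \<in> borel_measurable lebesgue" unfolding G_def by measurable
    have G0: "0 \<le> G y" for y using \<beta>(1) by (simp add: G_def)
    have osc_ptw: "\<bar>b x - b y\<bar> \<le> A / \<beta> * G y" for y
    proof -
      have "\<bar>ball_avg b x0 r - m\<bar> \<le> 2 ^ (n + 1) * L * \<beta>"
        using ball_avg_log_growth[OF b \<beta> r tau(2), of x0] by (simp add: m_def L_def n_def ac_simps)
      then have "\<bar>b x - b y\<bar> \<le> A + \<bar>b y - m\<bar>" using A(2) by linarith
      also have "\<dots> \<le> A + A / \<beta> * \<bar>b y - m\<bar>"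
      proof -
        have "1 * \<bar>b y - m\<bar> \<le> A / \<beta> * \<bar>b y - m\<bar>" using A(1) \<beta>(1) by (intro mult_right_mono) auto
        then show ?thesis by simp
      qed
      also have "\<dots> = A / \<beta> * G y" using \<beta>(1) by (simp add: G_def distrib_left)
      finally show ?thesis .
    qed
    have sub: "ball x t \<subseteq> ?B"
    proof
      fix y assume "y \<in> ball x t"
      then show "y \<in> ?B" using x t dist_triangle[of x0 y x] by (simp add: \<tau>_def)
    qed
    define N where "N = enn_powr (\<integral>\<^sup>+ y \<in> ?B. enn_powr (ennreal \<bar>f y\<bar>) p * ennreal (\<omega> y powr p) \<partial>lebesgue) (1 / p)"
    have "(\<integral>\<^sup>+ y \<in> ball x t. ennreal (\<bar>b x - b y\<bar> * \<bar>f y\<bar>) \<partial>lebesgue)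
        \<le> (\<integral>\<^sup>+ y. ennreal (A / \<beta>) * (ennreal (G y * \<bar>f y\<bar>) * indicator ?B y) \<partial>lebesgue)"
    proof (rule nn_integral_mono)
      fix y
      have "\<bar>b x - b y\<bar> * \<bar>f y\<bar> \<le> A / \<beta> * G y * \<bar>f y\<bar>" by (intro mult_right_mono osc_ptw) simp
      then have "ennreal (\<bar>b x - b y\<bar> * \<bar>f y\<bar>) \<le> ennreal (A / \<beta>) * ennreal (G y * \<bar>f y\<bar>)"
        using A(3) \<beta>(1) G0[of y] by (subst ennreal_mult[symmetric]) (auto intro!: ennreal_leI simp: mult.assoc)
      then show "ennreal (\<bar>b x - b y\<bar> * \<bar>f y\<bar>) * indicator (ball x t) y \<le> ennreal (A / \<beta>) * (ennreal (G y * \<bar>f y\<bar>) * indicator ?B y)"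
        using sub by (auto simp: indicator_def)
    qed
    also have "\<dots> = ennreal (A / \<beta>) * (\<integral>\<^sup>+ y \<in> ?B. ennreal (G y * \<bar>f y\<bar>) \<partial>lebesgue)"
      by (intro nn_integral_cmult) measurable
    also have "\<dots> \<le> ennreal (A / \<beta>) * (N * enn_powr (\<integral>\<^sup>+ y \<in> ?B. ennreal (G y powr p') * ennreal (v y) \<partial>lebesgue) (1 - 1 / p))"
      unfolding N_def p'_def v_def by (intro mult_left_mono weighted_Holder_dual om_pos G0 p) auto
    also have "\<dots> \<le> ennreal (A / \<beta>) * (N * enn_powr (ennreal (C4 * \<beta> powr p') * wmeas v ?B) (1 - 1 / p))"
      using osc[rule_format, OF muckenhoupt_swap[OF mu] b \<beta> tau(1), of x0] p
      by (intro mult_left_mono enn_powr_mono) (auto simp: G_def m_def)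
    also have "enn_powr (ennreal (C4 * \<beta> powr p') * wmeas v ?B) (1 - 1 / p) = ennreal (C4 powr (1 - 1 / p) * \<beta>) * enn_powr (wmeas v ?B) (1 - 1 / p)"
      using C4 \<beta>(1) p' by (simp add: enn_powr_mult enn_powr_ennreal powr_mult powr_powr)
    also have "ennreal (A / \<beta>) * (N * (ennreal (C4 powr (1 - 1 / p) * \<beta>) * enn_powr (wmeas v ?B) (1 - 1 / p)))
        = ennreal (A * C4 powr (1 - 1 / p)) * (N * enn_powr (wmeas v ?B) (1 - 1 / p))"
    proof -
      have "ennreal (A / \<beta>) * ennreal (C4 powr (1 - 1 / p) * \<beta>) = ennreal (A * C4 powr (1 - 1 / p))"
        using A(3) \<beta>(1) by (simp add: ennreal_mult[symmetric])
      moreover have "ennreal (A / \<beta>) * (N * (ennreal (C4 powr (1 - 1 / p) * \<beta>) * enn_powr (wmeas v ?B) (1 - 1 / p)))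
          = ennreal (A / \<beta>) * ennreal (C4 powr (1 - 1 / p) * \<beta>) * (N * enn_powr (wmeas v ?B) (1 - 1 / p))"
        by (simp only: ac_simps)
      ultimately show ?thesis by (simp only:)
    qed
    finally have J: "(\<integral>\<^sup>+ y \<in> ball x t. ennreal (\<bar>b x - b y\<bar> * \<bar>f y\<bar>) \<partial>lebesgue)
        \<le> ennreal (A * C4 powr (1 - 1 / p)) * (N * enn_powr (wmeas v ?B) (1 - 1 / p))" .
    have wv: "enn_powr (wmeas w ?B) (1 / q) * enn_powr (wmeas v ?B) (1 - 1 / p) \<le> ennreal ((max K 1) powr s * M powr s)"
    proof -
      have "enn_powr (wmeas w ?B) (1 / q) * enn_powr (wmeas v ?B) (1 - 1 / p)
          = enn_powr (enn_powr (wmeas w ?B) \<theta> * enn_powr (wmeas v ?B) (1 - \<theta>)) s"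
        using ex by (simp add: enn_powr_mult enn_powr_powr mult.commute)
      also have "\<dots> \<le> enn_powr (ennreal K * ball_meas x0 \<tau>) s"
        using ex by (intro enn_powr_mono W.ball_product tau) auto
      also have "\<dots> = ennreal (K powr s * M powr s)"
        using W.K_pos M by (simp add: enn_powr_mult enn_powr_ennreal ennreal_mult)
      also have "\<dots> \<le> ennreal ((max K 1) powr s * M powr s)"
        using W.K_pos ex by (intro ennreal_leI mult_right_mono powr_mono2) auto
      finally show ?thesis .
    qed
    have Mt: "measure lebesgue (ball x t) powr (- s) = (2 ^ n) powr s * M powr (- s)"
    proof -
      have "measure lebesgue (ball x t) = M / 2 ^ n"
        using tau by (simp add: M_def content_ball \<tau>_def n_def power_mult_distrib)
      then show ?thesis using M by (simp add: powr_divide powr_minus_divide)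
    qed
    have "ennreal (measure lebesgue (ball x t) powr (- s)) * (\<integral>\<^sup>+ y \<in> ball x t. ennreal (\<bar>b x - b y\<bar> * \<bar>f y\<bar>) \<partial>lebesgue)
          * enn_powr (wmeas w ?B) (1 / q)
        \<le> ennreal ((2 ^ n) powr s * M powr (- s)) * (ennreal (A * C4 powr (1 - 1 / p)) * (N * enn_powr (wmeas v ?B) (1 - 1 / p)))
          * enn_powr (wmeas w ?B) (1 / q)"
      unfolding Mt by (intro mult_right_mono mult_left_mono J) auto
    also have "\<dots> = ennreal ((2 ^ n) powr s * M powr (- s)) * ennreal (A * C4 powr (1 - 1 / p)) * N
          * (enn_powr (wmeas w ?B) (1 / q) * enn_powr (wmeas v ?B) (1 - 1 / p))"
      by (simp only: ac_simps)
    also have "\<dots> \<le> ennreal ((2 ^ n) powr s * M powr (- s)) * ennreal (A * C4 powr (1 - 1 / p)) * N * ennreal ((max K 1) powr s * M powr s)"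
      by (intro mult_left_mono wv) auto
    also have "\<dots> = ennreal ((2 ^ n) powr s * M powr (- s)) * ennreal (A * C4 powr (1 - 1 / p)) * ennreal ((max K 1) powr s * M powr s) * N"
      by (simp only: ac_simps)
    also have "ennreal ((2 ^ n) powr s * M powr (- s)) * ennreal (A * C4 powr (1 - 1 / p)) * ennreal ((max K 1) powr s * M powr s)
        = ennreal ((2 ^ n) powr s * M powr (- s) * (A * C4 powr (1 - 1 / p)) * ((max K 1) powr s * M powr s))"
      using A(3) by (simp add: ennreal_mult)
    also have "(2 ^ n) powr s * M powr (- s) * (A * C4 powr (1 - 1 / p)) * ((max K 1) powr s * M powr s)
        = C * L * (\<bar>b x - ball_avg b x0 r\<bar> + \<beta>) * (M powr (- s) * M powr s)"
      unfolding A_def C_def by (simp only: ac_simps)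
    also have "M powr (- s) * M powr s = 1" using M by (simp add: powr_add[symmetric])
    finally show "ennreal (measure lebesgue (ball x t) powr (- s)) * (\<integral>\<^sup>+ y \<in> ball x t. ennreal (\<bar>b x - b y\<bar> * \<bar>f y\<bar>) \<partial>lebesgue)
          * enn_powr (wmeas (\<lambda>y. \<omega> y powr q) (ball x0 (2 * t))) (1 / q)
        \<le> ennreal (C * (1 + ln (2 * t / r)) * (\<bar>b x - ball_avg b x0 r\<bar> + \<beta>))
          * enn_powr (\<integral>\<^sup>+ y \<in> ball x0 (2 * t). enn_powr (ennreal \<bar>f y\<bar>) p * ennreal (\<omega> y powr p) \<partial>lebesgue) (1 / p)"
      by (simp add: N_def w_def[abs_def] L_def \<tau>_def)
  qed
qed

section \<open>Decoupling the multilinear weight condition\<close>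

lemma wmeas_pos_AE:
  fixes x :: "'a::euclidean_space"
  assumes [measurable]: "w \<in> borel_measurable lebesgue" and ae: "AE y in lebesgue. 0 < w y" and r: "0 < r"
  shows "0 < wmeas w (ball x r)"
proof (rule ccontr)
  assume "\<not> 0 < wmeas w (ball x r)"
  then have "(\<integral>\<^sup>+ y. ennreal (w y) * indicator (ball x r) y \<partial>lebesgue) = 0" by (simp add: wmeas_def)
  then have "AE y in lebesgue. ennreal (w y) * indicator (ball x r) y = 0"
    by (subst (asm) nn_integral_0_iff_AE) auto
  with ae have "AE y in lebesgue. y \<notin> ball x r"
    by eventually_elim (auto simp: indicator_def ennreal_eq_0_iff split: if_splits)
  then have "emeasure lebesgue {y \<in> space lebesgue. y \<in> ball x r} = 0"
    by (rule emeasure_eq_0_AE)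
  moreover have "{y \<in> space lebesgue. y \<in> ball x r} = ball x r" by auto
  ultimately have "emeasure lebesgue (ball x r) = 0" by (simp only:)
  then show False using ball_meas_pos[OF r, of x] by (simp add: ball_meas_def)
qed

lemma weight_ball:
  assumes w: "is_weight w" and r: "0 < r"
  shows "wmeas w (ball x r) < top" "0 < wmeas w (ball x r)"
proof -
  have [measurable]: "w \<in> borel_measurable lebesgue" and w0: "\<And>y. 0 \<le> w y"
    and ae: "AE y in lebesgue. 0 < w y" using w by (auto simp: is_weight_def)
  have "set_integrable lebesgue (cball x r) w" using w by (simp add: is_weight_def)
  then have "(\<integral>\<^sup>+ y. ennreal (norm (indicator (cball x r) y *\<^sub>R w y)) \<partial>lebesgue) < \<infinity>"
    unfolding set_integrable_def by (simp add: integrable_iff_bounded)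
  moreover have "wmeas w (ball x r) \<le> (\<integral>\<^sup>+ y. ennreal (norm (indicator (cball x r) y *\<^sub>R w y)) \<partial>lebesgue)"
    unfolding wmeas_def using w0 by (intro nn_integral_mono) (auto simp: indicator_def)
  ultimately show "wmeas w (ball x r) < top" by (simp add: le_less_trans)
  show "0 < wmeas w (ball x r)" by (rule wmeas_pos_AE[OF _ ae r]) measurable
qed

text \<open>An \<open>A\<^sub>1\<close> weight is treated as an \<open>A\<^sub>2\<close> weight.\<close>

lemma A_infty_imp_Ap:
  fixes w :: "'a::euclidean_space \<Rightarrow> real"
  assumes "A_infty w"
  obtains \<rho> C where "1 < \<rho>" "0 < C" "is_weight w"
    "\<And>x r. 0 < r \<Longrightarrow> (wmeas w (ball x r) / ball_meas x r) *
        enn_powr ((\<integral>\<^sup>+ y \<in> ball x r. ennreal (w y powr (-1 / (\<rho> - 1))) \<partial>lebesgue) / ball_meas x r) (\<rho> - 1) \<le> ennreal C"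
proof -
  obtain p where p: "1 \<le> p" "A_class p w" using assms by (auto simp: A_infty_def)
  have wt: "is_weight w" using p by (simp add: A_class_def)
  have [measurable]: "w \<in> borel_measurable lebesgue" and w0: "\<And>y. 0 \<le> w y"
    and ae: "AE y in lebesgue. 0 < w y" using wt by (auto simp: is_weight_def)
  show ?thesis
  proof (cases "p = 1")
    case False
    then obtain C where C: "\<And>x r. 0 < r \<Longrightarrow> (wmeas w (ball x r) / ball_meas x r) *
        enn_powr ((\<integral>\<^sup>+ y \<in> ball x r. ennreal (w y powr (-1 / (p - 1))) \<partial>lebesgue) / ball_meas x r) (p - 1) \<le> ennreal C"
      using p by (auto simp: A_class_def)
    show ?thesis
    proof (rule that[of p "max C 1"])
      fix x :: 'a and r :: real assume "0 < r"
      from C[OF this, of x] show "(wmeas w (ball x r) / ball_meas x r) *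
        enn_powr ((\<integral>\<^sup>+ y \<in> ball x r. ennreal (w y powr (-1 / (p - 1))) \<partial>lebesgue) / ball_meas x r) (p - 1) \<le> ennreal (max C 1)"
        by (rule order_trans) (simp add: ennreal_leI)
    qed (use p False wt in auto)
  next
    case True
    then obtain C0 where C0: "\<And>x r. 0 < r \<Longrightarrow> wmeas w (ball x r) / ball_meas x r
             \<le> ennreal C0 * ess_inf_on (ball x r) (\<lambda>y. ennreal (w y))"
      using p by (auto simp: A_class_def)
    define C where "C = max C0 1"
    have C1: "1 \<le> C" by (simp add: C_def)
    show ?thesis
    proof (rule that[of 2 "2 * C"])
      fix x :: 'a and r :: real assume r: "0 < r"
      let ?B = "ball x r"
      obtain M where M: "ball_meas x r = ennreal M" "0 < M"
        using ball_meas_pos[OF r, of x] by (auto simp: ball_meas_conv_measure ennreal_less_zero_iff)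
      obtain W where W: "wmeas w ?B = ennreal W" "0 < W"
        using weight_ball[OF wt r, of x] by (cases "wmeas w ?B") (auto simp: ennreal_less_zero_iff)
      define a where "a = W / M"
      have a: "0 < a" "wmeas w ?B / ball_meas x r = ennreal a" using M W by (auto simp: a_def divide_ennreal)
      have "ennreal a \<le> ennreal C * ess_inf_on ?B (\<lambda>y. ennreal (w y))"
        using C0[OF r, of x] unfolding a(2)
        by (rule order_trans) (auto intro!: mult_right_mono ennreal_leI simp: C_def)
      then have "ennreal (1 / C) * ennreal a \<le> ennreal (1 / C) * (ennreal C * ess_inf_on ?B (\<lambda>y. ennreal (w y)))"
        by (rule mult_left_mono) simp
      then have e: "ennreal (a / C) \<le> ess_inf_on ?B (\<lambda>y. ennreal (w y))"
        using a C1 by (simp add: mult.assoc[symmetric] ennreal_mult[symmetric])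
      \<comment> \<open>\<open>ess_inf_on\<close> is a supremum of lower bounds. Going strictly
        below it, by the factor 2, produces an actual lower bound valid almost everywhere.\<close>
      have "ennreal (a / (2 * C)) < ennreal (a / C)"
        using a C1 by (intro ennreal_lessI) (auto simp: field_simps)
      then have "ennreal (a / (2 * C)) < Sup {c. AE y in lebesgue. y \<in> ?B \<longrightarrow> c \<le> ennreal (w y)}"
        using e unfolding ess_inf_on_def by (rule less_le_trans)
      then obtain c where c: "AE y in lebesgue. y \<in> ?B \<longrightarrow> c \<le> ennreal (w y)" "ennreal (a / (2 * C)) < c"
        by (auto simp: less_Sup_iff)
      have "(\<integral>\<^sup>+ y \<in> ?B. ennreal (w y powr (-1 / (2 - 1))) \<partial>lebesgue) \<le> (\<integral>\<^sup>+ y. ennreal (2 * C / a) * indicator ?B y \<partial>lebesgue)"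
      proof (rule nn_integral_mono_AE)
        show "AE y in lebesgue. ennreal (w y powr (-1 / (2 - 1))) * indicator ?B y \<le> ennreal (2 * C / a) * indicator ?B y"
          using c(1) ae
        proof eventually_elim
          case (elim y)
          show ?case
          proof (cases "y \<in> ?B")
            case True
            then have "ennreal (a / (2 * C)) \<le> ennreal (w y)" using elim c(2) by (metis less_imp_le order_trans)
            then have "a / (2 * C) \<le> w y" using w0[of y] by (simp add: ennreal_le_iff)
            then have "1 / w y \<le> 2 * C / a" using a C1 elim by (auto simp: field_simps)
            then show ?thesis using elim True by (simp add: powr_minus_divide ennreal_leI)
          qed simp
        qed
      qed
      also have "\<dots> = ennreal (2 * C / a) * ball_meas x r" by (simp add: nn_integral_cmult_indicator ball_meas_def)
      finally have "(\<integral>\<^sup>+ y \<in> ?B. ennreal (w y powr (-1 / (2 - 1))) \<partial>lebesgue) / ball_meas x r \<le> ennreal (2 * C / a)"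
        using M by (subst ennreal_divide_le_iff) auto
      then have "ennreal a * ((\<integral>\<^sup>+ y \<in> ?B. ennreal (w y powr (-1 / (2 - 1))) \<partial>lebesgue) / ball_meas x r) \<le> ennreal a * ennreal (2 * C / a)"
        by (rule mult_left_mono) simp
      also have "\<dots> = ennreal (2 * C)" using a C1 by (simp add: ennreal_mult[symmetric])
      finally show "(wmeas w ?B / ball_meas x r) *
        enn_powr ((\<integral>\<^sup>+ y \<in> ?B. ennreal (w y powr (-1 / (2 - 1))) \<partial>lebesgue) / ball_meas x r) (2 - 1) \<le> ennreal (2 * C)"
        unfolding a(2) by simp
    qed (use C1 wt in auto)
  qed
qed

text \<open>Hoelder's inequality applied to the constant function one, written as a product of
  a power of the geometric mean of the weights and powers of the dual weights.\<close>

lemma A_infty_geometric_mean: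
  fixes W :: "nat \<Rightarrow> 'a::euclidean_space \<Rightarrow> real" and \<theta> :: "nat \<Rightarrow> real"
  assumes ainf: "\<And>i. i < m \<Longrightarrow> A_infty (W i)" and th: "\<And>i. i < m \<Longrightarrow> 0 < \<theta> i" "(\<Sum>i<m. \<theta> i) = 1"
  shows "\<exists>C>0. \<forall>x. \<forall>r>0. (\<Prod>i<m. enn_powr (wmeas (W i) (ball x r)) (\<theta> i))
      \<le> ennreal C * wmeas (\<lambda>y. \<Prod>i<m. W i y powr \<theta> i) (ball x r)"
proof -
  have "\<forall>i\<in>{..<m}. \<exists>z :: real \<times> real. 1 < fst z \<and> 0 < snd z \<and> is_weight (W i) \<and> (\<forall>x. \<forall>r>0. (wmeas (W i) (ball x r) / ball_meas x r) *
        enn_powr ((\<integral>\<^sup>+ y \<in> ball x r. ennreal (W i y powr (-1 / (fst z - 1))) \<partial>lebesgue) / ball_meas x r) (fst z - 1) \<le> ennreal (snd z))"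
  proof
    fix i assume "i \<in> {..<m}"
    then have i: "i < m" by simp
    show "\<exists>z :: real \<times> real. 1 < fst z \<and> 0 < snd z \<and> is_weight (W i) \<and> (\<forall>x. \<forall>r>0. (wmeas (W i) (ball x r) / ball_meas x r) *
        enn_powr ((\<integral>\<^sup>+ y \<in> ball x r. ennreal (W i y powr (-1 / (fst z - 1))) \<partial>lebesgue) / ball_meas x r) (fst z - 1) \<le> ennreal (snd z))"
      by (rule A_infty_imp_Ap[OF ainf[OF i]], rule_tac x = "(\<rho>, C)" in exI) auto
  qed
  from bchoice[OF this] obtain z where z: "\<forall>i\<in>{..<m}. 1 < fst (z i) \<and> 0 < snd (z i) \<and> is_weight (W i) \<and> (\<forall>x. \<forall>r>0. (wmeas (W i) (ball x r) / ball_meas x r) *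
        enn_powr ((\<integral>\<^sup>+ y \<in> ball x r. ennreal (W i y powr (-1 / (fst (z i) - 1))) \<partial>lebesgue) / ball_meas x r) (fst (z i) - 1) \<le> ennreal (snd (z i)))"
    by (elim exE) (rule that)
  define \<rho> C where "\<rho> i = fst (z i)" and "C i = snd (z i)" for i
  have rho: "1 < \<rho> i" and C: "0 < C i" and wt: "is_weight (W i)"
    and Ap: "\<And>x r. 0 < r \<Longrightarrow> (wmeas (W i) (ball x r) / ball_meas x r) *
        enn_powr ((\<integral>\<^sup>+ y \<in> ball x r. ennreal (W i y powr (-1 / (\<rho> i - 1))) \<partial>lebesgue) / ball_meas x r) (\<rho> i - 1) \<le> ennreal (C i)"
    if "i < m" for i
    using z that unfolding \<rho>_def C_def by auto
  define CC where "CC = (\<Prod>i<m. C i powr \<theta> i)"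
  have CC: "0 < CC" unfolding CC_def by (intro prod_pos) (auto dest: C)
  define V where "V i y = W i y powr (-1 / (\<rho> i - 1))" for i y
  define U where "U y = (\<Prod>i<m. W i y powr \<theta> i)" for y
  have Wm [measurable]: "W i \<in> borel_measurable lebesgue" and W0: "\<And>y. 0 \<le> W i y"
    and Wae: "AE y in lebesgue. 0 < W i y" if "i < m" for i using wt[OF that] by (auto simp: is_weight_def)
  have Vm [measurable]: "V i \<in> borel_measurable lebesgue" if "i < m" for i
    unfolding V_def[abs_def] using Wm[OF that] by measurable
  have Um [measurable]: "U \<in> borel_measurable lebesgue"
  proof -
    have "(\<lambda>y. W i y powr \<theta> i) \<in> borel_measurable lebesgue" if "i < m" for i
      using Wm[OF that] by measurable
    then show ?thesis unfolding U_def[abs_def] by (intro borel_measurable_prod) simp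
  qed
  \<comment> \<open>Normalises the Hoelder exponents 1/S and \<theta> i (\<rho> i - 1)/S to sum to
    one; it also equals the sum of \<rho> i \<theta> i, which makes the powers of |B| match at the
    end.\<close>
  define S where "S = 1 + (\<Sum>i<m. \<theta> i * (\<rho> i - 1))"
  have "0 \<le> \<theta> i * (\<rho> i - 1)" if "i < m" for i using th(1)[OF that] rho[OF that] by simp
  then have S: "1 \<le> S" unfolding S_def by (auto intro!: sum_nonneg)
  have main: "(\<Prod>i<m. enn_powr (wmeas (W i) (ball x r)) (\<theta> i)) \<le> ennreal CC * wmeas U (ball x r)" if r: "0 < r" for x r
  proof -
    let ?B = "ball x r"
    obtain M where M: "ball_meas x r = ennreal M" "0 < M"
      using ball_meas_pos[OF r, of x] by (auto simp: ball_meas_conv_measure ennreal_less_zero_iff)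
    have holder: "ball_meas x r \<le> enn_powr (wmeas U ?B) (1 / S) * (\<Prod>i<m. enn_powr (wmeas (V i) ?B) (\<theta> i * (\<rho> i - 1) / S))"
    proof -
      \<comment> \<open>The index m belongs to the geometric mean \<open>U\<close>, the indices
        below m to the dual weights \<open>V i\<close>.\<close>
      define a where "a i = (if i = m then 1 / S else \<theta> i * (\<rho> i - 1) / S)" for i
      define F where "F i y = ennreal (if i = m then U y else V i y) * indicator ?B y" for i y
      have [measurable]: "F i \<in> borel_measurable lebesgue" if "i \<in> {..m}" for i
        unfolding F_def[abs_def] using that by (cases "i = m") auto
      have apos: "0 < a i" if "i \<in> {..m}" for i
        using that S th(1)[of i] rho[of i] by (auto simp: a_def)
      have asum: "(\<Sum>i\<le>m. a i) = 1"
      proof -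
        have "(\<Sum>i\<le>m. a i) = (\<Sum>i<m. \<theta> i * (\<rho> i - 1) / S) + 1 / S"
          unfolding lessThan_Suc_atMost[symmetric] by (simp add: a_def)
        also have "\<dots> = ((\<Sum>i<m. \<theta> i * (\<rho> i - 1)) + 1) / S" by (simp add: sum_divide_distrib add_divide_distrib)
        also have "(\<Sum>i<m. \<theta> i * (\<rho> i - 1)) + 1 = S" by (simp add: S_def)
        finally show ?thesis using S by simp
      qed
      have "ball_meas x r = (\<integral>\<^sup>+ y. indicator ?B y \<partial>lebesgue)" by (simp add: ball_meas_def)
      also have "\<dots> = (\<integral>\<^sup>+ y. (\<Prod>i\<le>m. enn_powr (F i y) (a i)) \<partial>lebesgue)"
      proof (rule nn_integral_cong_AE)
        have "AE y in lebesgue. \<forall>i\<in>{..<m}. 0 < W i y"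
          using Wae by (intro AE_finite_allI) auto
        then show "AE y in lebesgue. indicator ?B y = (\<Prod>i\<le>m. enn_powr (F i y) (a i))"
        proof eventually_elim
          case (elim y)
          show ?case
          proof (cases "y \<in> ?B")
            case True
            have "(\<Prod>i\<le>m. enn_powr (F i y) (a i)) = (\<Prod>i<m. ennreal (V i y powr (\<theta> i * (\<rho> i - 1) / S))) * ennreal (U y powr (1 / S))"
              unfolding lessThan_Suc_atMost[symmetric] using True
              by (auto simp: F_def a_def enn_powr_ennreal V_def U_def prod_nonneg intro!: arg_cong2[of _ _ _ _ "(*)"] prod.cong)
            also have "\<dots> = ennreal ((\<Prod>i<m. V i y powr (\<theta> i * (\<rho> i - 1) / S)) * U y powr (1 / S))"
              by (simp add: prod_ennreal ennreal_mult prod_nonneg)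
            also have "U y powr (1 / S) = (\<Prod>i<m. W i y powr (\<theta> i / S))"
              unfolding U_def by (subst prod_powr_distrib) (auto simp: powr_powr)
            also have "(\<Prod>i<m. V i y powr (\<theta> i * (\<rho> i - 1) / S)) = (\<Prod>i<m. W i y powr (- (\<theta> i / S)))"
            proof (intro prod.cong refl)
              fix i assume "i \<in> {..<m}"
              then have "\<rho> i - 1 \<noteq> 0" using rho[of i] by simp
              then have "-1 / (\<rho> i - 1) * (\<theta> i * (\<rho> i - 1) / S) = - (\<theta> i / S)" by simp
              then show "V i y powr (\<theta> i * (\<rho> i - 1) / S) = W i y powr (- (\<theta> i / S))"
                unfolding V_def by (simp only: powr_powr)
            qed
            also have "(\<Prod>i<m. W i y powr (- (\<theta> i / S))) * (\<Prod>i<m. W i y powr (\<theta> i / S)) = (\<Prod>i<m. W i y powr (- (\<theta> i / S)) * W i y powr (\<theta> i / S))"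
              by (simp add: prod.distrib)
            also have "\<dots> = (\<Prod>i<m. 1)"
              by (intro prod.cong refl) (use elim in \<open>force simp: powr_add[symmetric]\<close>)
            finally show ?thesis using True by simp
          next
            case False
            then have "F m y = 0" by (simp add: F_def)
            then have "(\<Prod>i\<le>m. enn_powr (F i y) (a i)) = 0" unfolding lessThan_Suc_atMost[symmetric] by simp
            then show ?thesis using False by simp
          qed
        qed
      qed
      also have "\<dots> \<le> (\<Prod>i\<le>m. enn_powr (\<integral>\<^sup>+ y. F i y \<partial>lebesgue) (a i))"
        by (rule nn_integral_Holder) (use apos asum in auto)
      also have "\<dots> = (\<Prod>i<m. enn_powr (wmeas (V i) ?B) (\<theta> i * (\<rho> i - 1) / S)) * enn_powr (wmeas U ?B) (1 / S)"
        unfolding lessThan_Suc_atMost[symmetric] by (auto simp: F_def a_def wmeas_def intro!: arg_cong2[of _ _ _ _ "(*)"] prod.cong)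
      finally show ?thesis by (simp add: mult.commute)
    qed
    define VV where "VV = (\<Prod>i<m. enn_powr (wmeas (V i) ?B) (\<theta> i * (\<rho> i - 1)))"
    have hS: "ennreal (M powr S) \<le> wmeas U ?B * VV"
    proof -
      have "enn_powr (ball_meas x r) S \<le> enn_powr (enn_powr (wmeas U ?B) (1 / S) * (\<Prod>i<m. enn_powr (wmeas (V i) ?B) (\<theta> i * (\<rho> i - 1) / S))) S"
        using S by (intro enn_powr_mono holder) auto
      also have "\<dots> = wmeas U ?B * VV"
        using S unfolding VV_def by (simp add: enn_powr_mult enn_powr_prod enn_powr_powr)
      finally show ?thesis using M by (simp add: enn_powr_ennreal)
    qed
    have each: "wmeas (W i) ?B * enn_powr (wmeas (V i) ?B) (\<rho> i - 1) \<le> ennreal (C i * M powr \<rho> i)" if i: "i < m" for i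
    proof -
      have fin: "(M * M powr (\<rho> i - 1)) = M powr \<rho> i"
        using M powr_add[of M 1 "\<rho> i - 1"] by simp
      have d: "z = z / ennreal M * ennreal M" for z
        using M by (simp add: ennreal_divide_times)
      have "wmeas (W i) ?B * enn_powr (wmeas (V i) ?B) (\<rho> i - 1)
          = (wmeas (W i) ?B / ennreal M * ennreal M) * enn_powr (wmeas (V i) ?B / ennreal M * ennreal M) (\<rho> i - 1)"
        by (simp only: d[symmetric])
      also have "\<dots> = (wmeas (W i) ?B / ennreal M * enn_powr (wmeas (V i) ?B / ennreal M) (\<rho> i - 1)) * ennreal (M * M powr (\<rho> i - 1))"
        using M by (simp add: enn_powr_mult enn_powr_ennreal ennreal_mult ac_simps)
      also have "\<dots> \<le> ennreal (C i) * ennreal (M powr \<rho> i)"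
        unfolding fin using Ap[OF i r, of x] M by (intro mult_right_mono) (auto simp: wmeas_def V_def)
      finally show ?thesis using C[OF i] by (simp add: ennreal_mult)
    qed
    have Wpos: "0 < wmeas (W i) ?B" if "i < m" for i using weight_ball[OF wt[OF that] r] by simp
    have Vfin: "wmeas (V i) ?B < top" if i: "i < m" for i
    proof (rule ccontr)
      assume "\<not> wmeas (V i) ?B < top"
      then have "wmeas (V i) ?B = top" using top.not_eq_extremum by blast
      then have "wmeas (W i) ?B * enn_powr (wmeas (V i) ?B) (\<rho> i - 1) = top"
        using Wpos[OF i] by (simp add: ennreal_mult_top)
      then show False using each[OF i] by (simp add: top_unique)
    qed
    have VVfin: "VV < top" unfolding VV_def less_top[symmetric] ennreal_prod_eq_top using Vfin by force
    have VVpos: "VV \<noteq> 0" using hS M by auto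
    \<comment> \<open>The A_\<rho> conditions, raised to the powers \<theta> i and multiplied, bound
      this by a multiple of |B|^S, and Hoelder's inequality bounds |B|^S by U(B) VV. The factor VV,
      finite and nonzero, then cancels.\<close>
    have "(\<Prod>i<m. enn_powr (wmeas (W i) ?B) (\<theta> i)) * VV = (\<Prod>i<m. enn_powr (wmeas (W i) ?B * enn_powr (wmeas (V i) ?B) (\<rho> i - 1)) (\<theta> i))"
      unfolding VV_def by (simp add: prod.distrib[symmetric] enn_powr_mult enn_powr_powr mult.commute)
    also have "\<dots> \<le> (\<Prod>i<m. enn_powr (ennreal (C i * M powr \<rho> i)) (\<theta> i))"
      using th by (intro prod_mono_ennreal enn_powr_mono each) (auto simp: less_imp_le)
    also have "\<dots> = (\<Prod>i<m. ennreal (C i powr \<theta> i * M powr (\<rho> i * \<theta> i)))"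
      using C by (intro prod.cong refl) (auto simp: enn_powr_ennreal powr_mult powr_powr less_imp_le)
    also have "\<dots> = ennreal (CC * M powr (\<Sum>i<m. \<rho> i * \<theta> i))"
      using M by (simp add: prod_ennreal prod.distrib CC_def powr_sum)
    also have "(\<Sum>i<m. \<rho> i * \<theta> i) = S"
    proof -
      have "S = (\<Sum>i<m. \<theta> i) + (\<Sum>i<m. \<theta> i * (\<rho> i - 1))" by (simp add: S_def th(2))
      also have "\<dots> = (\<Sum>i<m. \<rho> i * \<theta> i)" by (simp add: sum.distrib[symmetric] algebra_simps)
      finally show ?thesis by simp
    qed
    also have "ennreal (CC * M powr S) = ennreal CC * ennreal (M powr S)"
      using CC by (simp add: ennreal_mult)
    also have "\<dots> \<le> ennreal CC * (wmeas U ?B * VV)" by (intro mult_left_mono hS) simp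
    finally have "VV * (\<Prod>i<m. enn_powr (wmeas (W i) ?B) (\<theta> i)) \<le> VV * (ennreal CC * wmeas U ?B)" by (simp only: ac_simps)
    then show ?thesis
      using VVfin VVpos by (subst (asm) ennreal_mult_le_mult_iff) auto
  qed
  show ?thesis
    using main CC unfolding U_def[abs_def] by (intro exI[of _ CC]) auto
qed

lemma prod_ge_factor_ennreal:
  fixes X :: "'i \<Rightarrow> ennreal"
  assumes "finite I" "j \<in> I" "\<And>i. i \<in> I \<Longrightarrow> 1 \<le> X i"
  shows "X j \<le> (\<Prod>i\<in>I. X i)"
proof -
  have "1 \<le> (\<Prod>i\<in>I - {j}. X i)"
    using prod_mono_ennreal[of "I - {j}" "\<lambda>_. 1" X] assms by simp
  then have "X j * 1 \<le> X j * (\<Prod>i\<in>I - {j}. X i)" by (rule mult_left_mono) simp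
  also have "\<dots> = (\<Prod>i\<in>I. X i)" using assms by (simp add: prod.remove[symmetric])
  finally show ?thesis by simp
qed

section \<open>From the multilinear weight condition to the linear ones\<close>

locale multi_weights =
  fixes m :: nat and p q :: "nat \<Rightarrow> real" and qq :: real and \<omega> :: "nat \<Rightarrow> 'a::euclidean_space \<Rightarrow> real"
  assumes p1: "\<And>i. i < m \<Longrightarrow> 1 < p i" and pq: "\<And>i. i < m \<Longrightarrow> p i < q i" and m0: "0 < m"
    and qq: "1 / qq = (\<Sum>i<m. 1 / q i)"
    and om0: "\<And>i y. i < m \<Longrightarrow> 0 \<le> \<omega> i y"
    and multi: "A_multi m p qq \<omega>"
    and ainf: "\<And>i. i < m \<Longrightarrow> A_infty (\<lambda>y. \<omega> i y powr q i)"
begin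

definition "s i = 1 / q i + 1 - 1 / p i"
definition "\<theta> i = 1 / (q i * s i)"
definition "w i y = \<omega> i y powr q i"
definition "v i y = \<omega> i y powr (- (p i / (p i - 1)))"
text \<open>The weight of the target space, that is, the product of the \<omega> i already raised to
  the power qq.\<close>

definition "u y = (\<Prod>i<m. \<omega> i y) powr qq"

lemma q_pos: "i < m \<Longrightarrow> 0 < q i" using p1[of i] pq[of i] by simp

lemma qq_pos: "0 < qq"
proof -
  have "0 < (\<Sum>i<m. 1 / q i)" using m0 q_pos by (intro sum_pos) auto
  then show ?thesis by (simp flip: qq)
qed

lemma sum_qq: "(\<Sum>i<m. qq / q i) = 1"
proof -
  have "(\<Sum>i<m. qq / q i) = qq * (\<Sum>i<m. 1 / q i)" by (simp add: sum_distrib_left)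
  then show ?thesis using qq_pos by (simp flip: qq)
qed

lemmas ex = exponent_relations[OF p1 pq s_def \<theta>_def]

lemma weight_w: "i < m \<Longrightarrow> is_weight (w i)"
  using A_infty_imp_Ap[OF ainf[of i]] unfolding w_def[abs_def] by metis

text \<open>Measurability is known for the weight \<omega>^q; \<omega> is recovered as its q-th
  root.\<close>

lemma om_meas: assumes "i < m" shows "\<omega> i \<in> borel_measurable lebesgue"
proof -
  have "w i \<in> borel_measurable lebesgue" using weight_w[OF assms] by (simp add: is_weight_def)
  then have "(\<lambda>y. w i y powr (1 / q i)) \<in> borel_measurable lebesgue" by measurable
  moreover have "(\<lambda>y. w i y powr (1 / q i)) = \<omega> i"
    using om0[OF assms] q_pos[OF assms] by (auto simp: w_def powr_powr)
  ultimately show ?thesis by simp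
qed

lemma w_meas: "i < m \<Longrightarrow> w i \<in> borel_measurable lebesgue" and v_meas: "i < m \<Longrightarrow> v i \<in> borel_measurable lebesgue"
  using om_meas[of i] unfolding w_def[abs_def] v_def[abs_def] by measurable

lemma om_pos: assumes "i < m" shows "AE y in lebesgue. 0 < \<omega> i y"
proof -
  have "AE y in lebesgue. 0 < w i y" using weight_w[OF assms] by (simp add: is_weight_def)
  then show ?thesis by eventually_elim (use om0[OF assms] in \<open>force simp: w_def less_le\<close>)
qed

lemma u_eq: "u y = (\<Prod>i<m. w i y powr (qq / q i))"
proof -
  have "u y = (\<Prod>i<m. \<omega> i y powr qq)" unfolding u_def by (rule prod_powr_distrib)
  also have "\<dots> = (\<Prod>i<m. w i y powr (qq / q i))"
  proof (intro prod.cong refl)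
    fix i assume "i \<in> {..<m}"
    then have "q i \<noteq> 0" using q_pos[of i] by simp
    then show "\<omega> i y powr qq = w i y powr (qq / q i)" by (simp add: w_def powr_powr)
  qed
  finally show ?thesis .
qed

lemma geometric_mean: "\<exists>D>0. \<forall>x. \<forall>r>0. (\<Prod>i<m. enn_powr (wmeas (w i) (ball x r)) (qq / q i)) \<le> ennreal D * wmeas u (ball x r)"
proof -
  have "u = (\<lambda>y. \<Prod>i<m. w i y powr (qq / q i))" by (rule ext) (rule u_eq)
  then show ?thesis
    using A_infty_geometric_mean[of m w "\<lambda>i. qq / q i"] ainf q_pos qq_pos sum_qq by (simp add: w_def[abs_def])
qed

lemma ae_one: assumes i: "i < m" shows "AE y in lebesgue. w i y powr \<theta> i * v i y powr (1 - \<theta> i) = 1"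
  using om_pos[OF i]
proof eventually_elim
  case (elim y)
  have "w i y powr \<theta> i * v i y powr (1 - \<theta> i) = \<omega> i y powr (q i * \<theta> i - p i / (p i - 1) * (1 - \<theta> i))"
    using elim by (simp add: w_def v_def powr_powr powr_add[symmetric])
  also have "\<dots> = 1" using ex(6)[OF i i] elim by simp
  finally show ?case .
qed

text \<open>The normalised quantities \<open>X i\<close> are all at least one by Hoelder's
  inequality, and their product is bounded by the multilinear condition once the average of
  \<open>u\<close> is exchanged for the averages of the \<open>w i\<close>. A bound for a product of
  factors at least one bounds each factor.\<close>

lemma single_weights: assumes j: "j < m" shows "\<exists>K. muckenhoupt (\<theta> j) K (w j) (v j)"
proof -
  obtain D where D: "0 < D" "\<And>x r. 0 < r \<Longrightarrow> (\<Prod>i<m. enn_powr (wmeas (w i) (ball x r)) (qq / q i)) \<le> ennreal D * wmeas u (ball x r)"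
    using geometric_mean by auto
  obtain C0 where C0: "\<And>x r. 0 < r \<Longrightarrow> enn_powr (wmeas u (ball x r) / ball_meas x r) (1 / qq) *
        (\<Prod>i<m. enn_powr (wmeas (v i) (ball x r) / ball_meas x r) (1 - 1 / p i)) \<le> ennreal C0"
  proof -
    obtain C where C: "\<forall>x. \<forall>r>0.
        enn_powr ((\<integral>\<^sup>+ y \<in> ball x r. ennreal ((\<Prod>i<m. \<omega> i y) powr qq) \<partial>lebesgue) / ball_meas x r) (1 / qq) *
        (\<Prod>i<m. enn_powr ((\<integral>\<^sup>+ y \<in> ball x r. ennreal (\<omega> i y powr (- (p i / (p i - 1)))) \<partial>lebesgue) / ball_meas x r)
                   (1 / (p i / (p i - 1)))) \<le> ennreal C"
      using multi unfolding A_multi_def by auto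
    have eq: "1 / (p i / (p i - 1)) = 1 - 1 / p i" if "i < m" for i using p1[OF that] by (simp add: field_simps)
    have prod_eq: "(\<Prod>i<m. enn_powr (Z i) (1 - 1 / p i)) = (\<Prod>i<m. enn_powr (Z i) (1 / (p i / (p i - 1))))" for Z
      by (intro prod.cong refl) (simp only: eq lessThan_iff)
    show ?thesis
    proof (rule that[of C])
      fix x :: 'a and r :: real assume "0 < r"
      with C show "enn_powr (wmeas u (ball x r) / ball_meas x r) (1 / qq) *
        (\<Prod>i<m. enn_powr (wmeas (v i) (ball x r) / ball_meas x r) (1 - 1 / p i)) \<le> ennreal C"
        unfolding prod_eq wmeas_def u_def v_def by blast
    qed
  qed
  define C where "C = D powr (1 / qq) * max C0 1"
  have C: "0 < C" using D by (simp add: C_def)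
  define K where "K = C powr (1 / s j)"
  have K: "enn_powr (wmeas (w j) (ball x r)) (\<theta> j) * enn_powr (wmeas (v j) (ball x r)) (1 - \<theta> j) \<le> ennreal K * ball_meas x r"
    "wmeas (v j) (ball x r) < top" if r: "0 < r" for x r
  proof -
    let ?B = "ball x r"
    obtain M where M: "ball_meas x r = ennreal M" "0 < M"
      using ball_meas_pos[OF r, of x] by (auto simp: ball_meas_conv_measure ennreal_less_zero_iff)
    have div: "z / ball_meas x r = z * ennreal (1 / M)" for z
      using M by (simp add: divide_ennreal_def inverse_ennreal inverse_eq_divide)
    \<comment> \<open>\<open>Y i\<close> is the quantity of \<open>muck_pair\<close>, with exponents
      summing to one; \<open>X i\<close> is its power s i and has the exponents 1/q and 1 - 1/p of
      the multilinear condition.\<close>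
    define Y where "Y i = enn_powr (wmeas (w i) ?B) (\<theta> i) * enn_powr (wmeas (v i) ?B) (1 - \<theta> i) * ennreal (1 / M)" for i
    define X where "X i = enn_powr (wmeas (w i) ?B * ennreal (1 / M)) (1 / q i) * enn_powr (wmeas (v i) ?B * ennreal (1 / M)) (1 - 1 / p i)" for i
    have XY: "X i = enn_powr (Y i) (s i)" if i: "i < m" for i
    proof -
      have "enn_powr (ennreal (1 / M)) (\<theta> i) * enn_powr (ennreal (1 / M)) (1 - \<theta> i) = ennreal (1 / M)"
        using enn_powr_add[of "ennreal (1 / M)" "\<theta> i" "1 - \<theta> i"] by simp
      then have "Y i = enn_powr (wmeas (w i) ?B) (\<theta> i) * enn_powr (wmeas (v i) ?B) (1 - \<theta> i) * (enn_powr (ennreal (1 / M)) (\<theta> i) * enn_powr (ennreal (1 / M)) (1 - \<theta> i))"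
        unfolding Y_def by (simp only:)
      also have "\<dots> = enn_powr (wmeas (w i) ?B * ennreal (1 / M)) (\<theta> i) * enn_powr (wmeas (v i) ?B * ennreal (1 / M)) (1 - \<theta> i)"
        unfolding enn_powr_mult by (simp only: ac_simps)
      finally have "Y i = enn_powr (wmeas (w i) ?B * ennreal (1 / M)) (\<theta> i) * enn_powr (wmeas (v i) ?B * ennreal (1 / M)) (1 - \<theta> i)" .
      then show ?thesis
        unfolding X_def using ex(4,5)[OF i i] by (simp add: enn_powr_mult[of "enn_powr _ _"] enn_powr_powr mult.commute)
    qed
    have Y1: "1 \<le> Y i" if i: "i < m" for i
    proof -
      have "ball_meas x r \<le> enn_powr (wmeas (w i) ?B) (\<theta> i) * enn_powr (wmeas (v i) ?B) (1 - \<theta> i)"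
        unfolding ball_meas_def
        by (intro lebesgue_le_wmeas_product w_meas v_meas i ae_one ex(2,3)) (auto simp: w_def v_def i)
      then have "ball_meas x r * ennreal (1 / M) \<le> Y i" unfolding Y_def by (rule mult_right_mono) simp
      then show ?thesis using M by (simp add: ennreal_mult[symmetric])
    qed
    have X1: "1 \<le> X i" if i: "i < m" for i
      unfolding XY[OF i] using enn_powr_mono[OF Y1[OF i], of "s i"] ex(1)[OF i i] by simp
    have "(\<Prod>i<m. X i) = (\<Prod>i<m. enn_powr (wmeas (w i) ?B * ennreal (1 / M)) (1 / q i)) * (\<Prod>i<m. enn_powr (wmeas (v i) ?B / ball_meas x r) (1 - 1 / p i))"
      unfolding X_def by (simp add: prod.distrib div)
    also have "(\<Prod>i<m. enn_powr (wmeas (w i) ?B * ennreal (1 / M)) (1 / q i)) = enn_powr ((\<Prod>i<m. enn_powr (wmeas (w i) ?B) (qq / q i)) * ennreal (1 / M)) (1 / qq)"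
    proof -
      have "(\<Prod>i<m. enn_powr (ennreal (1 / M)) (qq / q i)) = ennreal (1 / M)"
        using M sum_qq by (simp add: enn_powr_ennreal prod_ennreal powr_sum[symmetric])
      then have "(\<Prod>i<m. enn_powr (wmeas (w i) ?B) (qq / q i)) * ennreal (1 / M) = (\<Prod>i<m. enn_powr (wmeas (w i) ?B * ennreal (1 / M)) (qq / q i))"
        by (simp add: enn_powr_mult prod.distrib)
      then show ?thesis using qq_pos by (simp add: enn_powr_prod enn_powr_powr)
    qed
    also have "\<dots> \<le> enn_powr (ennreal D * (wmeas u ?B / ball_meas x r)) (1 / qq)"
      unfolding div mult.assoc[symmetric] using qq_pos by (intro enn_powr_mono mult_right_mono D r) auto
    also have "\<dots> = ennreal (D powr (1 / qq)) * enn_powr (wmeas u ?B / ball_meas x r) (1 / qq)"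
      using D by (simp add: enn_powr_mult enn_powr_ennreal)
    finally have "(\<Prod>i<m. X i) \<le> ennreal (D powr (1 / qq)) * (enn_powr (wmeas u ?B / ball_meas x r) (1 / qq) * (\<Prod>i<m. enn_powr (wmeas (v i) ?B / ball_meas x r) (1 - 1 / p i)))"
      by (simp add: mult_right_mono mult.assoc)
    also have "\<dots> \<le> ennreal (D powr (1 / qq)) * ennreal (max C0 1)"
      by (intro mult_left_mono order_trans[OF C0[OF r]] ennreal_leI) auto
    also have "\<dots> = ennreal C" by (simp add: C_def ennreal_mult)
    finally have Xj: "X j \<le> ennreal C"
      using prod_ge_factor_ennreal[of "{..<m}" j X] X1 j by (auto intro: order_trans)
    then have "Y j \<le> enn_powr (ennreal C) (1 / s j)"
      unfolding XY[OF j] using ex(1)[OF j j] by (simp add: enn_powr_le_iff2)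
    also have "\<dots> = ennreal K" using C by (simp add: K_def enn_powr_ennreal)
    finally have YK: "Y j \<le> ennreal K" .
    then have "Y j * ennreal M \<le> ennreal K * ball_meas x r" unfolding M(1) by (rule mult_right_mono) simp
    moreover have "ennreal (1 / M) * ennreal M = 1" using M by (simp add: ennreal_mult[symmetric])
    ultimately show "enn_powr (wmeas (w j) ?B) (\<theta> j) * enn_powr (wmeas (v j) ?B) (1 - \<theta> j) \<le> ennreal K * ball_meas x r"
      unfolding Y_def by (simp add: mult.assoc)
    show "wmeas (v j) ?B < top"
    proof (rule ccontr)
      assume "\<not> wmeas (v j) ?B < top"
      then have "wmeas (v j) ?B = top" using top.not_eq_extremum by blast
      then have "Y j = top"
        using weight_ball(2)[OF weight_w[OF j] r, of x] M by (simp add: Y_def ennreal_mult_top ennreal_top_mult)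
      then show False using YK by (simp add: top_unique)
    qed
  qed
  have "muckenhoupt (\<theta> j) K (w j) (v j)"
    unfolding muckenhoupt_def muck_pair_def
    using ex(2,3)[OF j j] w_meas[OF j] v_meas[OF j] ae_one[OF j] weight_ball(1)[OF weight_w[OF j]] K
    by (auto simp: w_def v_def)
  then show ?thesis ..
qed

end

section \<open>Local estimates and the main theorem\<close>

text \<open>Everything the final argument uses about one weight, with a single constant: doubling,
  power moments, the operator bound and the far averages. A constant can then be chosen for each
  index at once, before b and f are given.\<close>

definition comm_estimates :: "real \<Rightarrow> real \<Rightarrow> real \<Rightarrow> ('a::euclidean_space \<Rightarrow> real) \<Rightarrow> bool" where
  "comm_estimates C p q \<omega> \<longleftrightarrow> 0 < C \<and>
     (\<forall>x. \<forall>r>0. wmeas (\<lambda>y. \<omega> y powr q) (ball x (2 * r)) \<le> ennreal C * wmeas (\<lambda>y. \<omega> y powr q) (ball x r)) \<and>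
     (\<forall>b \<beta>. in_BMO b \<longrightarrow> 0 < \<beta> \<longrightarrow> bmo_norm b \<le> ennreal \<beta> \<longrightarrow>
        (\<forall>x. \<forall>r>0. (\<integral>\<^sup>+ y \<in> ball x r. ennreal ((\<bar>b y - ball_avg b x r\<bar> + \<beta>) powr q) * ennreal (\<omega> y powr q) \<partial>lebesgue)
           \<le> ennreal (C * \<beta> powr q) * wmeas (\<lambda>y. \<omega> y powr q) (ball x r)) \<and>
        (\<forall>f \<in> borel_measurable lebesgue.
           (\<integral>\<^sup>+ x. enn_powr (comm_max (1 / q + 1 - 1 / p) b f x) q * ennreal (\<omega> x powr q) \<partial>lebesgue)
             \<le> ennreal (C * \<beta> powr q) * enn_powr (\<integral>\<^sup>+ y. enn_powr (ennreal \<bar>f y\<bar>) p * ennreal (\<omega> y powr p) \<partial>lebesgue) (q / p) \<and>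
           (\<forall>x0 r x t. 0 < r \<longrightarrow> x \<in> ball x0 r \<longrightarrow> r \<le> t \<longrightarrow>
              ennreal (measure lebesgue (ball x t) powr (- (1 / q + 1 - 1 / p))) * (\<integral>\<^sup>+ y \<in> ball x t. ennreal (\<bar>b x - b y\<bar> * \<bar>f y\<bar>) \<partial>lebesgue)
                * enn_powr (wmeas (\<lambda>y. \<omega> y powr q) (ball x0 (2 * t))) (1 / q)
              \<le> ennreal (C * (1 + ln (2 * t / r)) * (\<bar>b x - ball_avg b x0 r\<bar> + \<beta>))
                * enn_powr (\<integral>\<^sup>+ y \<in> ball x0 (2 * t). enn_powr (ennreal \<bar>f y\<bar>) p * ennreal (\<omega> y powr p) \<partial>lebesgue) (1 / p))))"

lemma comm_estimates_exist:
  fixes \<omega> :: "'a::euclidean_space \<Rightarrow> real"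
  assumes p: "1 < p" "p < q" and om: "\<omega> \<in> borel_measurable lebesgue" "\<forall>y. 0 \<le> \<omega> y"
    and mu: "muckenhoupt (1 / (q * (1 / q + 1 - 1 / p))) K (\<lambda>y. \<omega> y powr q) (\<lambda>y. \<omega> y powr (- (p / (p - 1))))"
  shows "\<exists>C. comm_estimates C p q \<omega>"
proof -
  define s where "s = 1 / q + 1 - 1 / p"
  define \<theta> where "\<theta> = 1 / (q * s)"
  have mu': "muckenhoupt \<theta> K (\<lambda>y. \<omega> y powr q) (\<lambda>y. \<omega> y powr (- (p / (p - 1))))" using mu by (simp add: \<theta>_def s_def)
  interpret W: muckenhoupt \<theta> K "\<lambda>y. \<omega> y powr q" "\<lambda>y. \<omega> y powr (- (p / (p - 1)))" by (rule mu')
  have q: "0 < q" using p by simp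
  from commutator_maximal_bound[OF p s_def \<theta>_def, of K, where 'a='a] obtain C1 where C1: "0 < C1"
    and near: "\<And>b \<beta> f. in_BMO b \<Longrightarrow> 0 < \<beta> \<Longrightarrow> bmo_norm b \<le> ennreal \<beta> \<Longrightarrow> f \<in> borel_measurable lebesgue \<Longrightarrow>
       (\<integral>\<^sup>+ x. enn_powr (comm_max s b f x) q * ennreal (\<omega> x powr q) \<partial>lebesgue)
     \<le> ennreal (C1 * \<beta> powr q) * enn_powr (\<integral>\<^sup>+ y. enn_powr (ennreal \<bar>f y\<bar>) p * ennreal (\<omega> y powr p) \<partial>lebesgue) (q / p)"
    using om mu' by blast
  from comm_average_far[OF p s_def \<theta>_def, of K, where 'a='a] obtain C2 where C2: "0 < C2"
    and far: "\<forall>(\<omega> :: 'a \<Rightarrow> real) b \<beta> f. \<omega> \<in> borel_measurable lebesgue \<longrightarrow> (\<forall>y. 0 \<le> \<omega> y) \<longrightarrow>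
     muckenhoupt \<theta> K (\<lambda>y. \<omega> y powr q) (\<lambda>y. \<omega> y powr (- (p / (p - 1)))) \<longrightarrow> in_BMO b \<longrightarrow> 0 < \<beta> \<longrightarrow> bmo_norm b \<le> ennreal \<beta> \<longrightarrow> f \<in> borel_measurable lebesgue \<longrightarrow>
        (\<forall>x0 r x t. 0 < r \<longrightarrow> x \<in> ball x0 r \<longrightarrow> r \<le> t \<longrightarrow>
        ennreal (measure lebesgue (ball x t) powr (- s)) * (\<integral>\<^sup>+ y \<in> ball x t. ennreal (\<bar>b x - b y\<bar> * \<bar>f y\<bar>) \<partial>lebesgue)
          * enn_powr (wmeas (\<lambda>y. \<omega> y powr q) (ball x0 (2 * t))) (1 / q)
        \<le> ennreal (C2 * (1 + ln (2 * t / r)) * (\<bar>b x - ball_avg b x0 r\<bar> + \<beta>))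
          * enn_powr (\<integral>\<^sup>+ y \<in> ball x0 (2 * t). enn_powr (ennreal \<bar>f y\<bar>) p * ennreal (\<omega> y powr p) \<partial>lebesgue) (1 / p))"
    by (elim exE conjE) (rule that)
  from oscillation_power_bound[OF q, of \<theta> K, where 'a='a] obtain C3 where C3: "0 < C3"
    and osc: "\<forall>(w :: 'a \<Rightarrow> real) v b \<beta>. muckenhoupt \<theta> K w v \<longrightarrow> in_BMO b \<longrightarrow> 0 < \<beta> \<longrightarrow> bmo_norm b \<le> ennreal \<beta> \<longrightarrow>
     (\<forall>x. \<forall>r>0. (\<integral>\<^sup>+ y \<in> ball x r. ennreal ((\<bar>b y - ball_avg b x r\<bar> + \<beta>) powr q) * ennreal (w y) \<partial>lebesgue)
        \<le> ennreal (C3 * \<beta> powr q) * wmeas w (ball x r))"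
    by (elim exE conjE) (rule that)
  define C4 where "C4 = (K * 2 ^ DIM('a)) powr (1 / \<theta>)"
  define C where "C = max (max C1 C2) (max C3 C4)"
  have C: "0 < C" "C1 \<le> C" "C2 \<le> C" "C3 \<le> C" "C4 \<le> C" using C1 by (auto simp: C_def)
  have "comm_estimates C p q \<omega>"
    unfolding comm_estimates_def s_def[symmetric]
  proof (intro conjI allI impI ballI C(1))
    fix x :: 'a and r :: real assume r: "0 < r"
    have "wmeas (\<lambda>y. \<omega> y powr q) (ball x (2 * r)) \<le> ennreal C4 * wmeas (\<lambda>y. \<omega> y powr q) (ball x r)"
      using W.wmeas_ball_scale[OF r, of 2 x] by (simp add: C4_def)
    also have "\<dots> \<le> ennreal C * wmeas (\<lambda>y. \<omega> y powr q) (ball x r)"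
      by (intro mult_right_mono ennreal_leI C) simp
    finally show "wmeas (\<lambda>y. \<omega> y powr q) (ball x (2 * r)) \<le> ennreal C * wmeas (\<lambda>y. \<omega> y powr q) (ball x r)" .
  next
    fix b :: "'a \<Rightarrow> real" and \<beta> :: real and x :: 'a and r :: real
    assume b: "in_BMO b" "0 < \<beta>" "bmo_norm b \<le> ennreal \<beta>" and r: "0 < r"
    show "(\<integral>\<^sup>+ y \<in> ball x r. ennreal ((\<bar>b y - ball_avg b x r\<bar> + \<beta>) powr q) * ennreal (\<omega> y powr q) \<partial>lebesgue)
           \<le> ennreal (C * \<beta> powr q) * wmeas (\<lambda>y. \<omega> y powr q) (ball x r)"
      using osc[rule_format, OF mu' b r] by (rule order_trans) (intro mult_right_mono ennreal_leI C, auto)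
  next
    fix b :: "'a \<Rightarrow> real" and \<beta> :: real and f :: "'a \<Rightarrow> real"
    assume b: "in_BMO b" "0 < \<beta>" "bmo_norm b \<le> ennreal \<beta>" and f: "f \<in> borel_measurable lebesgue"
    show "(\<integral>\<^sup>+ x. enn_powr (comm_max s b f x) q * ennreal (\<omega> x powr q) \<partial>lebesgue)
     \<le> ennreal (C * \<beta> powr q) * enn_powr (\<integral>\<^sup>+ y. enn_powr (ennreal \<bar>f y\<bar>) p * ennreal (\<omega> y powr p) \<partial>lebesgue) (q / p)"
      using near[OF b f] by (rule order_trans) (intro mult_right_mono ennreal_leI C, auto)
    fix x0 x :: 'a and r t :: real assume rt: "0 < r" "x \<in> ball x0 r" "r \<le> t"
    have "1 \<le> 2 * t / r" using rt by (simp add: field_simps)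
    then have "0 \<le> 1 + ln (2 * t / r)" using ln_ge_zero[of "2 * t / r"] by linarith
    then have le: "ennreal (C2 * (1 + ln (2 * t / r)) * (\<bar>b x - ball_avg b x0 r\<bar> + \<beta>)) \<le> ennreal (C * (1 + ln (2 * t / r)) * (\<bar>b x - ball_avg b x0 r\<bar> + \<beta>))"
      using b(2) by (intro ennreal_leI mult_right_mono C) auto
    from far[rule_format, OF om(1) om(2)[rule_format] mu' b f rt]
    show "ennreal (measure lebesgue (ball x t) powr (- s)) * (\<integral>\<^sup>+ y \<in> ball x t. ennreal (\<bar>b x - b y\<bar> * \<bar>f y\<bar>) \<partial>lebesgue)
          * enn_powr (wmeas (\<lambda>y. \<omega> y powr q) (ball x0 (2 * t))) (1 / q)
        \<le> ennreal (C * (1 + ln (2 * t / r)) * (\<bar>b x - ball_avg b x0 r\<bar> + \<beta>))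
          * enn_powr (\<integral>\<^sup>+ y \<in> ball x0 (2 * t). enn_powr (ennreal \<bar>f y\<bar>) p * ennreal (\<omega> y powr p) \<partial>lebesgue) (1 / p)"
      by (rule order_trans) (intro mult_right_mono le, simp)
  qed
  then show ?thesis ..
qed

text \<open>For fixed x the integrand is a product of functions of the separate variables, so
  Tonelli turns the integral over the product of balls into a product of integrals.\<close>

lemma frac_max_comm_eq:
  fixes b f :: "nat \<Rightarrow> 'a::euclidean_space \<Rightarrow> real" and s :: "nat \<Rightarrow> real"
  assumes bm: "\<And>i. i < m \<Longrightarrow> b i \<in> borel_measurable lebesgue" and fm: "\<And>i. i < m \<Longrightarrow> f i \<in> borel_measurable lebesgue"
    and s: "\<alpha> / real DIM('a) - real m = - (\<Sum>i<m. s i)"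
  shows "frac_max_comm m \<alpha> b f x = (SUP t\<in>{0<..}. ennreal (measure lebesgue (ball x t) powr (- (\<Sum>i<m. s i))) *
      (\<Prod>i<m. \<integral>\<^sup>+ y \<in> ball x t. ennreal (\<bar>b i x - b i y\<bar> * \<bar>f i y\<bar>) \<partial>lebesgue))"
  unfolding frac_max_comm_def s
proof (intro SUP_cong refl arg_cong2[of _ _ _ _ "(*)"])
  fix t :: real
  interpret product_sigma_finite "\<lambda>_::nat. lebesgue :: 'a measure"
    by (simp add: product_sigma_finite_def sigma_finite_lebesgue)
  have "(\<integral>\<^sup>+ ys \<in> (\<Pi>\<^sub>E i\<in>{..<m}. ball x t). ennreal (\<Prod>i<m. \<bar>b i x - b i (ys i)\<bar> * \<bar>f i (ys i)\<bar>) \<partial>(\<Pi>\<^sub>M i\<in>{..<m}. (lebesgue :: 'a measure)))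
     = (\<integral>\<^sup>+ ys. (\<Prod>i<m. ennreal (\<bar>b i x - b i (ys i)\<bar> * \<bar>f i (ys i)\<bar>) * indicator (ball x t) (ys i)) \<partial>(\<Pi>\<^sub>M i\<in>{..<m}. (lebesgue :: 'a measure)))"
  proof (rule nn_integral_cong)
    fix ys assume ys: "ys \<in> space (\<Pi>\<^sub>M i\<in>{..<m}. (lebesgue :: 'a measure))"
    have "indicator (\<Pi>\<^sub>E i\<in>{..<m}. ball x t) ys = (\<Prod>i<m. indicator (ball x t) (ys i) :: ennreal)"
    proof (cases "\<forall>i<m. ys i \<in> ball x t")
      case True
      then have "ys \<in> (\<Pi>\<^sub>E i\<in>{..<m}. ball x t)" using ys by (auto simp: space_PiM PiE_iff)
      then show ?thesis using True by simp
    next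
      case False
      then have "ys \<notin> (\<Pi>\<^sub>E i\<in>{..<m}. ball x t)" by (auto simp: PiE_iff)
      moreover obtain i where "i < m" "ys i \<notin> ball x t" using False by auto
      then have "(\<Prod>i<m. indicator (ball x t) (ys i) :: ennreal) = 0"
        by (intro prod_zero bexI[of _ i]) auto
      ultimately show ?thesis by simp
    qed
    moreover have "ennreal (\<Prod>i<m. \<bar>b i x - b i (ys i)\<bar> * \<bar>f i (ys i)\<bar>) = (\<Prod>i<m. ennreal (\<bar>b i x - b i (ys i)\<bar> * \<bar>f i (ys i)\<bar>))"
      by (simp add: prod_ennreal)
    ultimately show "ennreal (\<Prod>i<m. \<bar>b i x - b i (ys i)\<bar> * \<bar>f i (ys i)\<bar>) * indicator (\<Pi>\<^sub>E i\<in>{..<m}. ball x t) ys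
        = (\<Prod>i<m. ennreal (\<bar>b i x - b i (ys i)\<bar> * \<bar>f i (ys i)\<bar>) * indicator (ball x t) (ys i))"
      by (simp only: prod.distrib)
  qed
  also have "\<dots> = (\<Prod>i<m. \<integral>\<^sup>+ y \<in> ball x t. ennreal (\<bar>b i x - b i y\<bar> * \<bar>f i y\<bar>) \<partial>lebesgue)"
  proof (intro product_nn_integral_prod)
    fix i assume "i \<in> {..<m}"
    then have [measurable]: "b i \<in> borel_measurable lebesgue" "f i \<in> borel_measurable lebesgue" using bm fm by auto
    show "(\<lambda>y. ennreal (\<bar>b i x - b i y\<bar> * \<bar>f i y\<bar>) * indicator (ball x t) y) \<in> borel_measurable lebesgue" by measurable
  qed simp
  finally show "(\<integral>\<^sup>+ ys \<in> (\<Pi>\<^sub>E i\<in>{..<m}. ball x t). ennreal (\<Prod>i<m. \<bar>b i x - b i (ys i)\<bar> * \<bar>f i (ys i)\<bar>) \<partial>(\<Pi>\<^sub>M i\<in>{..<m}. (lebesgue :: 'a measure)))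
     = (\<Prod>i<m. \<integral>\<^sup>+ y \<in> ball x t. ennreal (\<bar>b i x - b i y\<bar> * \<bar>f i y\<bar>) \<partial>lebesgue)" .
qed

lemma borel_measurable_commutator_kernel:
  assumes [measurable]: "b \<in> borel_measurable lebesgue" "f \<in> borel_measurable lebesgue"
  shows "(\<lambda>(x, y). ennreal (\<bar>b x - b y\<bar> * \<bar>f y\<bar>)) \<in> borel_measurable (lebesgue \<Otimes>\<^sub>M lebesgue)"
  by measurable

lemma borel_measurable_comm_max:
  assumes "b \<in> borel_measurable lebesgue" "f \<in> borel_measurable lebesgue" "0 \<le> s"
  shows "comm_max s b f \<in> borel_measurable lebesgue"
  using borel_measurable_frac_max[of "{()}" "\<lambda>_ x y. ennreal (\<bar>b x - b y\<bar> * \<bar>f y\<bar>)" s] borel_measurable_commutator_kernel[OF assms(1,2)] assms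
  unfolding comm_max_def[abs_def] by simp

text \<open>Covers a = 0, which occurs where the functions \<phi> vanish: there the inverse is
  \<open>top\<close>, and finiteness of N forces X = 0.\<close>

lemma ennreal_le_of_inverse_mult:
  fixes a N X :: ennreal
  assumes "inverse a * X \<le> N" "N < top" "a < top"
  shows "X \<le> N * a"
proof (cases "a = 0")
  case True
  then have "X = 0" using assms by (auto simp: ennreal_top_mult top_unique split: if_splits)
  then show ?thesis by simp
next
  case False
  have "a * (inverse a * X) \<le> a * N" using assms(1) by (rule mult_left_mono) simp
  moreover have "a * inverse a = 1"
    using False assms(3) by (metis divide_ennreal_def ennreal_divide_self)
  ultimately have "X \<le> a * N" by (simp add: mult.assoc[symmetric])
  then show ?thesis by (simp only: mult.commute)
qed

lemma ennreal_inverse_mult_le: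
  fixes a X R :: ennreal
  assumes "X \<le> R * a" "a < top"
  shows "inverse a * X \<le> R"
proof (cases "a = 0")
  case True
  then show ?thesis using assms by simp
next
  case False
  have "inverse a * X \<le> inverse a * (R * a)" using assms(1) by (rule mult_left_mono) simp
  moreover have "a * inverse a = 1"
    using False assms(2) by (metis divide_ennreal_def ennreal_divide_self)
  moreover have "inverse a * (R * a) = R * (a * inverse a)" by (simp only: ac_simps)
  ultimately show ?thesis by simp
qed

section \<open>Estimate on a single ball\<close>

context multi_weights
begin

text \<open>The exponents qq / q i sum to one, and \<open>u\<close> is the product of the
  \<open>w i\<close> raised to exactly these powers, so the integrand is a product to which
  Hoelder's inequality applies.\<close>

lemma product_Holder:
  assumes G: "\<And>i. i < m \<Longrightarrow> G i \<in> borel_measurable lebesgue" and E [measurable]: "E \<in> sets lebesgue"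
  shows "(\<integral>\<^sup>+ y \<in> E. enn_powr (\<Prod>i<m. G i y) qq * ennreal (u y) \<partial>lebesgue)
     \<le> enn_powr (\<Prod>i<m. enn_powr (\<integral>\<^sup>+ y \<in> E. enn_powr (G i y) (q i) * ennreal (w i y) \<partial>lebesgue) (1 / q i)) qq"
proof -
  have "(\<integral>\<^sup>+ y \<in> E. enn_powr (\<Prod>i<m. G i y) qq * ennreal (u y) \<partial>lebesgue)
      = (\<integral>\<^sup>+ y. (\<Prod>i<m. enn_powr (enn_powr (G i y) (q i) * ennreal (w i y) * indicator E y) (qq / q i)) \<partial>lebesgue)"
  proof (rule nn_integral_cong)
    fix y
    show "enn_powr (\<Prod>i<m. G i y) qq * ennreal (u y) * indicator E y = (\<Prod>i<m. enn_powr (enn_powr (G i y) (q i) * ennreal (w i y) * indicator E y) (qq / q i))"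
    proof (cases "y \<in> E")
      case True
      have "(\<Prod>i<m. enn_powr (enn_powr (G i y) (q i) * ennreal (w i y)) (qq / q i)) = (\<Prod>i<m. enn_powr (G i y) qq * ennreal (w i y powr (qq / q i)))"
      proof (intro prod.cong refl)
        fix i assume "i \<in> {..<m}"
        then have "q i \<noteq> 0" using q_pos[of i] by simp
        then show "enn_powr (enn_powr (G i y) (q i) * ennreal (w i y)) (qq / q i) = enn_powr (G i y) qq * ennreal (w i y powr (qq / q i))"
          by (simp add: enn_powr_mult enn_powr_powr enn_powr_ennreal w_def)
      qed
      also have "\<dots> = enn_powr (\<Prod>i<m. G i y) qq * ennreal (u y)"
        by (simp add: prod.distrib enn_powr_prod prod_ennreal u_eq)
      finally show ?thesis using True by simp
    next
      case False
      then show ?thesis using m0 by simp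
    qed
  qed
  also have "\<dots> \<le> (\<Prod>i<m. enn_powr (\<integral>\<^sup>+ y \<in> E. enn_powr (G i y) (q i) * ennreal (w i y) \<partial>lebesgue) (qq / q i))"
  proof (rule nn_integral_Holder)
    fix i assume i: "i \<in> {..<m}"
    then have [measurable]: "G i \<in> borel_measurable lebesgue" "w i \<in> borel_measurable lebesgue" using G w_meas by auto
    show "(\<lambda>y. enn_powr (G i y) (q i) * ennreal (w i y) * indicator E y) \<in> borel_measurable lebesgue" by measurable
    show "0 < qq / q i" using i q_pos qq_pos by auto
  qed (use m0 sum_qq in auto)
  also have "\<dots> = enn_powr (\<Prod>i<m. enn_powr (\<integral>\<^sup>+ y \<in> E. enn_powr (G i y) (q i) * ennreal (w i y) \<partial>lebesgue) (1 / q i)) qq"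
    by (simp add: enn_powr_prod enn_powr_powr)
  finally show ?thesis .
qed

text \<open>\<Lambda> collects everything that the Morrey norms and the condition on (\<phi>1,
  \<phi>2) contribute; \<open>hyp\<close> is the only information about them. On the ball the
  operator is at most \<open>PU\<close> + \<Lambda> \<open>PV\<close>, where \<open>PV\<close> no
  longer depends on the radius t.\<close>

lemma local_estimate:
  fixes b f :: "nat \<Rightarrow> 'a \<Rightarrow> real" and Cc \<beta> :: "nat \<Rightarrow> real" and \<Lambda> :: ennreal and x0 :: 'a and r D :: real
  assumes est: "\<And>i. i < m \<Longrightarrow> comm_estimates (Cc i) (p i) (q i) (\<omega> i)"
    and D: "0 < D" "\<And>x r. 0 < r \<Longrightarrow> (\<Prod>i<m. enn_powr (wmeas (w i) (ball x r)) (qq / q i)) \<le> ennreal D * wmeas u (ball x r)"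
    and b: "\<And>i. i < m \<Longrightarrow> in_BMO (b i)" and \<beta>: "\<And>i. i < m \<Longrightarrow> 0 < \<beta> i" "\<And>i. i < m \<Longrightarrow> bmo_norm (b i) \<le> ennreal (\<beta> i)"
    and f: "\<And>i. i < m \<Longrightarrow> f i \<in> borel_measurable lebesgue" and r: "0 < r"
  defines "F \<equiv> \<lambda>i \<tau>. enn_powr (\<integral>\<^sup>+ y \<in> ball x0 \<tau>. enn_powr (ennreal \<bar>f i y\<bar>) (p i) * ennreal (\<omega> i y powr p i) \<partial>lebesgue) (1 / p i)"
  defines "T \<equiv> \<lambda>x. SUP t\<in>{0<..}. ennreal (measure lebesgue (ball x t) powr (- (\<Sum>i<m. s i))) *
      (\<Prod>i<m. \<integral>\<^sup>+ y \<in> ball x t. ennreal (\<bar>b i x - b i y\<bar> * \<bar>f i y\<bar>) \<partial>lebesgue)"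
  assumes hyp: "\<And>\<tau>. r < \<tau> \<Longrightarrow> ennreal ((1 + ln (\<tau> / r)) ^ m) * (\<Prod>i<m. F i \<tau>) \<le> \<Lambda> * (\<Prod>i<m. enn_powr (wmeas (w i) (ball x0 \<tau>)) (1 / q i))"
  shows "enn_powr (\<integral>\<^sup>+ y \<in> ball x0 r. enn_powr (T y) qq * ennreal (u y) \<partial>lebesgue) (1 / qq)
     \<le> ennreal ((2 powr qq * 2) powr (1 / qq) * (\<Prod>i<m. Cc i powr (1 / q i) * Cc i powr (1 / q i) + Cc i * Cc i powr (1 / q i)) * D powr (1 / qq))
        * (\<Lambda> * (\<Prod>i<m. ennreal (\<beta> i)) * enn_powr (wmeas u (ball x0 r)) (1 / qq))"
proof -
  let ?B = "ball x0 r"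
  define E where "E i = Cc i powr (1 / q i)" for i
  have Cpos: "0 < Cc i" and Epos: "0 < E i" if "i < m" for i
    using est[OF that] by (auto simp: comm_estimates_def E_def)
  have bm: "b i \<in> borel_measurable lebesgue" if "i < m" for i using b[OF that] by (simp add: in_BMO_def)
  \<comment> \<open>For x in the ball and t < r, the ball of radius t around x stays inside the
    doubled ball, so the cut-off does not change averages over such radii.\<close>
  define f2 where "f2 i y = f i y * indicator (ball x0 (2 * r)) y" for i y
  have f2m: "f2 i \<in> borel_measurable lebesgue" if "i < m" for i
    using f[OF that] unfolding f2_def[abs_def] by measurable
  define U where "U i = comm_max (s i) (b i) (f2 i)" for i
  define V where "V i x = ennreal (Cc i * (\<bar>b i x - ball_avg (b i) x0 r\<bar> + \<beta> i))" for i x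
  have Um: "U i \<in> borel_measurable lebesgue" if "i < m" for i
    unfolding U_def using that ex(1)[OF that that] by (intro borel_measurable_comm_max bm f2m) auto
  have Vm: "V i \<in> borel_measurable lebesgue" if "i < m" for i
    unfolding V_def[abs_def] using bm[OF that] by measurable
  define PU where "PU y = (\<Prod>i<m. U i y)" for y
  define PV where "PV y = (\<Prod>i<m. V i y)" for y
  have [measurable]: "PU \<in> borel_measurable lebesgue" "PV \<in> borel_measurable lebesgue"
    unfolding PU_def[abs_def] PV_def[abs_def] using Um Vm by (auto intro!: borel_measurable_prod_ennreal)
  have [measurable]: "u \<in> borel_measurable lebesgue"
  proof -
    have "(\<lambda>y. \<Prod>i<m. \<omega> i y) \<in> borel_measurable lebesgue" using om_meas by (intro borel_measurable_prod) auto
    then show ?thesis unfolding u_def[abs_def] by measurable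
  qed
  define wr where "wr \<tau> = (\<Prod>i<m. enn_powr (wmeas (w i) (ball x0 \<tau>)) (1 / q i))" for \<tau>
  have wr_pos: "wr \<tau> \<noteq> 0" "wr \<tau> \<noteq> top" if "0 < \<tau>" for \<tau>
  proof -
    have "wmeas (w i) (ball x0 \<tau>) \<noteq> 0 \<and> wmeas (w i) (ball x0 \<tau>) \<noteq> top" if "i < m" for i
      using weight_ball[OF weight_w[OF that] \<open>0 < \<tau>\<close>, of x0] by auto
    then show "wr \<tau> \<noteq> 0" "wr \<tau> \<noteq> top" by (auto simp: wr_def ennreal_prod_eq_top)
  qed
  have ptw: "T x \<le> PU x + \<Lambda> * PV x" if x: "x \<in> ?B" for x
    unfolding T_def
  proof (rule SUP_least)
    fix t :: real assume "t \<in> {0<..}"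
    then have t: "0 < t" by simp
    define \<Phi> where "\<Phi> i = (\<integral>\<^sup>+ y \<in> ball x t. ennreal (\<bar>b i x - b i y\<bar> * \<bar>f i y\<bar>) \<partial>lebesgue)" for i
    define M where "M = measure lebesgue (ball x t)"
    have M: "0 < M" using t by (simp add: M_def content_ball_pos)
    have "ennreal (M powr (- (\<Sum>i<m. s i))) * (\<Prod>i<m. \<Phi> i) = (\<Prod>i<m. ennreal (M powr (- s i)) * \<Phi> i)"
      using M by (simp add: prod.distrib prod_ennreal sum_negf[symmetric] powr_sum)
    also have "\<dots> \<le> PU x + \<Lambda> * PV x"
    proof (cases "t < r")
      case True
      have "ennreal (M powr (- s i)) * \<Phi> i \<le> U i x" for i
      proof -
        have "\<Phi> i = (\<integral>\<^sup>+ y \<in> ball x t. ennreal (\<bar>b i x - b i y\<bar> * \<bar>f2 i y\<bar>) \<partial>lebesgue)"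
          unfolding \<Phi>_def
        proof (intro nn_integral_cong)
          fix y
          show "ennreal (\<bar>b i x - b i y\<bar> * \<bar>f i y\<bar>) * indicator (ball x t) y = ennreal (\<bar>b i x - b i y\<bar> * \<bar>f2 i y\<bar>) * indicator (ball x t) y"
          proof (cases "y \<in> ball x t")
            case y: True
            then have "y \<in> ball x0 (2 * r)" using x True dist_triangle[of x0 y x] by simp
            then show ?thesis by (simp add: f2_def)
          qed simp
        qed
        then show ?thesis unfolding U_def comm_max_def M_def using t by (auto intro!: SUP_upper2[of t])
      qed
      then have "(\<Prod>i<m. ennreal (M powr (- s i)) * \<Phi> i) \<le> PU x" unfolding PU_def by (intro prod_mono_ennreal)
      then show ?thesis by (simp add: add_increasing2)
    next
      case False
      then have rt: "r \<le> t" by simp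
      define \<tau> where "\<tau> = 2 * t"
      have tau: "r < \<tau>" "0 < \<tau>" using rt r by (auto simp: \<tau>_def)
      define L where "L = 1 + ln (\<tau> / r)"
      have L: "1 \<le> L" using tau r by (simp add: L_def)
      have each: "ennreal (M powr (- s i)) * \<Phi> i * enn_powr (wmeas (w i) (ball x0 \<tau>)) (1 / q i) \<le> ennreal L * F i \<tau> * V i x" if i: "i < m" for i
      proof -
        have "ennreal (M powr (- s i)) * \<Phi> i * enn_powr (wmeas (w i) (ball x0 \<tau>)) (1 / q i)
           \<le> ennreal (Cc i * L * (\<bar>b i x - ball_avg (b i) x0 r\<bar> + \<beta> i)) * F i \<tau>"
          using est[OF i] b[OF i] \<beta>[OF i] f[OF i] r x rt
          unfolding comm_estimates_def M_def \<Phi>_def s_def w_def[abs_def] \<tau>_def L_def F_def by blast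
        also have "ennreal (Cc i * L * (\<bar>b i x - ball_avg (b i) x0 r\<bar> + \<beta> i)) = ennreal L * V i x"
          unfolding V_def using L Cpos[OF i] \<beta>(1)[OF i] by (subst ennreal_mult[symmetric]) (auto simp: ac_simps)
        finally show ?thesis by (simp only: ac_simps)
      qed
      have "(\<Prod>i<m. ennreal (M powr (- s i)) * \<Phi> i) * wr \<tau> = (\<Prod>i<m. ennreal (M powr (- s i)) * \<Phi> i * enn_powr (wmeas (w i) (ball x0 \<tau>)) (1 / q i))"
        by (simp add: wr_def prod.distrib)
      \<comment> \<open>Each index contributes one logarithm. Their product L^m is the power in
        \<open>hyp\<close>, which trades the product of the local norms for \<Lambda>
        \<open>wr \<tau>\<close>; then \<open>wr \<tau>\<close> cancels.\<close>
      also have "\<dots> \<le> (\<Prod>i<m. ennreal L * F i \<tau> * V i x)" by (intro prod_mono_ennreal each) simp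
      also have "\<dots> = ennreal (L ^ m) * (\<Prod>i<m. F i \<tau>) * PV x"
        using L by (simp add: prod.distrib PV_def ennreal_power)
      also have "\<dots> \<le> \<Lambda> * wr \<tau> * PV x"
        unfolding L_def wr_def by (intro mult_right_mono hyp tau) simp
      finally have "wr \<tau> * (\<Prod>i<m. ennreal (M powr (- s i)) * \<Phi> i) \<le> wr \<tau> * (\<Lambda> * PV x)" by (simp only: ac_simps)
      then have "(\<Prod>i<m. ennreal (M powr (- s i)) * \<Phi> i) \<le> \<Lambda> * PV x"
        using wr_pos[OF tau(2)] by (auto intro: ennreal_mult_le_imp_le)
      then show ?thesis by (simp add: add_increasing)
    qed
    finally show "ennreal (measure lebesgue (ball x t) powr (- (\<Sum>i<m. s i))) * (\<Prod>i<m. \<integral>\<^sup>+ y \<in> ball x t. ennreal (\<bar>b i x - b i y\<bar> * \<bar>f i y\<bar>) \<partial>lebesgue) \<le> PU x + \<Lambda> * PV x"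
      by (simp add: M_def \<Phi>_def)
  qed
  define P1 where "P1 = (\<Prod>i<m. ennreal (\<beta> i))"
  \<comment> \<open>Near part: one \<open>E i\<close> from the operator bound and one from doubling.
    Far part: \<open>Cc i\<close> from the pointwise estimate and \<open>E i\<close> from the power
    moment. The sum dominates both, so one constant serves for both pieces.\<close>
  define c where "c = (\<Prod>i<m. E i * E i + Cc i * E i)"
  have c_nonneg: "0 \<le> E i * E i" "0 \<le> Cc i * E i" if "i < m" for i using Cpos[OF that] Epos[OF that] by auto
  have c0: "0 \<le> c" unfolding c_def using c_nonneg by (intro prod_nonneg) (force intro: add_nonneg_nonneg)
  have c_eq: "ennreal c = (\<Prod>i<m. ennreal (E i * E i + Cc i * E i))"
    unfolding c_def using c_nonneg by (intro prod_ennreal[symmetric]) (force intro: add_nonneg_nonneg)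
  define Z where "Z = \<Lambda> * P1 * wr r"
  have claimU: "(\<integral>\<^sup>+ y \<in> ?B. enn_powr (PU y) qq * ennreal (u y) \<partial>lebesgue) \<le> enn_powr (ennreal c * Z) qq"
  proof -
    have each: "enn_powr (\<integral>\<^sup>+ y \<in> ?B. enn_powr (U i y) (q i) * ennreal (w i y) \<partial>lebesgue) (1 / q i) \<le> ennreal (E i) * ennreal (\<beta> i) * F i (2 * r)" if i: "i < m" for i
    proof -
      have "(\<integral>\<^sup>+ y \<in> ?B. enn_powr (U i y) (q i) * ennreal (w i y) \<partial>lebesgue) \<le> (\<integral>\<^sup>+ y. enn_powr (U i y) (q i) * ennreal (\<omega> i y powr q i) \<partial>lebesgue)"
        by (intro nn_integral_mono) (auto simp: indicator_def w_def)
      also have "\<dots> \<le> ennreal (Cc i * \<beta> i powr q i) * enn_powr (\<integral>\<^sup>+ y. enn_powr (ennreal \<bar>f2 i y\<bar>) (p i) * ennreal (\<omega> i y powr p i) \<partial>lebesgue) (q i / p i)"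
        using est[OF i] b[OF i] \<beta>[OF i] f2m[OF i] unfolding comm_estimates_def U_def s_def by blast
      also have "(\<integral>\<^sup>+ y. enn_powr (ennreal \<bar>f2 i y\<bar>) (p i) * ennreal (\<omega> i y powr p i) \<partial>lebesgue)
         = (\<integral>\<^sup>+ y \<in> ball x0 (2 * r). enn_powr (ennreal \<bar>f i y\<bar>) (p i) * ennreal (\<omega> i y powr p i) \<partial>lebesgue)"
        by (intro nn_integral_cong) (auto simp: f2_def indicator_def)
      finally have "enn_powr (\<integral>\<^sup>+ y \<in> ?B. enn_powr (U i y) (q i) * ennreal (w i y) \<partial>lebesgue) (1 / q i)
         \<le> enn_powr (ennreal (Cc i * \<beta> i powr q i) * enn_powr (\<integral>\<^sup>+ y \<in> ball x0 (2 * r). enn_powr (ennreal \<bar>f i y\<bar>) (p i) * ennreal (\<omega> i y powr p i) \<partial>lebesgue) (q i / p i)) (1 / q i)"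
        using q_pos[OF i] by (intro enn_powr_mono) auto
      also have "\<dots> = ennreal (E i) * ennreal (\<beta> i) * F i (2 * r)"
        using Cpos[OF i] \<beta>(1)[OF i] q_pos[OF i]
        by (simp add: enn_powr_mult enn_powr_ennreal enn_powr_powr powr_mult powr_powr ennreal_mult E_def F_def)
      finally show ?thesis .
    qed
    have dbl: "wr (2 * r) \<le> (\<Prod>i<m. ennreal (E i)) * wr r"
    proof -
      have "enn_powr (wmeas (w i) (ball x0 (2 * r))) (1 / q i) \<le> ennreal (E i) * enn_powr (wmeas (w i) (ball x0 r)) (1 / q i)" if i: "i < m" for i
      proof -
        have "wmeas (w i) (ball x0 (2 * r)) \<le> ennreal (Cc i) * wmeas (w i) (ball x0 r)"
          using est[OF i] r unfolding comm_estimates_def w_def[abs_def] by blast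
        then have "enn_powr (wmeas (w i) (ball x0 (2 * r))) (1 / q i) \<le> enn_powr (ennreal (Cc i) * wmeas (w i) (ball x0 r)) (1 / q i)"
          using q_pos[OF i] by (intro enn_powr_mono) auto
        then show ?thesis using Cpos[OF i] by (simp add: enn_powr_mult enn_powr_ennreal E_def)
      qed
      then show ?thesis unfolding wr_def prod.distrib[symmetric] by (intro prod_mono_ennreal) simp
    qed
    \<comment> \<open>The near part also uses \<open>hyp\<close>, at \<tau> = 2r, where the
      logarithmic factor is at least one and may be dropped.\<close>
    have F2: "(\<Prod>i<m. F i (2 * r)) \<le> \<Lambda> * wr (2 * r)"
    proof -
      have "0 \<le> ln (2 * r / r)" using r by simp
      then have "(1::real) \<le> (1 + ln (2 * r / r)) ^ m" by (intro one_le_power) simp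
      then have "ennreal 1 * (\<Prod>i<m. F i (2 * r)) \<le> ennreal ((1 + ln (2 * r / r)) ^ m) * (\<Prod>i<m. F i (2 * r))"
        by (intro mult_right_mono ennreal_leI) auto
      also have "\<dots> \<le> \<Lambda> * wr (2 * r)" unfolding wr_def using r by (intro hyp) simp
      finally show ?thesis by simp
    qed
    have "(\<integral>\<^sup>+ y \<in> ?B. enn_powr (PU y) qq * ennreal (u y) \<partial>lebesgue)
        \<le> enn_powr (\<Prod>i<m. enn_powr (\<integral>\<^sup>+ y \<in> ?B. enn_powr (U i y) (q i) * ennreal (w i y) \<partial>lebesgue) (1 / q i)) qq"
      unfolding PU_def by (rule product_Holder) (auto intro: Um)
    also have "\<dots> \<le> enn_powr (\<Prod>i<m. ennreal (E i) * ennreal (\<beta> i) * F i (2 * r)) qq"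
      using qq_pos by (intro enn_powr_mono prod_mono_ennreal each) auto
    also have "(\<Prod>i<m. ennreal (E i) * ennreal (\<beta> i) * F i (2 * r)) = (\<Prod>i<m. ennreal (E i)) * P1 * (\<Prod>i<m. F i (2 * r))"
      by (simp add: prod.distrib P1_def)
    also have "enn_powr \<dots> qq \<le> enn_powr (ennreal c * Z) qq"
    proof (rule enn_powr_mono)
      have "(\<Prod>i<m. ennreal (E i)) * P1 * (\<Prod>i<m. F i (2 * r)) \<le> (\<Prod>i<m. ennreal (E i)) * P1 * (\<Lambda> * ((\<Prod>i<m. ennreal (E i)) * wr r))"
        by (intro mult_left_mono order_trans[OF F2] dbl) auto
      also have "\<dots> = (\<Prod>i<m. ennreal (E i)) * (\<Prod>i<m. ennreal (E i)) * Z"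
        unfolding Z_def by (simp only: ac_simps)
      also have "\<dots> \<le> ennreal c * Z"
        unfolding c_eq prod.distrib[symmetric]
      proof (intro mult_right_mono prod_mono_ennreal)
        fix i assume "i \<in> {..<m}"
        then have "i < m" by simp
        then show "ennreal (E i) * ennreal (E i) \<le> ennreal (E i * E i + Cc i * E i)"
          using c_nonneg[of i] Epos[of i] by (subst ennreal_mult[symmetric]) (auto intro!: ennreal_leI)
      qed simp
      finally show "(\<Prod>i<m. ennreal (E i)) * P1 * (\<Prod>i<m. F i (2 * r)) \<le> ennreal c * Z" .
    qed (use qq_pos in simp)
    finally show ?thesis .
  qed
  have claimV: "(\<integral>\<^sup>+ y \<in> ?B. enn_powr (\<Lambda> * PV y) qq * ennreal (u y) \<partial>lebesgue) \<le> enn_powr (ennreal c * Z) qq"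
  proof -
    have each: "enn_powr (\<integral>\<^sup>+ y \<in> ?B. enn_powr (V i y) (q i) * ennreal (w i y) \<partial>lebesgue) (1 / q i)
        \<le> ennreal (Cc i * E i) * ennreal (\<beta> i) * enn_powr (wmeas (w i) ?B) (1 / q i)" if i: "i < m" for i
    proof -
      note [measurable] = bm[OF i] om_meas[OF i]
      have Vq: "enn_powr (V i y) (q i) = ennreal (Cc i powr q i) * ennreal ((\<bar>b i y - ball_avg (b i) x0 r\<bar> + \<beta> i) powr q i)" for y
        unfolding V_def using Cpos[OF i] \<beta>(1)[OF i] by (subst enn_powr_ennreal) (auto simp: powr_mult ennreal_mult)
      have "(\<integral>\<^sup>+ y \<in> ?B. enn_powr (V i y) (q i) * ennreal (w i y) \<partial>lebesgue)
         = (\<integral>\<^sup>+ y. ennreal (Cc i powr q i) * (ennreal ((\<bar>b i y - ball_avg (b i) x0 r\<bar> + \<beta> i) powr q i) * ennreal (\<omega> i y powr q i) * indicator ?B y) \<partial>lebesgue)"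
        by (intro nn_integral_cong) (simp only: Vq w_def mult.assoc)
      also have "\<dots> = ennreal (Cc i powr q i) * (\<integral>\<^sup>+ y \<in> ?B. ennreal ((\<bar>b i y - ball_avg (b i) x0 r\<bar> + \<beta> i) powr q i) * ennreal (\<omega> i y powr q i) \<partial>lebesgue)"
        by (intro nn_integral_cmult) measurable
      also have "\<dots> \<le> ennreal (Cc i powr q i) * (ennreal (Cc i * \<beta> i powr q i) * wmeas (\<lambda>y. \<omega> i y powr q i) ?B)"
        using est[OF i] b[OF i] \<beta>[OF i] r unfolding comm_estimates_def by (intro mult_left_mono) auto
      finally have "enn_powr (\<integral>\<^sup>+ y \<in> ?B. enn_powr (V i y) (q i) * ennreal (w i y) \<partial>lebesgue) (1 / q i)
         \<le> enn_powr (ennreal (Cc i powr q i) * (ennreal (Cc i * \<beta> i powr q i) * wmeas (w i) ?B)) (1 / q i)"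
        using q_pos[OF i] by (intro enn_powr_mono) (auto simp: w_def[abs_def])
      also have "\<dots> = ennreal (Cc i * E i) * ennreal (\<beta> i) * enn_powr (wmeas (w i) ?B) (1 / q i)"
        using Cpos[OF i] \<beta>(1)[OF i] q_pos[OF i]
        by (simp add: enn_powr_mult enn_powr_ennreal powr_mult powr_powr ennreal_mult E_def mult.assoc)
      finally show ?thesis .
    qed
    have "(\<integral>\<^sup>+ y \<in> ?B. enn_powr (\<Lambda> * PV y) qq * ennreal (u y) \<partial>lebesgue) = (\<integral>\<^sup>+ y. enn_powr \<Lambda> qq * (enn_powr (PV y) qq * ennreal (u y) * indicator ?B y) \<partial>lebesgue)"
      by (simp add: enn_powr_mult mult.assoc)
    also have "\<dots> = enn_powr \<Lambda> qq * (\<integral>\<^sup>+ y \<in> ?B. enn_powr (PV y) qq * ennreal (u y) \<partial>lebesgue)"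
      by (intro nn_integral_cmult) measurable
    also have "\<dots> \<le> enn_powr \<Lambda> qq * enn_powr (\<Prod>i<m. enn_powr (\<integral>\<^sup>+ y \<in> ?B. enn_powr (V i y) (q i) * ennreal (w i y) \<partial>lebesgue) (1 / q i)) qq"
      unfolding PV_def by (intro mult_left_mono product_Holder Vm) auto
    also have "\<dots> \<le> enn_powr \<Lambda> qq * enn_powr (\<Prod>i<m. ennreal (Cc i * E i) * ennreal (\<beta> i) * enn_powr (wmeas (w i) ?B) (1 / q i)) qq"
      using qq_pos by (intro mult_left_mono enn_powr_mono prod_mono_ennreal each) auto
    also have "\<dots> = enn_powr ((\<Prod>i<m. ennreal (Cc i * E i)) * Z) qq"
    proof -
      have "\<Lambda> * (\<Prod>i<m. ennreal (Cc i * E i) * ennreal (\<beta> i) * enn_powr (wmeas (w i) ?B) (1 / q i)) = (\<Prod>i<m. ennreal (Cc i * E i)) * Z"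
        unfolding prod.distrib Z_def P1_def wr_def by (simp only: ac_simps)
      then show ?thesis by (simp only: enn_powr_mult[symmetric])
    qed
    also have "\<dots> \<le> enn_powr (ennreal c * Z) qq"
      unfolding c_eq using qq_pos c_nonneg by (intro enn_powr_mono mult_right_mono prod_mono_ennreal ennreal_leI) auto
    finally show ?thesis .
  qed
  have "(\<integral>\<^sup>+ y \<in> ?B. enn_powr (T y) qq * ennreal (u y) \<partial>lebesgue)
      \<le> (\<integral>\<^sup>+ y. ennreal (2 powr qq) * (enn_powr (PU y) qq * ennreal (u y) * indicator ?B y + enn_powr (\<Lambda> * PV y) qq * ennreal (u y) * indicator ?B y) \<partial>lebesgue)"
  proof (rule nn_integral_mono)
    fix y
    show "enn_powr (T y) qq * ennreal (u y) * indicator ?B y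
       \<le> ennreal (2 powr qq) * (enn_powr (PU y) qq * ennreal (u y) * indicator ?B y + enn_powr (\<Lambda> * PV y) qq * ennreal (u y) * indicator ?B y)"
    proof (cases "y \<in> ?B")
      case True
      have "enn_powr (T y) qq \<le> enn_powr (PU y + \<Lambda> * PV y) qq" using qq_pos by (intro enn_powr_mono ptw True) simp
      also have "\<dots> \<le> ennreal (2 powr qq) * (enn_powr (PU y) qq + enn_powr (\<Lambda> * PV y) qq)" using qq_pos by (intro enn_powr_add_le) simp
      finally have "enn_powr (T y) qq * ennreal (u y) \<le> ennreal (2 powr qq) * (enn_powr (PU y) qq + enn_powr (\<Lambda> * PV y) qq) * ennreal (u y)"
        by (rule mult_right_mono) simp
      then show ?thesis using True by (simp add: distrib_right distrib_left mult.assoc)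
    qed simp
  qed
  also have "\<dots> = ennreal (2 powr qq) * ((\<integral>\<^sup>+ y \<in> ?B. enn_powr (PU y) qq * ennreal (u y) \<partial>lebesgue) + (\<integral>\<^sup>+ y \<in> ?B. enn_powr (\<Lambda> * PV y) qq * ennreal (u y) \<partial>lebesgue))"
    by (subst nn_integral_cmult) (auto simp: nn_integral_add)
  also have "\<dots> \<le> ennreal (2 powr qq) * (enn_powr (ennreal c * Z) qq + enn_powr (ennreal c * Z) qq)"
    by (intro mult_left_mono add_mono claimU claimV) auto
  also have "\<dots> = ennreal (2 powr qq * 2) * enn_powr (ennreal c * Z) qq"
    by (simp add: mult_2[symmetric] ennreal_mult mult.assoc)
  finally have "enn_powr (\<integral>\<^sup>+ y \<in> ?B. enn_powr (T y) qq * ennreal (u y) \<partial>lebesgue) (1 / qq) \<le> enn_powr (ennreal (2 powr qq * 2) * enn_powr (ennreal c * Z) qq) (1 / qq)"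
    using qq_pos by (intro enn_powr_mono) auto
  also have "\<dots> = ennreal ((2 powr qq * 2) powr (1 / qq)) * (ennreal c * Z)"
    using qq_pos by (simp add: enn_powr_mult[of "ennreal (2 powr qq * 2)"] enn_powr_cancel enn_powr_ennreal)
  also have "\<dots> = ennreal ((2 powr qq * 2) powr (1 / qq)) * ennreal c * (\<Lambda> * P1) * wr r"
    unfolding Z_def by (simp only: ac_simps)
  also have "\<dots> \<le> ennreal ((2 powr qq * 2) powr (1 / qq)) * ennreal c * (\<Lambda> * P1) * (ennreal (D powr (1 / qq)) * enn_powr (wmeas u ?B) (1 / qq))"
  proof (intro mult_left_mono)
    \<comment> \<open>The geometric mean inequality enters once more: Hoelder's inequality leaves a
      product of the measures of the \<open>w i\<close>, whereas the target norm is normalised by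
      the measure of \<open>u\<close>.\<close>
    have "wr r = enn_powr (\<Prod>i<m. enn_powr (wmeas (w i) ?B) (qq / q i)) (1 / qq)"
      unfolding wr_def using qq_pos by (simp add: enn_powr_prod enn_powr_powr)
    also have "\<dots> \<le> enn_powr (ennreal D * wmeas u ?B) (1 / qq)" using qq_pos by (intro enn_powr_mono D r) simp
    also have "\<dots> = ennreal (D powr (1 / qq)) * enn_powr (wmeas u ?B) (1 / qq)" using D by (simp add: enn_powr_mult enn_powr_ennreal)
    finally show "wr r \<le> ennreal (D powr (1 / qq)) * enn_powr (wmeas u ?B) (1 / qq)" .
  qed simp
  also have "\<dots> = ennreal ((2 powr qq * 2) powr (1 / qq)) * ennreal c * ennreal (D powr (1 / qq)) * (\<Lambda> * P1 * enn_powr (wmeas u ?B) (1 / qq))"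
    by (simp only: ac_simps)
  also have "ennreal ((2 powr qq * 2) powr (1 / qq)) * ennreal c * ennreal (D powr (1 / qq)) = ennreal ((2 powr qq * 2) powr (1 / qq) * c * D powr (1 / qq))"
    using c0 by (simp add: ennreal_mult)
  finally show ?thesis unfolding c_def E_def P1_def .
qed

end

section \<open>Morrey norms and the condition on the pair of functions\<close>

context multi_weights
begin

text \<open>As p < q, \<omega>^p <= 1 + \<omega>^q, so local integrability is inherited from
  \<omega>^q.\<close>

lemma wmeas_om_powr_p:
  assumes i: "i < m" and \<tau>: "0 < \<tau>"
  shows "wmeas (\<lambda>y. \<omega> i y powr p i) (ball x \<tau>) < top" "0 < wmeas (\<lambda>y. \<omega> i y powr p i) (ball x \<tau>)"
proof -
  note [measurable] = om_meas[OF i] w_meas[OF i]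
  have le: "\<omega> i y powr p i \<le> 1 + w i y" for y
  proof (cases "\<omega> i y \<le> 1")
    case True
    then have "\<omega> i y powr p i \<le> 1 powr p i" using om0[OF i] p1[OF i] by (intro powr_mono2) auto
    moreover have "0 \<le> w i y" by (simp add: w_def)
    ultimately show ?thesis by simp
  next
    case False
    then have "\<omega> i y powr p i \<le> w i y" using pq[OF i] unfolding w_def by (intro powr_mono) auto
    then show ?thesis by simp
  qed
  have "wmeas (\<lambda>y. \<omega> i y powr p i) (ball x \<tau>) \<le> (\<integral>\<^sup>+ y. indicator (ball x \<tau>) y + ennreal (w i y) * indicator (ball x \<tau>) y \<partial>lebesgue)"
    unfolding wmeas_def
  proof (intro nn_integral_mono)
    fix y
    have "ennreal (\<omega> i y powr p i) \<le> ennreal (1 + w i y)" using le by (rule ennreal_leI)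
    also have "\<dots> = 1 + ennreal (w i y)" by (simp add: w_def)
    finally show "ennreal (\<omega> i y powr p i) * indicator (ball x \<tau>) y \<le> indicator (ball x \<tau>) y + ennreal (w i y) * indicator (ball x \<tau>) y"
      by (auto simp: indicator_def)
  qed
  also have "\<dots> = ball_meas x \<tau> + wmeas (w i) (ball x \<tau>)"
    by (subst nn_integral_add) (auto simp: ball_meas_def wmeas_def)
  also have "\<dots> < top"
    using ball_meas_finite[of x \<tau>] weight_ball(1)[OF weight_w[OF i] \<tau>, of x] by simp
  finally show "wmeas (\<lambda>y. \<omega> i y powr p i) (ball x \<tau>) < top" .
  have "AE y in lebesgue. 0 < \<omega> i y powr p i" using om_pos[OF i] by eventually_elim simp
  then show "0 < wmeas (\<lambda>y. \<omega> i y powr p i) (ball x \<tau>)" by (rule wmeas_pos_AE[rotated]) (use \<tau> in auto)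
qed

text \<open>Finite by Hoelder's inequality for constant functions; positive by the geometric mean
  inequality.\<close>

lemma wmeas_u:
  assumes r: "0 < r"
  shows "wmeas u (ball x r) < top" "0 < wmeas u (ball x r)"
proof -
  have fin: "wmeas (w i) (ball x r) \<noteq> 0 \<and> wmeas (w i) (ball x r) \<noteq> top" if "i < m" for i
    using weight_ball[OF weight_w[OF that] r, of x] by auto
  have "wmeas u (ball x r) \<le> enn_powr (\<Prod>i<m. enn_powr (wmeas (w i) (ball x r)) (1 / q i)) qq"
    using product_Holder[of "\<lambda>_ _. 1" "ball x r"] by (simp add: wmeas_def)
  also have "\<dots> < top" using fin by (auto simp: less_top[symmetric] ennreal_prod_eq_top)
  finally show "wmeas u (ball x r) < top" .
  obtain D where D: "0 < D" "\<And>x r. 0 < r \<Longrightarrow> (\<Prod>i<m. enn_powr (wmeas (w i) (ball x r)) (qq / q i)) \<le> ennreal D * wmeas u (ball x r)"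
    using geometric_mean by auto
  have "(\<Prod>i<m. enn_powr (wmeas (w i) (ball x r)) (qq / q i)) \<noteq> 0" using fin by auto
  then have "ennreal D * wmeas u (ball x r) \<noteq> 0" using D(2)[OF r, of x] by auto
  then show "0 < wmeas u (ball x r)" by (auto simp: zero_less_iff_neq_zero)
qed

text \<open>The local norms increase with the radius. Their product at \<tau> is thus bounded
  through the Morrey norms at every \<eta> > \<tau>, hence by the essential infimum over these
  \<eta>; this is the quantity that \<open>A_prime_const\<close> controls.\<close>

lemma morrey_product_bound:
  fixes f :: "nat \<Rightarrow> 'a \<Rightarrow> real" and \<phi>1 :: "nat \<Rightarrow> 'a \<Rightarrow> real \<Rightarrow> real" and \<phi>2 :: "'a \<Rightarrow> real \<Rightarrow> real" and x0 :: 'a and r \<tau> :: real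
  defines "N \<equiv> \<lambda>i. morrey_norm (p i) (\<phi>1 i) (\<lambda>y. \<omega> i y powr p i) (\<lambda>y. ennreal \<bar>f i y\<bar>)"
  defines "A \<equiv> A_prime_const m p q \<omega> \<phi>1 \<phi>2"
  defines "F \<equiv> \<lambda>i \<tau>. enn_powr (\<integral>\<^sup>+ y \<in> ball x0 \<tau>. enn_powr (ennreal \<bar>f i y\<bar>) (p i) * ennreal (\<omega> i y powr p i) \<partial>lebesgue) (1 / p i)"
  assumes A: "A < top" and N: "\<And>i. i < m \<Longrightarrow> N i < top" and r: "0 < r" "r < \<tau>"
  shows "ennreal ((1 + ln (\<tau> / r)) ^ m) * (\<Prod>i<m. F i \<tau>)
     \<le> (A * ennreal (\<phi>2 x0 r) * (\<Prod>i<m. N i)) * (\<Prod>i<m. enn_powr (wmeas (w i) (ball x0 \<tau>)) (1 / q i))"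
proof -
  define g where "g \<eta> = (\<Prod>i<m. ennreal (\<phi>1 i x0 \<eta>) *
             enn_powr (\<integral>\<^sup>+ y \<in> ball x0 \<eta>. ennreal (\<omega> i y powr p i) \<partial>lebesgue) (1 / p i))" for \<eta>
  define W where "W = (\<Prod>i<m. enn_powr (wmeas (w i) (ball x0 \<tau>)) (1 / q i))"
  define Le where "Le = ennreal ((1 + ln (\<tau> / r)) ^ m)"
  define Ei where "Ei = ess_inf_on {\<tau><..} g"
  have tau: "0 < \<tau>" using r by simp
  have W: "W \<noteq> 0" "W \<noteq> top"
  proof -
    have "wmeas (w i) (ball x0 \<tau>) \<noteq> 0 \<and> wmeas (w i) (ball x0 \<tau>) \<noteq> top" if "i < m" for i
      using weight_ball[OF weight_w[OF that] tau, of x0] by auto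
    then show "W \<noteq> 0" "W \<noteq> top" by (auto simp: W_def ennreal_prod_eq_top)
  qed
  have Fg: "(\<Prod>i<m. F i \<tau>) \<le> (\<Prod>i<m. N i) * g \<eta>" if eta: "\<tau> < \<eta>" for \<eta>
  proof -
    have "F i \<tau> \<le> N i * (ennreal (\<phi>1 i x0 \<eta>) * enn_powr (\<integral>\<^sup>+ y \<in> ball x0 \<eta>. ennreal (\<omega> i y powr p i) \<partial>lebesgue) (1 / p i))" if i: "i < m" for i
    proof -
      have e0: "0 < \<eta>" using eta tau by simp
      have "F i \<tau> \<le> F i \<eta>"
        unfolding F_def using eta p1[OF i] by (intro enn_powr_mono nn_integral_mono) (auto simp: indicator_def)
      also have "F i \<eta> \<le> N i * (ennreal (\<phi>1 i x0 \<eta>) * enn_powr (wmeas (\<lambda>y. \<omega> i y powr p i) (ball x0 \<eta>)) (1 / p i))"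
      proof (rule ennreal_le_of_inverse_mult)
        have "inverse (ennreal (\<phi>1 i (fst (x0, \<eta>)) (snd (x0, \<eta>)))) *
            inverse (enn_powr (wmeas (\<lambda>y. \<omega> i y powr p i) (ball (fst (x0, \<eta>)) (snd (x0, \<eta>)))) (1 / p i)) *
            enn_powr (\<integral>\<^sup>+ y \<in> ball (fst (x0, \<eta>)) (snd (x0, \<eta>)). enn_powr (ennreal \<bar>f i y\<bar>) (p i) * ennreal (\<omega> i y powr p i) \<partial>lebesgue) (1 / p i) \<le> N i"
          unfolding N_def morrey_norm_def using e0 by (intro SUP_upper) simp
        moreover have "inverse (ennreal (\<phi>1 i x0 \<eta>) * enn_powr (wmeas (\<lambda>y. \<omega> i y powr p i) (ball x0 \<eta>)) (1 / p i))
           = inverse (ennreal (\<phi>1 i x0 \<eta>)) * inverse (enn_powr (wmeas (\<lambda>y. \<omega> i y powr p i) (ball x0 \<eta>)) (1 / p i))"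
          using wmeas_om_powr_p[OF i e0, of x0] by (intro ennreal_inverse_mult) auto
        ultimately show "inverse (ennreal (\<phi>1 i x0 \<eta>) * enn_powr (wmeas (\<lambda>y. \<omega> i y powr p i) (ball x0 \<eta>)) (1 / p i)) * F i \<eta> \<le> N i"
          by (simp add: F_def)
        show "ennreal (\<phi>1 i x0 \<eta>) * enn_powr (wmeas (\<lambda>y. \<omega> i y powr p i) (ball x0 \<eta>)) (1 / p i) < top"
          using wmeas_om_powr_p[OF i e0, of x0] by (simp add: ennreal_mult_less_top)
      qed (rule N[OF i])
      finally show ?thesis by (simp add: wmeas_def)
    qed
    then show ?thesis unfolding g_def prod.distrib[symmetric] by (intro prod_mono_ennreal) simp
  qed
  have FE: "(\<Prod>i<m. F i \<tau>) \<le> (\<Prod>i<m. N i) * Ei"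
  \<comment> \<open>If the product of the norms vanishes it cannot be divided out, but
    \<open>Fg\<close> at a single \<eta> already gives zero on the left.\<close>
  proof (cases "(\<Prod>i<m. N i) = 0")
    case True
    show ?thesis using Fg[of "\<tau> + 1"] unfolding True by simp
  next
    case False
    have Nfin: "(\<Prod>i<m. N i) < top"
      unfolding less_top[symmetric] ennreal_prod_eq_top using N by force
    have "(\<Prod>i<m. F i \<tau>) / (\<Prod>i<m. N i) \<le> g \<eta>" if "\<tau> < \<eta>" for \<eta>
      using Fg[OF that] False Nfin by (subst ennreal_divide_le_iff) (auto simp: mult.commute)
    then have "(\<Prod>i<m. F i \<tau>) / (\<Prod>i<m. N i) \<le> Ei"
      unfolding Ei_def ess_inf_on_def by (intro Sup_upper) auto
    then show ?thesis using False Nfin by (subst (asm) ennreal_divide_le_iff) (auto simp: mult.commute)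
  qed
  have LE: "Le * Ei \<le> A * ennreal (\<phi>2 x0 r) * W"
  proof -
    have "inverse (ennreal (\<phi>2 (fst (x0, r)) (snd (x0, r)))) *
     (SUP t \<in> {snd (x0, r)<..}.
        ennreal ((1 + ln (t / snd (x0, r))) ^ m) *
        ess_inf_on {t<..} (\<lambda>\<eta>. \<Prod>i<m. ennreal (\<phi>1 i (fst (x0, r)) \<eta>) *
             enn_powr (\<integral>\<^sup>+ y \<in> ball (fst (x0, r)) \<eta>. ennreal (\<omega> i y powr p i) \<partial>lebesgue) (1 / p i))
        / (\<Prod>i<m. enn_powr (\<integral>\<^sup>+ y \<in> ball (fst (x0, r)) t. ennreal (\<omega> i y powr q i) \<partial>lebesgue) (1 / q i))) \<le> A"
      unfolding A_def A_prime_const_def using r by (intro SUP_upper) simp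
    then have "(SUP t \<in> {r<..}.
        ennreal ((1 + ln (t / r)) ^ m) *
        ess_inf_on {t<..} (\<lambda>\<eta>. \<Prod>i<m. ennreal (\<phi>1 i x0 \<eta>) *
             enn_powr (\<integral>\<^sup>+ y \<in> ball x0 \<eta>. ennreal (\<omega> i y powr p i) \<partial>lebesgue) (1 / p i))
        / (\<Prod>i<m. enn_powr (\<integral>\<^sup>+ y \<in> ball x0 t. ennreal (\<omega> i y powr q i) \<partial>lebesgue) (1 / q i))) \<le> A * ennreal (\<phi>2 x0 r)"
      unfolding fst_conv snd_conv by (rule ennreal_le_of_inverse_mult) (auto simp: A)
    then have "Le * Ei / W \<le> A * ennreal (\<phi>2 x0 r)"
      unfolding SUP_le_iff Le_def Ei_def g_def[abs_def] W_def wmeas_def w_def using r(2) by blast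
    then show ?thesis using W by (subst (asm) ennreal_divide_le_iff) (auto simp: less_top)
  qed
  have "Le * (\<Prod>i<m. F i \<tau>) \<le> Le * ((\<Prod>i<m. N i) * Ei)" by (intro mult_left_mono FE) simp
  also have "\<dots> = (\<Prod>i<m. N i) * (Le * Ei)" by (simp only: ac_simps)
  also have "\<dots> \<le> (\<Prod>i<m. N i) * (A * ennreal (\<phi>2 x0 r) * W)" by (intro mult_left_mono LE) simp
  also have "\<dots> = (A * ennreal (\<phi>2 x0 r) * (\<Prod>i<m. N i)) * W" by (simp only: ac_simps)
  finally show ?thesis unfolding Le_def W_def .
qed

end

theorem theorem1p2:
  fixes m :: nat
    and p q \<alpha> :: "nat \<Rightarrow> real"
    and qq :: real
    and \<omega> :: "nat \<Rightarrow> 'a::euclidean_space \<Rightarrow> real"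
    and \<phi>1 :: "nat \<Rightarrow> 'a \<Rightarrow> real \<Rightarrow> real"
    and \<phi>2 :: "'a \<Rightarrow> real \<Rightarrow> real"
  assumes m2: "2 \<le> m"
    and p_range: "\<forall>i<m. 1 < p i"
    and q_pos: "\<forall>i<m. 0 < q i"
    and alpha_def: "\<forall>i<m. \<alpha> i / real DIM('a) = 1 / p i - 1 / q i"
    and alpha_range: "\<forall>i<m. 0 < \<alpha> i / real DIM('a) \<and> \<alpha> i / real DIM('a) < 1"
    and qq_def: "1 / qq = (\<Sum>i<m. 1 / q i)"
    and om_nonneg: "\<forall>i<m. \<forall>y. 0 \<le> \<omega> i y"
    and om_AP: "A_multi m p qq \<omega>"
    and om_Ainf: "\<forall>i<m. A_infty (\<lambda>y. \<omega> i y powr q i)"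
    and phi1_meas: "\<forall>i<m. (\<lambda>z. \<phi>1 i (fst z) (snd z)) \<in> borel_measurable (lebesgue_on (UNIV \<times> {0<..}))"
    and phi2_meas: "(\<lambda>z. \<phi>2 (fst z) (snd z)) \<in> borel_measurable (lebesgue_on (UNIV \<times> {0<..}))"
    and phi1_nonneg: "\<forall>i<m. \<forall>x. \<forall>r>0. 0 \<le> \<phi>1 i x r"
    and phi2_nonneg: "\<forall>x. \<forall>r>0. 0 \<le> \<phi>2 x r"
    and A_prime: "A_prime_const m p q \<omega> \<phi>1 \<phi>2 < top"
  shows "\<exists>C::real. 0 < C \<and>
    (\<forall>b :: nat \<Rightarrow> 'a \<Rightarrow> real. (\<forall>i<m. in_BMO (b i)) \<longrightarrow>
      (\<forall>f :: nat \<Rightarrow> 'a \<Rightarrow> real.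
         (\<forall>i<m. f i \<in> borel_measurable lebesgue \<and>
                 in_morrey (p i) (\<phi>1 i) (\<lambda>y. \<omega> i y powr p i) (\<lambda>y. ennreal \<bar>f i y\<bar>)) \<longrightarrow>
         in_morrey qq \<phi>2 (\<lambda>y. (\<Prod>i<m. \<omega> i y) powr qq) (frac_max_comm m (\<Sum>i<m. \<alpha> i) b f) \<and>
         morrey_norm qq \<phi>2 (\<lambda>y. (\<Prod>i<m. \<omega> i y) powr qq) (frac_max_comm m (\<Sum>i<m. \<alpha> i) b f)
           \<le> ennreal C * (\<Prod>i<m. bmo_norm (b i)) *
              (\<Prod>i<m. morrey_norm (p i) (\<phi>1 i) (\<lambda>y. \<omega> i y powr p i) (\<lambda>y. ennreal \<bar>f i y\<bar>))))"
proof -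
  have pq: "p i < q i" if i: "i < m" for i
  proof -
    have "0 < p i" using p_range i by force
    moreover have "1 / q i < 1 / p i" using alpha_def alpha_range i by force
    ultimately show ?thesis using q_pos i by (simp add: field_simps)
  qed
  interpret multi_weights m p q qq \<omega>
    by standard (use m2 p_range pq qq_def om_nonneg om_AP om_Ainf in auto)
  have s_sum: "(\<Sum>i<m. \<alpha> i) / real DIM('a) - real m = - (\<Sum>i<m. s i)"
  proof -
    have "(\<Sum>i<m. s i) = (\<Sum>i<m. 1 - \<alpha> i / real DIM('a))"
      using alpha_def by (intro sum.cong refl) (auto simp: s_def)
    then show ?thesis by (simp add: sum_subtractf sum_divide_distrib)
  qed
  obtain D where D: "0 < D" "\<And>x r. 0 < r \<Longrightarrow> (\<Prod>i<m. enn_powr (wmeas (w i) (ball x r)) (qq / q i)) \<le> ennreal D * wmeas u (ball x r)"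
    using geometric_mean by auto
  have "\<forall>i\<in>{..<m}. \<exists>C. comm_estimates C (p i) (q i) (\<omega> i)"
  proof
    fix i assume "i \<in> {..<m}"
    then have i: "i < m" by simp
    obtain K where K: "muckenhoupt (\<theta> i) K (w i) (v i)" using single_weights[OF i] by auto
    show "\<exists>C. comm_estimates C (p i) (q i) (\<omega> i)"
      using K unfolding \<theta>_def s_def w_def[abs_def] v_def[abs_def]
      by (intro comm_estimates_exist[where K=K] p1 pq i om_meas) (auto intro: om0[OF i])
  qed
  from bchoice[OF this] obtain Cc where Cc: "\<And>i. i < m \<Longrightarrow> comm_estimates (Cc i) (p i) (q i) (\<omega> i)" by auto
  define Cst where "Cst = (2 powr qq * 2) powr (1 / qq) * (\<Prod>i<m. Cc i powr (1 / q i) * Cc i powr (1 / q i) + Cc i * Cc i powr (1 / q i)) * D powr (1 / qq)"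
  have Cst: "0 \<le> Cst"
  proof -
    have "0 \<le> Cc i powr (1 / q i) * Cc i powr (1 / q i) + Cc i * Cc i powr (1 / q i)" if "i < m" for i
      using Cc[OF that] by (simp add: comm_estimates_def)
    then show ?thesis unfolding Cst_def by (intro mult_nonneg_nonneg prod_nonneg) auto
  qed
  obtain A where A: "A_prime_const m p q \<omega> \<phi>1 \<phi>2 = ennreal A" "0 \<le> A"
    using A_prime by (cases "A_prime_const m p q \<omega> \<phi>1 \<phi>2") auto
  \<comment> \<open>The summand 1 makes the constant positive even if the condition has constant
    zero.\<close>
  define C where "C = Cst * A + 1"
  have C: "0 < C" using Cst A by (simp add: C_def add_nonneg_pos)
  have "in_morrey qq \<phi>2 u (frac_max_comm m (\<Sum>i<m. \<alpha> i) b f) \<and>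
         morrey_norm qq \<phi>2 u (frac_max_comm m (\<Sum>i<m. \<alpha> i) b f)
           \<le> ennreal C * (\<Prod>i<m. bmo_norm (b i)) *
              (\<Prod>i<m. morrey_norm (p i) (\<phi>1 i) (\<lambda>y. \<omega> i y powr p i) (\<lambda>y. ennreal \<bar>f i y\<bar>))"
    if b: "\<forall>i<m. in_BMO (b i)" and f: "\<forall>i<m. f i \<in> borel_measurable lebesgue \<and>
                 in_morrey (p i) (\<phi>1 i) (\<lambda>y. \<omega> i y powr p i) (\<lambda>y. ennreal \<bar>f i y\<bar>)" for b f :: "nat \<Rightarrow> 'a \<Rightarrow> real"
  proof -
    define N where "N i = morrey_norm (p i) (\<phi>1 i) (\<lambda>y. \<omega> i y powr p i) (\<lambda>y. ennreal \<bar>f i y\<bar>)" for i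
    have Nfin: "N i < top" and fm: "f i \<in> borel_measurable lebesgue" and bm: "b i \<in> borel_measurable lebesgue"
      and bfin: "bmo_norm (b i) < top" if "i < m" for i
      using f b that by (auto simp: N_def in_morrey_def in_BMO_def)
    define T where "T = frac_max_comm m (\<Sum>i<m. \<alpha> i) b f"
    have T_eq: "T x = (SUP t\<in>{0<..}. ennreal (measure lebesgue (ball x t) powr (- (\<Sum>i<m. s i))) *
      (\<Prod>i<m. \<integral>\<^sup>+ y \<in> ball x t. ennreal (\<bar>b i x - b i y\<bar> * \<bar>f i y\<bar>) \<partial>lebesgue))" for x
      unfolding T_def by (rule frac_max_comm_eq) (auto simp: bm fm s_sum)
    have s_nonneg: "0 \<le> (\<Sum>i<m. s i)" using ex(1) by (intro sum_nonneg) (auto simp: less_imp_le)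
    \<comment> \<open>Membership in the target space includes measurability, here of a supremum over
      uncountably many radii.\<close>
    have Tm: "T \<in> borel_measurable lebesgue"
    proof -
      have "(\<lambda>x. SUP t\<in>{0<..}. ennreal (measure lebesgue (ball x t) powr (- (\<Sum>i<m. s i))) *
        (\<Prod>i\<in>{..<m}. \<integral>\<^sup>+ y \<in> ball x t. ennreal (\<bar>b i x - b i y\<bar> * \<bar>f i y\<bar>) \<partial>lebesgue)) \<in> borel_measurable lebesgue"
      proof (rule borel_measurable_frac_max)
        fix i assume "i \<in> {..<m}"
        then have i: "i < m" by simp
        note [measurable] = bm[OF i] fm[OF i]
        show "(\<lambda>(x, y). ennreal (\<bar>b i x - b i y\<bar> * \<bar>f i y\<bar>)) \<in> borel_measurable (lebesgue \<Otimes>\<^sub>M lebesgue)"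
          by (rule borel_measurable_commutator_kernel) (auto simp: bm fm i)
        show "(\<lambda>y. ennreal (\<bar>b i x - b i y\<bar> * \<bar>f i y\<bar>)) \<in> borel_measurable lebesgue" for x by measurable
      qed (use s_nonneg in auto)
      then show ?thesis unfolding T_eq[abs_def, symmetric] by (simp add: T_eq[symmetric])
    qed
    have bound: "morrey_norm qq \<phi>2 u T \<le> ennreal C * (\<Prod>i<m. ennreal (\<beta> i)) * (\<Prod>i<m. N i)"
      if \<beta>: "\<And>i. i < m \<Longrightarrow> 0 < \<beta> i" "\<And>i. i < m \<Longrightarrow> bmo_norm (b i) \<le> ennreal (\<beta> i)" for \<beta> :: "nat \<Rightarrow> real"
      unfolding morrey_norm_def
    proof (rule SUP_least)
      fix xr :: "'a \<times> real" assume "xr \<in> {xr. 0 < snd xr}"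
      then have r: "0 < snd xr" by simp
      define x0 where "x0 = fst xr"
      define r where "r = snd xr"
      have r: "0 < r" using r by (simp add: r_def)
      define I where "I = enn_powr (\<integral>\<^sup>+ y \<in> ball x0 r. enn_powr (T y) qq * ennreal (u y) \<partial>lebesgue) (1 / qq)"
      define Wu where "Wu = enn_powr (wmeas u (ball x0 r)) (1 / qq)"
      have "I \<le> ennreal Cst * (ennreal A * ennreal (\<phi>2 x0 r) * (\<Prod>i<m. N i) * (\<Prod>i<m. ennreal (\<beta> i)) * Wu)"
        unfolding I_def Wu_def Cst_def T_eq
      proof (rule local_estimate[OF Cc D _ \<beta> fm r])
        fix \<tau> assume "r < \<tau>"
        from morrey_product_bound[of \<phi>1 \<phi>2 f r \<tau> x0, OF A_prime _ r this] Nfin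
        show "ennreal ((1 + ln (\<tau> / r)) ^ m) * (\<Prod>i<m. enn_powr (\<integral>\<^sup>+ y \<in> ball x0 \<tau>. enn_powr (ennreal \<bar>f i y\<bar>) (p i) * ennreal (\<omega> i y powr p i) \<partial>lebesgue) (1 / p i))
           \<le> ennreal A * ennreal (\<phi>2 x0 r) * (\<Prod>i<m. N i) * (\<Prod>i<m. enn_powr (wmeas (w i) (ball x0 \<tau>)) (1 / q i))"
          unfolding N_def A(1) by blast
      qed (use b in auto)
      also have "\<dots> = (ennreal Cst * ennreal A * (\<Prod>i<m. ennreal (\<beta> i)) * (\<Prod>i<m. N i)) * (ennreal (\<phi>2 x0 r) * Wu)"
        by (simp only: ac_simps)
      also have "\<dots> \<le> (ennreal C * (\<Prod>i<m. ennreal (\<beta> i)) * (\<Prod>i<m. N i)) * (ennreal (\<phi>2 x0 r) * Wu)"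
        using Cst A by (intro mult_right_mono) (auto simp: C_def ennreal_mult[symmetric] intro!: ennreal_leI)
      finally have "inverse (ennreal (\<phi>2 x0 r) * Wu) * I \<le> ennreal C * (\<Prod>i<m. ennreal (\<beta> i)) * (\<Prod>i<m. N i)"
        by (rule ennreal_inverse_mult_le) (use wmeas_u[OF r, of x0] in \<open>auto simp: Wu_def ennreal_mult_less_top\<close>)
      moreover have "inverse (ennreal (\<phi>2 x0 r) * Wu) = inverse (ennreal (\<phi>2 x0 r)) * inverse Wu"
        using wmeas_u[OF r, of x0] by (intro ennreal_inverse_mult) (auto simp: Wu_def)
      ultimately show "inverse (ennreal (\<phi>2 (fst xr) (snd xr))) * inverse (enn_powr (wmeas u (ball (fst xr) (snd xr))) (1 / qq)) *
          enn_powr (\<integral>\<^sup>+ y \<in> ball (fst xr) (snd xr). enn_powr (T y) qq * ennreal (u y) \<partial>lebesgue) (1 / qq)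
          \<le> ennreal C * (\<Prod>i<m. ennreal (\<beta> i)) * (\<Prod>i<m. N i)"
        by (simp add: I_def Wu_def x0_def r_def)
    qed
    define n where "n i = enn2real (bmo_norm (b i))" for i
    have n: "bmo_norm (b i) = ennreal (n i)" "0 \<le> n i" if "i < m" for i using bfin[OF that] by (auto simp: n_def)
    have NN: "(\<Prod>i<m. N i) < top" unfolding less_top[symmetric] ennreal_prod_eq_top using Nfin by force
    then obtain P where P: "(\<Prod>i<m. N i) = ennreal P" "0 \<le> P" by (cases "\<Prod>i<m. N i") auto
    \<comment> \<open>\<open>bound\<close> asks for positive \<beta> i, while a norm may be zero: it
      is applied to \<open>n i + d\<close>, and d tends to zero from above.\<close>
    have "morrey_norm qq \<phi>2 u T \<le> ennreal (C * (\<Prod>i<m. n i) * P)"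
    proof (rule tendsto_lowerbound)
      have "((\<lambda>d. C * (\<Prod>i<m. n i + d) * P) \<longlongrightarrow> C * (\<Prod>i<m. n i + 0) * P) (at_right 0)"
        by (intro tendsto_intros)
      then show "((\<lambda>d. ennreal (C * (\<Prod>i<m. n i + d) * P)) \<longlongrightarrow> ennreal (C * (\<Prod>i<m. n i) * P)) (at_right 0)"
        by (intro tendsto_ennrealI) simp
      have "morrey_norm qq \<phi>2 u T \<le> ennreal (C * (\<Prod>i<m. n i + d) * P)" if d: "0 < d" for d
      proof -
        have "morrey_norm qq \<phi>2 u T \<le> ennreal C * (\<Prod>i<m. ennreal (n i + d)) * (\<Prod>i<m. N i)"
          using n d by (intro bound) (auto intro: ennreal_leI add_nonneg_pos)
        also have "(\<Prod>i<m. ennreal (n i + d)) = ennreal (\<Prod>i<m. n i + d)" using n d by (intro prod_ennreal) auto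
        also have "ennreal C * ennreal (\<Prod>i<m. n i + d) * (\<Prod>i<m. N i) = ennreal (C * (\<Prod>i<m. n i + d) * P)"
        proof -
          have "0 \<le> (\<Prod>i<m. n i + d)" using n(2) d by (intro prod_nonneg) (force intro: add_nonneg_nonneg)
          then show ?thesis unfolding P(1) using C P(2) by (simp add: ennreal_mult)
        qed
        finally show ?thesis .
      qed
      then show "\<forall>\<^sub>F d in at_right 0. morrey_norm qq \<phi>2 u T \<le> ennreal (C * (\<Prod>i<m. n i + d) * P)"
        by (auto simp: eventually_at_right_field intro!: exI[of _ 1])
    qed simp
    also have "\<dots> = ennreal C * (\<Prod>i<m. bmo_norm (b i)) * (\<Prod>i<m. N i)"
    proof -
      have "(\<Prod>i<m. bmo_norm (b i)) = (\<Prod>i<m. ennreal (n i))" using n by (intro prod.cong refl) auto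
      also have "\<dots> = ennreal (\<Prod>i<m. n i)" using n by (intro prod_ennreal) auto
      finally have eq: "(\<Prod>i<m. bmo_norm (b i)) = ennreal (\<Prod>i<m. n i)" .
      have "0 \<le> (\<Prod>i<m. n i)" using n(2) by (intro prod_nonneg) auto
      then show ?thesis unfolding P(1) eq using C P(2) by (simp add: ennreal_mult)
    qed
    finally have main: "morrey_norm qq \<phi>2 u T \<le> ennreal C * (\<Prod>i<m. bmo_norm (b i)) * (\<Prod>i<m. N i)" .
    moreover have "\<dots> < top"
    proof -
      have "(\<Prod>i<m. bmo_norm (b i)) < top" unfolding less_top[symmetric] ennreal_prod_eq_top using bfin by force
      then show ?thesis using NN by (simp add: ennreal_mult_less_top)
    qed
    ultimately have "in_morrey qq \<phi>2 u T" unfolding in_morrey_def using Tm by (auto intro: le_less_trans)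
    then show ?thesis using main unfolding T_def N_def by blast
  qed
  then show ?thesis
    using C unfolding u_def[abs_def] by (intro exI[of _ C]) blast
qed

end
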